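(* There exists a 1-to-1 correspondence between Lie 3-algebras and 3-term Lie infinity algebras $(V,\ell_p)$ whose structure maps $\ell_2$ and $\ell_3$ vanish on $V_1\times V_1$ and on triplets of total degree $1$, respectively.
   Context: All vector spaces are over a fixed field. Categories are strict. **Linear 2-categories.** An $n$-globular vector space is a sequence of vector spaces and linear source/target maps $L_n\rightrightarrows L_{n-1}\rightrightarrows\cdots\rightrightarrows L_0\rightrightarrows 0$ with $s(s(a))=s(t(a))$, $t(s(a))=t(t(a))$. Elements of $L_m$ are $m$-cells. Two $m$-cells $a,b$ are composable along a $p$-cell ($p<m$) if $t^{m-p}(a)=s^{m-p}(b)$; the space of such pairs is $L_m\times_{L_p}L_m$. A linear $n$-category is an $n$-globular vector space with linear compositions $\circ_p:L_m\times_{L_p}L_m\to L_m$ (written $a\circ_p b$, the cell acting first on the left) and linear identities $1:L_m\to L_{m+1}$ such that: $s(a\circ_{m-1}b)=s(a)$, $t(a\circ_{m-1}b)=t(b)$; for $p\le m-2$, $s(a\circ_pb)=s(a)\circ_ps(b)$ and $t(a\circ_pb)=t(a)\circ_pt(b)$; $s(1_a)=t(1_a)=a$; $\circ_p$ is associative; $1^{m-p}_{s^{m-p}a}\circ_pa=a=a\circ_p1^{m-p}_{t^{m-p}a}$; for $q<p$, $(a\circ_pb)\circ_q(c\circ_pd)=(a\circ_qc)\circ_p(b\circ_qd)$ whenever defined; $1_{a\circ_pb}=1_a\circ_p1_b$. Here $1^k$ denotes $k$-fold iterated identity. Set $V_i=\ker (s|_{L_i})$. One identifies $L_m$ with $\bigoplus_{i=0}^mV_i$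 via $(v_0,\dots,v_m)\mapsto 1^m_{v_0}+\dots+1_{v_{m-1}}+v_m$. Then $s(v_0,\ldots,v_m)=(v_0,\ldots,v_{m-1})$, $t(v_0,\ldots,v_m)=(v_0,\ldots,v_{m-1}+tv_m)$, $1_{(v_0,\ldots,v_m)}=(v_0,\ldots,v_m,0)$, $(v_0,\ldots,v_m)\circ_p(v_0',\ldots,v_m')=(v_0,\ldots,v_p,v_{p+1}+v_{p+1}',\ldots,v_m+v_m')$. **Multilinear functors, transformations, modifications.** A bilinear (multilinear) 2-functor $F:L\times L'\to L''$ between linear 2-categories is a family of bilinear (multilinear) maps on $m$-cells, $m=0,1,2$, respecting sources, targets, identities and compositions. A multilinear natural 2-transformation $\theta:F\Rightarrow G$ assigns to each tuple $a$ of $0$-cells a 1-cell $\theta_a:F(a)\to G(a)$, multilinear in $a$, such that for every 2-cell (tuple) $\alpha:f\Rightarrow g$, $f,g:a\to b$: $F(\alpha)\circ_01_{\theta_b}=1_{\theta_a}\circ_0G(\alpha)$. A multilinear 2-modification $\mu:\eta\Rrightarrow\varepsilon$ between natural 2-transformations $\eta,\varepsilon:F\Rightarrow G$ assigns to each tuple $a$ of 0-cells a 2-cell $\mu_a:\eta_a\Rightarrow\varepsilon_a$, multilinear in $a$, with $F(\alpha)\circ_0\mu_b=\mu_a\circ_0G(\alpha)$ for all $\alpha:f\Rightarrow g$, $f,g:a\to b$. A natural 2-transformation $J$ (resp. 2-modification $\mu$) is skew-symmetric if the $V_1$-component of $J_{xyz}\in L_1=V_0\oplus V_1$ (resp. the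 $V_2$-component of $\mu_{xyzu}\in L_2=V_0\oplus V_1\oplus V_2$) is antisymmetric. **Lie 3-algebra.** A Lie 3-algebra is a linear 2-category $L$ with an antisymmetric bilinear 2-functor (bracket) $[-,-]:L\times L\to L$, a skew-symmetric trilinear natural 2-transformation (Jacobiator) $J_{xyz}:[[x,y],z]\to[[x,z],y]+[x,[y,z]]$ ($x,y,z\in L_0$), and a skew-symmetric quadrilinear 2-modification (Identiator) $$\mu_{xyzu}:[J_{x,y,z},1_u]\circ_0(J_{[x,z],y,u}+J_{x,[y,z],u})\circ_0([J_{xzu},1_y]+1)\circ_0([1_x,J_{yzu}]+1)$$ $$\Rightarrow J_{[x,y],z,u}\circ_0([J_{xyu},1_z]+1)\circ_0(J_{x,[y,u],z}+J_{[x,u],y,z}+J_{x,y,[z,u]})$$ ($x,y,z,u\in L_0$; each symbol $1$ without index is the identity 1-cell of the 0-cell determined by composability), satisfying for all $x,y,z,u,v\in L_0$ the coherence law $$\alpha_1+\alpha_4^{-1}=\alpha_3+\alpha_2^{-1},$$ where for a 2-cell $\alpha=(A,\mathbf s,\mathbf a)\in L_2$ with target $(A,\mathbf t)$ one sets $\alpha^{-1}=(A,\mathbf t,-\mathbf a)$ (inverse for composition along a 1-cell), and, with every $1^2$ without index denoting the identity 2-cell of the 0-cell determined by composability (and $1_f$ the identity 2-cell of a 1-cell $f$): $\alpha_1=1_{11}\circ_0(\mu_{x,y,z,[u,v]}+[\mu_{xyzv},1^2_u])\circ_01_{12}\circ_0(\mu_{[x,v],y,z,u}+\mu_{x,[y,v],z,u}+\mu_{x,y,[z,v],u}+1^2)$,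 with $1_{11}=1_{J_{[[x,y],z],u,v}}$, $1_{12}=1_{[J_{x,[z,v],y},1_u]+[J_{[x,v],z,y},1_u]+[J_{x,z,[y,v]},1_u]}+1^2$. $\alpha_4=[\mu_{xyzu},1^2_v]\circ_01_{41}\circ_0(\mu_{[x,u],y,z,v}+\mu_{x,[y,u],z,v}+\mu_{x,y,[z,u],v})\circ_01_{42}$, with $1_{41}=1_{[J_{[x,u],z,y},1_v]+[J_{x,z,[y,u]},1_v]+[J_{x,[z,u],y},1_v]}+1^2$, $1_{42}=1_{[[J_{xuv},1_z],1_y]+[J_{xuv},1_{[y,z]}]+[1_x,[J_{yuv},1_z]]+[[1_x,J_{zuv}],1_y]+[1_x,[1_y,J_{zuv}]]+[1_{[x,z]},J_{yuv}]}+1^2$. $\alpha_3=\mu_{[x,y],z,u,v}\circ_01_{31}\circ_0([\mu_{xyuv},1^2_z]+1^2)\circ_01_{32}\circ_01_{33}$, with $1_{31}=1_{[J_{[x,y],v,u},1_z]}+1^2$; $1_{32}=1_{h}$ where $h=[J_{xyv},1_{[z,u]}]+J_{x,y,[[z,v],u]}+J_{x,y,[z,[u,v]]}+J_{[[x,v],u],y,z}+J_{[x,v],[y,u],z}+J_{[x,u],[y,v],z}+J_{x,[[y,v],u],z}+J_{[x,[u,v]],y,z}+J_{x,[y,[u,v]],z}+[J_{xyu},1_{[z,v]}]$; $1_{33}=1_{J_{x,[y,v],[z,u]}+J_{[x,v],y,[z,u]}+J_{x,[y,u],[z,v]}+J_{[x,u],y,[z,v]}}+1^2$. $\alpha_2=1_{21}\circ_0(\mu_{[x,z],y,u,v}+\mu_{x,[y,z],u,v})\circ_01_{22}\circ_0([1^2_x,\mu_{yzuv}]+[\mu_{xzuv},1^2_y]+1^2)\circ_01_{23}$,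 with $1_{21}=1_{[[J_{xyz},1_u],1_v]}$, $1_{22}=1_{[1_x,J_{[y,z],v,u}]+[J_{[x,z],v,u},1_y]}+1^2$, $1_{23}=1_{[J_{xzv},1_{[y,u]}]+[J_{xzu},1_{[y,v]}]+[1_{[x,v]},J_{yzu}]+[1_{[x,u]},J_{yzv}]}+1^2$. **3-term Lie infinity algebra.** A graded vector space $V=V_0\oplus V_1\oplus V_2$ with graded antisymmetric $p$-linear maps $\ell_p$ of weight (degree) $p-2$, $p=1,2,3,4$ (higher ones vanish), such that for all $n\ge1$ and homogeneous $a_1,\dots,a_n\in V$ $$\sum_{i+j=n+1}\ \sum_{(i,n-i)\text{-shuffles }\sigma}\chi(\sigma)(-1)^{i(j-1)}\ell_j(\ell_i(a_{\sigma_1},\ldots,a_{\sigma_i}),a_{\sigma_{i+1}},\ldots,a_{\sigma_n})=0,$$ where $\chi(\sigma)$ is the product of the signature of $\sigma$ and the Koszul sign. In the correspondence linear 2-categories $L$ are taken up to the identification $L_m=\bigoplus_{i\le m}V_i$ above; the underlying 3-term complex of $L$ has $V_m=\ker s_m$ and differential $\ell_1=t|_{V_m}$. *)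

theory Defs
  imports Complex_Main "HOL-Library.Product_Plus" "HOL-Combinatorics.Permutations"
begin

section \<open>Multilinear maps on tuples\<close>

text \<open>An n-tuple is a list of length n; values on lists of other lengths are irrelevant.\<close>

definition multilinear ::
  "nat \<Rightarrow> ('k::field \<Rightarrow> 'x::ab_group_add \<Rightarrow> 'x) \<Rightarrow> ('k \<Rightarrow> 'y::ab_group_add \<Rightarrow> 'y)
    \<Rightarrow> ('x list \<Rightarrow> 'y) \<Rightarrow> bool" where
  "multilinear n s s' F \<longleftrightarrow>
     (\<forall>xs i. length xs = n \<and> i < n \<longrightarrow> Vector_Spaces.linear s s' (\<lambda>x. F (xs[i := x])))"

definition antisymmetric :: "nat \<Rightarrow> ('x list \<Rightarrow> 'y::ab_group_add) \<Rightarrow> bool" where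
  "antisymmetric n F \<longleftrightarrow>
     (\<forall>xs i j. length xs = n \<and> i < j \<and> j < n \<longrightarrow> F (xs[i := xs ! j, j := xs ! i]) = - F xs)"

definition scale_prod ::
  "('k \<Rightarrow> 'x \<Rightarrow> 'x) \<Rightarrow> ('k \<Rightarrow> 'y \<Rightarrow> 'y) \<Rightarrow> 'k \<Rightarrow> 'x \<times> 'y \<Rightarrow> 'x \<times> 'y" where
  "scale_prod s s' r = map_prod (s r) (s' r)"


section \<open>Linear 2-categories\<close>

text \<open>\<open>comp10\<close> composes 1-cells along a 0-cell, \<open>comp20\<close> and \<open>comp21\<close> compose 2-cells along
  a 0-cell and along a 1-cell. Composition is written in diagrammatic order.\<close>

record ('a, 'b, 'c) two_cat =
  src1 :: "'b \<Rightarrow> 'a"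
  tgt1 :: "'b \<Rightarrow> 'a"
  src2 :: "'c \<Rightarrow> 'b"
  tgt2 :: "'c \<Rightarrow> 'b"
  one0 :: "'a \<Rightarrow> 'b"
  one1 :: "'b \<Rightarrow> 'c"
  comp10 :: "'b \<Rightarrow> 'b \<Rightarrow> 'b"
  comp20 :: "'c \<Rightarrow> 'c \<Rightarrow> 'c"
  comp21 :: "'c \<Rightarrow> 'c \<Rightarrow> 'c"

definition able10 :: "('a, 'b, 'c, 'm) two_cat_scheme \<Rightarrow> 'b \<Rightarrow> 'b \<Rightarrow> bool" where
  "able10 C f g \<longleftrightarrow> tgt1 C f = src1 C g"

definition able20 :: "('a, 'b, 'c, 'm) two_cat_scheme \<Rightarrow> 'c \<Rightarrow> 'c \<Rightarrow> bool" where
  "able20 C \<alpha> \<beta> \<longleftrightarrow> tgt1 C (tgt2 C \<alpha>) = src1 C (src2 C \<beta>)"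

definition able21 :: "('a, 'b, 'c, 'm) two_cat_scheme \<Rightarrow> 'c \<Rightarrow> 'c \<Rightarrow> bool" where
  "able21 C \<alpha> \<beta> \<longleftrightarrow> tgt2 C \<alpha> = src2 C \<beta>"

text \<open>A composition is a linear map on the space of composable pairs only. As HOL functions are
  total, it is given the dummy value 0 on all other pairs, so that equality of structures
  is equality of the actual compositions.\<close>

definition linear_composition ::
  "('k \<Rightarrow> 'x::ab_group_add \<Rightarrow> 'x) \<Rightarrow> ('x \<Rightarrow> 'x \<Rightarrow> bool) \<Rightarrow> ('x \<Rightarrow> 'x \<Rightarrow> 'x) \<Rightarrow> bool" where
  "linear_composition s able cmp \<longleftrightarrow>
     (\<forall>a b a' b'. able a b \<and> able a' b' \<longrightarrow> cmp (a + a') (b + b') = cmp a b + cmp a' b') \<and>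
     (\<forall>r a b. able a b \<longrightarrow> cmp (s r a) (s r b) = s r (cmp a b)) \<and>
     (\<forall>a b. \<not> able a b \<longrightarrow> cmp a b = 0)"

locale linear_2_category =
  L0: vector_space sc0 + L1: vector_space sc1 + L2: vector_space sc2
  for sc0 :: "'k::field \<Rightarrow> 'a::ab_group_add \<Rightarrow> 'a"
    and sc1 :: "'k \<Rightarrow> 'b::ab_group_add \<Rightarrow> 'b"
    and sc2 :: "'k \<Rightarrow> 'c::ab_group_add \<Rightarrow> 'c" +
  fixes C :: "('a, 'b, 'c, 'm) two_cat_scheme"
  assumes lin_src1: "Vector_Spaces.linear sc1 sc0 (src1 C)"
    and lin_tgt1: "Vector_Spaces.linear sc1 sc0 (tgt1 C)"
    and lin_src2: "Vector_Spaces.linear sc2 sc1 (src2 C)"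
    and lin_tgt2: "Vector_Spaces.linear sc2 sc1 (tgt2 C)"
    and lin_one0: "Vector_Spaces.linear sc0 sc1 (one0 C)"
    and lin_one1: "Vector_Spaces.linear sc1 sc2 (one1 C)"
    and lin_comp10: "linear_composition sc1 (able10 C) (comp10 C)"
    and lin_comp20: "linear_composition sc2 (able20 C) (comp20 C)"
    and lin_comp21: "linear_composition sc2 (able21 C) (comp21 C)"
    and glob_src: "src1 C (src2 C \<alpha>) = src1 C (tgt2 C \<alpha>)"
    and glob_tgt: "tgt1 C (src2 C \<alpha>) = tgt1 C (tgt2 C \<alpha>)"
    and src_comp10: "able10 C f g \<Longrightarrow> src1 C (comp10 C f g) = src1 C f"
    and tgt_comp10: "able10 C f g \<Longrightarrow> tgt1 C (comp10 C f g) = tgt1 C g"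
    and src_comp21: "able21 C \<alpha> \<beta> \<Longrightarrow> src2 C (comp21 C \<alpha> \<beta>) = src2 C \<alpha>"
    and tgt_comp21: "able21 C \<alpha> \<beta> \<Longrightarrow> tgt2 C (comp21 C \<alpha> \<beta>) = tgt2 C \<beta>"
    and src_comp20: "able20 C \<alpha> \<beta> \<Longrightarrow>
      src2 C (comp20 C \<alpha> \<beta>) = comp10 C (src2 C \<alpha>) (src2 C \<beta>)"
    and tgt_comp20: "able20 C \<alpha> \<beta> \<Longrightarrow>
      tgt2 C (comp20 C \<alpha> \<beta>) = comp10 C (tgt2 C \<alpha>) (tgt2 C \<beta>)"
    and src_one0: "src1 C (one0 C x) = x"
    and tgt_one0: "tgt1 C (one0 C x) = x"
    and src_one1: "src2 C (one1 C f) = f"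
    and tgt_one1: "tgt2 C (one1 C f) = f"
    and assoc10: "able10 C f g \<Longrightarrow> able10 C g h \<Longrightarrow>
      comp10 C (comp10 C f g) h = comp10 C f (comp10 C g h)"
    and assoc20: "able20 C \<alpha> \<beta> \<Longrightarrow> able20 C \<beta> \<gamma> \<Longrightarrow>
      comp20 C (comp20 C \<alpha> \<beta>) \<gamma> = comp20 C \<alpha> (comp20 C \<beta> \<gamma>)"
    and assoc21: "able21 C \<alpha> \<beta> \<Longrightarrow> able21 C \<beta> \<gamma> \<Longrightarrow>
      comp21 C (comp21 C \<alpha> \<beta>) \<gamma> = comp21 C \<alpha> (comp21 C \<beta> \<gamma>)"
    and unit10_left: "comp10 C (one0 C (src1 C f)) f = f"
    and unit10_right: "comp10 C f (one0 C (tgt1 C f)) = f"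
    and unit20_left: "comp20 C (one1 C (one0 C (src1 C (src2 C \<alpha>)))) \<alpha> = \<alpha>"
    and unit20_right: "comp20 C \<alpha> (one1 C (one0 C (tgt1 C (tgt2 C \<alpha>)))) = \<alpha>"
    and unit21_left: "comp21 C (one1 C (src2 C \<alpha>)) \<alpha> = \<alpha>"
    and unit21_right: "comp21 C \<alpha> (one1 C (tgt2 C \<alpha>)) = \<alpha>"
    and interchange: "able21 C \<alpha> \<beta> \<Longrightarrow> able21 C \<gamma> \<delta> \<Longrightarrow> able20 C \<alpha> \<gamma> \<Longrightarrow> able20 C \<beta> \<delta> \<Longrightarrow>
      comp20 C (comp21 C \<alpha> \<beta>) (comp21 C \<gamma> \<delta>) = comp21 C (comp20 C \<alpha> \<gamma>) (comp20 C \<beta> \<delta>)"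
    and one_comp10: "able10 C f g \<Longrightarrow>
      one1 C (comp10 C f g) = comp20 C (one1 C f) (one1 C g)"

text \<open>The components of a 1-cell in \<open>V\<^sub>1 = ker s\<close> and of a 2-cell in \<open>V\<^sub>2 = ker s\<close> with respect
  to the splitting given by the identities.\<close>

definition part1 :: "('a, 'b::ab_group_add, 'c, 'm) two_cat_scheme \<Rightarrow> 'b \<Rightarrow> 'b" where
  "part1 C f = f - one0 C (src1 C f)"

definition part2 :: "('a, 'b, 'c::ab_group_add, 'm) two_cat_scheme \<Rightarrow> 'c \<Rightarrow> 'c" where
  "part2 C \<alpha> = \<alpha> - one1 C (src2 C \<alpha>)"

text \<open>\<open>(A, s, a)\<close> with target \<open>(A, t)\<close> is sent to \<open>(A, t, -a)\<close>.\<close>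

definition inverse2 :: "('a, 'b, 'c::ab_group_add, 'm) two_cat_scheme \<Rightarrow> 'c \<Rightarrow> 'c" where
  "inverse2 C \<alpha> = one1 C (tgt2 C \<alpha>) - part2 C \<alpha>"


section \<open>Multilinear 2-functors, natural 2-transformations, 2-modifications\<close>

text \<open>These are from \<open>L \<times> \<dots> \<times> L\<close> (n factors) to \<open>L\<close>; cells of the product are lists of
  length n, and its structure maps act entrywise.\<close>

record ('a, 'b, 'c) functor_data =
  on0 :: "'a list \<Rightarrow> 'a"
  on1 :: "'b list \<Rightarrow> 'b"
  on2 :: "'c list \<Rightarrow> 'c"

definition multilinear_2_functor ::
  "nat \<Rightarrow> ('k::field \<Rightarrow> 'a::ab_group_add \<Rightarrow> 'a) \<Rightarrow> ('k \<Rightarrow> 'b::ab_group_add \<Rightarrow> 'b)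
    \<Rightarrow> ('k \<Rightarrow> 'c::ab_group_add \<Rightarrow> 'c) \<Rightarrow> ('a, 'b, 'c, 'm) two_cat_scheme
    \<Rightarrow> ('a, 'b, 'c) functor_data \<Rightarrow> bool" where
  "multilinear_2_functor n sc0 sc1 sc2 C F \<longleftrightarrow>
     multilinear n sc0 sc0 (on0 F) \<and> multilinear n sc1 sc1 (on1 F) \<and>
     multilinear n sc2 sc2 (on2 F) \<and>
     (\<forall>fs. length fs = n \<longrightarrow>
        src1 C (on1 F fs) = on0 F (map (src1 C) fs) \<and>
        tgt1 C (on1 F fs) = on0 F (map (tgt1 C) fs) \<and>
        one1 C (on1 F fs) = on2 F (map (one1 C) fs)) \<and>
     (\<forall>\<alpha>s. length \<alpha>s = n \<longrightarrow>
        src2 C (on2 F \<alpha>s) = on1 F (map (src2 C) \<alpha>s) \<and>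
        tgt2 C (on2 F \<alpha>s) = on1 F (map (tgt2 C) \<alpha>s)) \<and>
     (\<forall>xs. length xs = n \<longrightarrow> one0 C (on0 F xs) = on1 F (map (one0 C) xs)) \<and>
     (\<forall>fs gs. length fs = n \<and> list_all2 (able10 C) fs gs \<longrightarrow>
        on1 F (map2 (comp10 C) fs gs) = comp10 C (on1 F fs) (on1 F gs)) \<and>
     (\<forall>\<alpha>s \<beta>s. length \<alpha>s = n \<and> list_all2 (able20 C) \<alpha>s \<beta>s \<longrightarrow>
        on2 F (map2 (comp20 C) \<alpha>s \<beta>s) = comp20 C (on2 F \<alpha>s) (on2 F \<beta>s)) \<and>
     (\<forall>\<alpha>s \<beta>s. length \<alpha>s = n \<and> list_all2 (able21 C) \<alpha>s \<beta>s \<longrightarrow>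
        on2 F (map2 (comp21 C) \<alpha>s \<beta>s) = comp21 C (on2 F \<alpha>s) (on2 F \<beta>s))"

definition multilinear_2_transformation ::
  "nat \<Rightarrow> ('k::field \<Rightarrow> 'a::ab_group_add \<Rightarrow> 'a) \<Rightarrow> ('k \<Rightarrow> 'b::ab_group_add \<Rightarrow> 'b)
    \<Rightarrow> ('a, 'b, 'c, 'm) two_cat_scheme
    \<Rightarrow> ('a, 'b, 'c) functor_data \<Rightarrow> ('a, 'b, 'c) functor_data \<Rightarrow> ('a list \<Rightarrow> 'b) \<Rightarrow> bool" where
  "multilinear_2_transformation n sc0 sc1 C F G \<theta> \<longleftrightarrow>
     multilinear n sc0 sc1 \<theta> \<and>
     (\<forall>xs. length xs = n \<longrightarrow> src1 C (\<theta> xs) = on0 F xs \<and> tgt1 C (\<theta> xs) = on0 G xs) \<and>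
     (\<forall>\<alpha>s. length \<alpha>s = n \<longrightarrow>
        comp20 C (on2 F \<alpha>s) (one1 C (\<theta> (map (\<lambda>\<alpha>. tgt1 C (tgt2 C \<alpha>)) \<alpha>s)))
        = comp20 C (one1 C (\<theta> (map (\<lambda>\<alpha>. src1 C (src2 C \<alpha>)) \<alpha>s))) (on2 G \<alpha>s))"

definition multilinear_2_modification ::
  "nat \<Rightarrow> ('k::field \<Rightarrow> 'a::ab_group_add \<Rightarrow> 'a) \<Rightarrow> ('k \<Rightarrow> 'c::ab_group_add \<Rightarrow> 'c)
    \<Rightarrow> ('a, 'b, 'c, 'm) two_cat_scheme
    \<Rightarrow> ('a, 'b, 'c) functor_data \<Rightarrow> ('a, 'b, 'c) functor_data
    \<Rightarrow> ('a list \<Rightarrow> 'b) \<Rightarrow> ('a list \<Rightarrow> 'b) \<Rightarrow> ('a list \<Rightarrow> 'c) \<Rightarrow> bool" where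
  "multilinear_2_modification n sc0 sc2 C F G \<eta> \<epsilon> \<mu> \<longleftrightarrow>
     multilinear n sc0 sc2 \<mu> \<and>
     (\<forall>xs. length xs = n \<longrightarrow> src2 C (\<mu> xs) = \<eta> xs \<and> tgt2 C (\<mu> xs) = \<epsilon> xs) \<and>
     (\<forall>\<alpha>s. length \<alpha>s = n \<longrightarrow>
        comp20 C (on2 F \<alpha>s) (\<mu> (map (\<lambda>\<alpha>. tgt1 C (tgt2 C \<alpha>)) \<alpha>s))
        = comp20 C (\<mu> (map (\<lambda>\<alpha>. src1 C (src2 C \<alpha>)) \<alpha>s)) (on2 G \<alpha>s))"


section \<open>Lie 3-algebras\<close>

record ('a, 'b, 'c) lie3 = "('a, 'b, 'c) two_cat" +
  br0 :: "'a \<Rightarrow> 'a \<Rightarrow> 'a"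
  br1 :: "'b \<Rightarrow> 'b \<Rightarrow> 'b"
  br2 :: "'c \<Rightarrow> 'c \<Rightarrow> 'c"
  jac :: "'a \<Rightarrow> 'a \<Rightarrow> 'a \<Rightarrow> 'b"
  idt :: "'a \<Rightarrow> 'a \<Rightarrow> 'a \<Rightarrow> 'a \<Rightarrow> 'c"

text \<open>\<open>pad10 L f g\<close> is \<open>f \<circ>\<^sub>0 (g + 1)\<close>, where \<open>1\<close> is the identity 1-cell of the 0-cell that is
  determined by composability; similarly \<open>pad20\<close> for 2-cells.\<close>

definition pad10 ::
  "('a::ab_group_add, 'b::ab_group_add, 'c, 'm) two_cat_scheme \<Rightarrow> 'b \<Rightarrow> 'b \<Rightarrow> 'b" where
  "pad10 C f g = comp10 C f (g + one0 C (tgt1 C f - src1 C g))"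

definition pad20 ::
  "('a::ab_group_add, 'b, 'c::ab_group_add, 'm) two_cat_scheme \<Rightarrow> 'c \<Rightarrow> 'c \<Rightarrow> 'c" where
  "pad20 C \<alpha> \<beta> =
     comp20 C \<alpha> (\<beta> + one1 C (one0 C (tgt1 C (tgt2 C \<alpha>) - src1 C (src2 C \<beta>))))"

text \<open>The functors between which the Jacobiator and the Identiator live, for a bracket \<open>b\<close> on
  cells of any dimension. The last one is the common target of the two composite
  transformations that are the source and the target of the Identiator.\<close>

definition jac_dom :: "('x \<Rightarrow> 'x \<Rightarrow> 'x) \<Rightarrow> 'x list \<Rightarrow> 'x" where
  "jac_dom b xs = b (b (xs ! 0) (xs ! 1)) (xs ! 2)"

definition jac_cod :: "('x::plus \<Rightarrow> 'x \<Rightarrow> 'x) \<Rightarrow> 'x list \<Rightarrow> 'x" where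
  "jac_cod b xs = b (b (xs ! 0) (xs ! 2)) (xs ! 1) + b (xs ! 0) (b (xs ! 1) (xs ! 2))"

definition idt_dom :: "('x \<Rightarrow> 'x \<Rightarrow> 'x) \<Rightarrow> 'x list \<Rightarrow> 'x" where
  "idt_dom b xs = b (b (b (xs ! 0) (xs ! 1)) (xs ! 2)) (xs ! 3)"

definition idt_cod :: "('x::plus \<Rightarrow> 'x \<Rightarrow> 'x) \<Rightarrow> 'x list \<Rightarrow> 'x" where
  "idt_cod b xs = (let x = xs ! 0; y = xs ! 1; z = xs ! 2; u = xs ! 3 in
     b (b x z) (b y u) + b x (b (b y u) z)
     + b (b (b x u) z) y + b (b x u) (b y z)
     + b (b x (b z u)) y + b x (b y (b z u)))"

context
  fixes L :: "('a::ab_group_add, 'b::ab_group_add, 'c::ab_group_add) lie3"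
begin

private abbreviation B0 (\<open>\<langle>_,_\<rangle>\<^sub>0\<close>) where "\<langle>x,y\<rangle>\<^sub>0 \<equiv> br0 L x y"
private abbreviation B1 (\<open>\<langle>_,_\<rangle>\<^sub>1\<close>) where "\<langle>f,g\<rangle>\<^sub>1 \<equiv> br1 L f g"
private abbreviation B2 (\<open>\<langle>_,_\<rangle>\<^sub>2\<close>) where "\<langle>\<alpha>,\<beta>\<rangle>\<^sub>2 \<equiv> br2 L \<alpha> \<beta>"
private abbreviation "J \<equiv> jac L"
private abbreviation "M \<equiv> idt L"
private abbreviation "I0 \<equiv> one0 L"
private abbreviation "I1 \<equiv> one1 L"
private abbreviation "II x \<equiv> one1 L (one0 L x)"
private abbreviation C1 (infixl \<open>\<odot>\<^sub>1\<close> 60) where "f \<odot>\<^sub>1 g \<equiv> comp10 L f g"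
private abbreviation C2 (infixl \<open>\<odot>\<^sub>2\<close> 60) where "\<alpha> \<odot>\<^sub>2 \<beta> \<equiv> comp20 L \<alpha> \<beta>"
private abbreviation P1 (infixl \<open>\<odot>\<^sub>1\<^sup>+\<close> 60) where "f \<odot>\<^sub>1\<^sup>+ g \<equiv> pad10 L f g"
private abbreviation P2 (infixl \<open>\<odot>\<^sub>2\<^sup>+\<close> 60) where "\<alpha> \<odot>\<^sub>2\<^sup>+ \<beta> \<equiv> pad20 L \<alpha> \<beta>"

definition idt_src :: "'a \<Rightarrow> 'a \<Rightarrow> 'a \<Rightarrow> 'a \<Rightarrow> 'b" where
  "idt_src x y z u =
     \<langle>J x y z, I0 u\<rangle>\<^sub>1
     \<odot>\<^sub>1 (J \<langle>x,z\<rangle>\<^sub>0 y u + J x \<langle>y,z\<rangle>\<^sub>0 u)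
     \<odot>\<^sub>1\<^sup>+ \<langle>J x z u, I0 y\<rangle>\<^sub>1
     \<odot>\<^sub>1\<^sup>+ \<langle>I0 x, J y z u\<rangle>\<^sub>1"

definition idt_tgt :: "'a \<Rightarrow> 'a \<Rightarrow> 'a \<Rightarrow> 'a \<Rightarrow> 'b" where
  "idt_tgt x y z u =
     J \<langle>x,y\<rangle>\<^sub>0 z u
     \<odot>\<^sub>1\<^sup>+ \<langle>J x y u, I0 z\<rangle>\<^sub>1
     \<odot>\<^sub>1 (J x \<langle>y,u\<rangle>\<^sub>0 z + J \<langle>x,u\<rangle>\<^sub>0 y z + J x y \<langle>z,u\<rangle>\<^sub>0)"

definition alpha1 :: "'a \<Rightarrow> 'a \<Rightarrow> 'a \<Rightarrow> 'a \<Rightarrow> 'a \<Rightarrow> 'c" where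
  "alpha1 x y z u v =
     I1 (J \<langle>\<langle>x,y\<rangle>\<^sub>0,z\<rangle>\<^sub>0 u v)
     \<odot>\<^sub>2 (M x y z \<langle>u,v\<rangle>\<^sub>0 + \<langle>M x y z v, II u\<rangle>\<^sub>2)
     \<odot>\<^sub>2\<^sup>+ I1 (\<langle>J x \<langle>z,v\<rangle>\<^sub>0 y, I0 u\<rangle>\<^sub>1 + \<langle>J \<langle>x,v\<rangle>\<^sub>0 z y, I0 u\<rangle>\<^sub>1 + \<langle>J x z \<langle>y,v\<rangle>\<^sub>0, I0 u\<rangle>\<^sub>1)
     \<odot>\<^sub>2\<^sup>+ (M \<langle>x,v\<rangle>\<^sub>0 y z u + M x \<langle>y,v\<rangle>\<^sub>0 z u + M x y \<langle>z,v\<rangle>\<^sub>0 u)"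

definition alpha4 :: "'a \<Rightarrow> 'a \<Rightarrow> 'a \<Rightarrow> 'a \<Rightarrow> 'a \<Rightarrow> 'c" where
  "alpha4 x y z u v =
     \<langle>M x y z u, II v\<rangle>\<^sub>2
     \<odot>\<^sub>2\<^sup>+ I1 (\<langle>J \<langle>x,u\<rangle>\<^sub>0 z y, I0 v\<rangle>\<^sub>1 + \<langle>J x z \<langle>y,u\<rangle>\<^sub>0, I0 v\<rangle>\<^sub>1 + \<langle>J x \<langle>z,u\<rangle>\<^sub>0 y, I0 v\<rangle>\<^sub>1)
     \<odot>\<^sub>2 (M \<langle>x,u\<rangle>\<^sub>0 y z v + M x \<langle>y,u\<rangle>\<^sub>0 z v + M x y \<langle>z,u\<rangle>\<^sub>0 v)
     \<odot>\<^sub>2\<^sup>+ I1 (\<langle>\<langle>J x u v, I0 z\<rangle>\<^sub>1, I0 y\<rangle>\<^sub>1 + \<langle>J x u v, I0 \<langle>y,z\<rangle>\<^sub>0\<rangle>\<^sub>1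
            + \<langle>I0 x, \<langle>J y u v, I0 z\<rangle>\<^sub>1\<rangle>\<^sub>1 + \<langle>\<langle>I0 x, J z u v\<rangle>\<^sub>1, I0 y\<rangle>\<^sub>1
            + \<langle>I0 x, \<langle>I0 y, J z u v\<rangle>\<^sub>1\<rangle>\<^sub>1 + \<langle>I0 \<langle>x,z\<rangle>\<^sub>0, J y u v\<rangle>\<^sub>1)"

definition alpha3 :: "'a \<Rightarrow> 'a \<Rightarrow> 'a \<Rightarrow> 'a \<Rightarrow> 'a \<Rightarrow> 'c" where
  "alpha3 x y z u v =
     M \<langle>x,y\<rangle>\<^sub>0 z u v
     \<odot>\<^sub>2\<^sup>+ I1 \<langle>J \<langle>x,y\<rangle>\<^sub>0 v u, I0 z\<rangle>\<^sub>1
     \<odot>\<^sub>2\<^sup>+ \<langle>M x y u v, II z\<rangle>\<^sub>2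
     \<odot>\<^sub>2 I1 (\<langle>J x y v, I0 \<langle>z,u\<rangle>\<^sub>0\<rangle>\<^sub>1
           + J x y \<langle>\<langle>z,v\<rangle>\<^sub>0,u\<rangle>\<^sub>0 + J x y \<langle>z,\<langle>u,v\<rangle>\<^sub>0\<rangle>\<^sub>0
           + J \<langle>\<langle>x,v\<rangle>\<^sub>0,u\<rangle>\<^sub>0 y z + J \<langle>x,v\<rangle>\<^sub>0 \<langle>y,u\<rangle>\<^sub>0 z
           + J \<langle>x,u\<rangle>\<^sub>0 \<langle>y,v\<rangle>\<^sub>0 z + J x \<langle>\<langle>y,v\<rangle>\<^sub>0,u\<rangle>\<^sub>0 z
           + J \<langle>x,\<langle>u,v\<rangle>\<^sub>0\<rangle>\<^sub>0 y z + J x \<langle>y,\<langle>u,v\<rangle>\<^sub>0\<rangle>\<^sub>0 z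
           + \<langle>J x y u, I0 \<langle>z,v\<rangle>\<^sub>0\<rangle>\<^sub>1)
     \<odot>\<^sub>2\<^sup>+ I1 (J x \<langle>y,v\<rangle>\<^sub>0 \<langle>z,u\<rangle>\<^sub>0 + J \<langle>x,v\<rangle>\<^sub>0 y \<langle>z,u\<rangle>\<^sub>0
            + J x \<langle>y,u\<rangle>\<^sub>0 \<langle>z,v\<rangle>\<^sub>0 + J \<langle>x,u\<rangle>\<^sub>0 y \<langle>z,v\<rangle>\<^sub>0)"

definition alpha2 :: "'a \<Rightarrow> 'a \<Rightarrow> 'a \<Rightarrow> 'a \<Rightarrow> 'a \<Rightarrow> 'c" where
  "alpha2 x y z u v =
     I1 \<langle>\<langle>J x y z, I0 u\<rangle>\<^sub>1, I0 v\<rangle>\<^sub>1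
     \<odot>\<^sub>2 (M \<langle>x,z\<rangle>\<^sub>0 y u v + M x \<langle>y,z\<rangle>\<^sub>0 u v)
     \<odot>\<^sub>2\<^sup>+ I1 (\<langle>I0 x, J \<langle>y,z\<rangle>\<^sub>0 v u\<rangle>\<^sub>1 + \<langle>J \<langle>x,z\<rangle>\<^sub>0 v u, I0 y\<rangle>\<^sub>1)
     \<odot>\<^sub>2\<^sup>+ (\<langle>II x, M y z u v\<rangle>\<^sub>2 + \<langle>M x z u v, II y\<rangle>\<^sub>2)
     \<odot>\<^sub>2\<^sup>+ I1 (\<langle>J x z v, I0 \<langle>y,u\<rangle>\<^sub>0\<rangle>\<^sub>1 + \<langle>J x z u, I0 \<langle>y,v\<rangle>\<^sub>0\<rangle>\<^sub>1
            + \<langle>I0 \<langle>x,v\<rangle>\<^sub>0, J y z u\<rangle>\<^sub>1 + \<langle>I0 \<langle>x,u\<rangle>\<^sub>0, J y z v\<rangle>\<^sub>1)"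

definition coherence_law :: bool where
  "coherence_law \<longleftrightarrow> (\<forall>x y z u v.
     alpha1 x y z u v + inverse2 L (alpha4 x y z u v)
     = alpha3 x y z u v + inverse2 L (alpha2 x y z u v))"

end

definition is_lie_3_algebra ::
  "('k::field \<Rightarrow> 'a::ab_group_add \<Rightarrow> 'a) \<Rightarrow> ('k \<Rightarrow> 'b::ab_group_add \<Rightarrow> 'b)
    \<Rightarrow> ('k \<Rightarrow> 'c::ab_group_add \<Rightarrow> 'c) \<Rightarrow> ('a, 'b, 'c) lie3 \<Rightarrow> bool" where
  "is_lie_3_algebra sc0 sc1 sc2 L \<longleftrightarrow>
     linear_2_category sc0 sc1 sc2 L \<and>
     multilinear_2_functor 2 sc0 sc1 sc2 L
       \<lparr>on0 = \<lambda>xs. br0 L (xs ! 0) (xs ! 1),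
        on1 = \<lambda>fs. br1 L (fs ! 0) (fs ! 1),
        on2 = \<lambda>\<alpha>s. br2 L (\<alpha>s ! 0) (\<alpha>s ! 1)\<rparr> \<and>
     (\<forall>x y. br0 L x y = - br0 L y x) \<and>
     (\<forall>f g. br1 L f g = - br1 L g f) \<and>
     (\<forall>\<alpha> \<beta>. br2 L \<alpha> \<beta> = - br2 L \<beta> \<alpha>) \<and>
     multilinear_2_transformation 3 sc0 sc1 L
       \<lparr>on0 = jac_dom (br0 L), on1 = jac_dom (br1 L), on2 = jac_dom (br2 L)\<rparr>
       \<lparr>on0 = jac_cod (br0 L), on1 = jac_cod (br1 L), on2 = jac_cod (br2 L)\<rparr>
       (\<lambda>xs. jac L (xs ! 0) (xs ! 1) (xs ! 2)) \<and>
     antisymmetric 3 (\<lambda>xs. part1 L (jac L (xs ! 0) (xs ! 1) (xs ! 2))) \<and>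
     multilinear_2_modification 4 sc0 sc2 L
       \<lparr>on0 = idt_dom (br0 L), on1 = idt_dom (br1 L), on2 = idt_dom (br2 L)\<rparr>
       \<lparr>on0 = idt_cod (br0 L), on1 = idt_cod (br1 L), on2 = idt_cod (br2 L)\<rparr>
       (\<lambda>xs. idt_src L (xs ! 0) (xs ! 1) (xs ! 2) (xs ! 3))
       (\<lambda>xs. idt_tgt L (xs ! 0) (xs ! 1) (xs ! 2) (xs ! 3))
       (\<lambda>xs. idt L (xs ! 0) (xs ! 1) (xs ! 2) (xs ! 3)) \<and>
     antisymmetric 4 (\<lambda>xs. part2 L (idt L (xs ! 0) (xs ! 1) (xs ! 2) (xs ! 3))) \<and>
     coherence_law L"


section \<open>3-term Lie infinity algebras\<close>

text \<open>The graded vector space \<open>V\<^sub>0 \<oplus> V\<^sub>1 \<oplus> V\<^sub>2\<close> is the product type; \<open>homog d\<close> is its subspace of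
  elements of degree d, which is zero unless d is 0, 1 or 2.\<close>

definition homog :: "int \<Rightarrow> ('u::zero \<times> 'v::zero \<times> 'w::zero) set" where
  "homog d = {(x, f, a). (d \<noteq> 0 \<longrightarrow> x = 0) \<and> (d \<noteq> 1 \<longrightarrow> f = 0) \<and> (d \<noteq> 2 \<longrightarrow> a = 0)}"

definition has_degrees :: "('u::zero \<times> 'v::zero \<times> 'w::zero) list \<Rightarrow> nat list \<Rightarrow> bool" where
  "has_degrees xs ds \<longleftrightarrow> list_all2 (\<lambda>x d. x \<in> homog (int d)) xs ds"

text \<open>Permutations of n letters act on \<open>{..<n}\<close>. The Koszul sign of \<open>\<sigma>\<close>, for letters of degrees
  \<open>ds\<close>, is a product over the pairs of letters whose order is reversed in
  \<open>permute_list \<sigma> xs\<close>; \<open>chi\<close> is its product with the signature.\<close>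

definition koszul_sign :: "nat list \<Rightarrow> (nat \<Rightarrow> nat) \<Rightarrow> int" where
  "koszul_sign ds \<sigma> =
     (\<Prod>(p, q) \<in> {(p, q). p < q \<and> q < length ds \<and> \<sigma> q < \<sigma> p}. (-1) ^ (ds ! \<sigma> p * ds ! \<sigma> q))"

definition chi :: "nat list \<Rightarrow> (nat \<Rightarrow> nat) \<Rightarrow> int" where
  "chi ds \<sigma> = sign \<sigma> * koszul_sign ds \<sigma>"

text \<open>The \<open>(i, n - i)\<close>-shuffles.\<close>

definition shuffle_perms :: "nat \<Rightarrow> nat \<Rightarrow> (nat \<Rightarrow> nat) set" where
  "shuffle_perms i n =
     {\<sigma>. \<sigma> permutes {..<n} \<and> strict_mono_on {..<i} \<sigma> \<and> strict_mono_on {i..<n} \<sigma>}"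

text \<open>A single function \<open>l\<close> on lists encodes all the maps \<open>\<ell>\<^sub>p\<close>, namely by its restrictions to the lists
  of length p. In the defining identity \<open>j - 1 = n - i\<close>.\<close>

definition is_lie_infinity_3 ::
  "('k::field \<Rightarrow> 'u::ab_group_add \<Rightarrow> 'u) \<Rightarrow> ('k \<Rightarrow> 'v::ab_group_add \<Rightarrow> 'v)
    \<Rightarrow> ('k \<Rightarrow> 'w::ab_group_add \<Rightarrow> 'w) \<Rightarrow> (('u \<times> 'v \<times> 'w) list \<Rightarrow> 'u \<times> 'v \<times> 'w) \<Rightarrow> bool" where
  "is_lie_infinity_3 s0 s1 s2 l \<longleftrightarrow>
     (let s = scale_prod s0 (scale_prod s1 s2) in
       vector_space s0 \<and> vector_space s1 \<and> vector_space s2 \<and>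
       (\<forall>xs. length xs \<notin> {1..4} \<longrightarrow> l xs = 0) \<and>
       (\<forall>p\<in>{1..4}. multilinear p s s l) \<and>
       (\<forall>xs ds. length xs \<in> {1..4} \<and> has_degrees xs ds \<longrightarrow>
          l xs \<in> homog (int (sum_list ds) + int (length xs) - 2)) \<and>
       (\<forall>xs ds \<sigma>. has_degrees xs ds \<and> \<sigma> permutes {..<length xs} \<longrightarrow>
          l (permute_list \<sigma> xs) = s (of_int (chi ds \<sigma>)) (l xs)) \<and>
       (\<forall>n\<ge>1. \<forall>xs ds. length xs = n \<and> has_degrees xs ds \<longrightarrow>
          (\<Sum>i=1..n. \<Sum>\<sigma>\<in>shuffle_perms i n.
             s (of_int (chi ds \<sigma> * (-1) ^ (i * (n - i))))
               (l (l (take i (permute_list \<sigma> xs)) # drop i (permute_list \<sigma> xs)))) = 0))"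

definition l2_vanishes_on_V1_V1 ::
  "(('u::zero \<times> 'v::zero \<times> 'w::zero) list \<Rightarrow> 'u \<times> 'v \<times> 'w) \<Rightarrow> bool" where
  "l2_vanishes_on_V1_V1 l \<longleftrightarrow> (\<forall>f \<in> homog 1. \<forall>g \<in> homog 1. l [f, g] = 0)"

definition l3_vanishes_in_total_degree_1 ::
  "(('u::zero \<times> 'v::zero \<times> 'w::zero) list \<Rightarrow> 'u \<times> 'v \<times> 'w) \<Rightarrow> bool" where
  "l3_vanishes_in_total_degree_1 l \<longleftrightarrow>
     (\<forall>xs ds. length xs = 3 \<and> has_degrees xs ds \<and> sum_list ds = 1 \<longrightarrow> l xs = 0)"


section \<open>The correspondence\<close>

text \<open>\<open>V\<^sub>m\<close> is identified with \<open>ker s\<close> in \<open>L\<^sub>m\<close> by \<open>v \<mapsto> i\<^sub>m (0, \<dots>, 0, v)\<close>, and \<open>i\<^sub>m\<close> is then the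
  identification \<open>(v\<^sub>0, \<dots>, v\<^sub>m) \<mapsto> 1\<^sup>m v\<^sub>0 + \<dots> + v\<^sub>m\<close> of the direct sum with \<open>L\<^sub>m\<close>.\<close>

definition identified_via ::
  "('u::ab_group_add \<Rightarrow> 'a::ab_group_add) \<Rightarrow> ('u \<times> 'v::ab_group_add \<Rightarrow> 'b::ab_group_add)
    \<Rightarrow> ('u \<times> 'v \<times> 'w::ab_group_add \<Rightarrow> 'c::ab_group_add)
    \<Rightarrow> ('a, 'b, 'c, 'm) two_cat_scheme \<Rightarrow> bool" where
  "identified_via i0 i1 i2 C \<longleftrightarrow>
     range (\<lambda>f. i1 (0, f)) = {f. src1 C f = 0} \<and>
     range (\<lambda>a. i2 (0, 0, a)) = {\<alpha>. src2 C \<alpha> = 0} \<and>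
     (\<forall>x f. i1 (x, f) = one0 C (i0 x) + i1 (0, f)) \<and>
     (\<forall>x f a. i2 (x, f, a) = one1 C (one0 C (i0 x)) + one1 C (i1 (0, f)) + i2 (0, 0, a))"

definition same_underlying_complex ::
  "('u::ab_group_add \<Rightarrow> 'a) \<Rightarrow> ('u \<times> 'v::ab_group_add \<Rightarrow> 'b)
    \<Rightarrow> ('u \<times> 'v \<times> 'w::ab_group_add \<Rightarrow> 'c)
    \<Rightarrow> ('a, 'b, 'c, 'm) two_cat_scheme \<Rightarrow> (('u \<times> 'v \<times> 'w) list \<Rightarrow> 'u \<times> 'v \<times> 'w) \<Rightarrow> bool" where
  "same_underlying_complex i0 i1 i2 C l \<longleftrightarrow>
     (\<forall>f. i0 (fst (l [(0, f, 0)])) = tgt1 C (i1 (0, f))) \<and>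
     (\<forall>a. i1 (0, fst (snd (l [(0, 0, a)]))) = tgt2 C (i2 (0, 0, a)))"

text \<open>Apart from the differential, the \<open>\<ell>\<^sub>p\<close> are the components of bracket, Jacobiator and
  Identiator. The sign of \<open>\<ell>\<^sub>4\<close> is forced by the sign convention \<open>(-1)^(i * (j - 1))\<close>.\<close>

definition structure_maps_match ::
  "('u::ab_group_add \<Rightarrow> 'a) \<Rightarrow> ('u \<times> 'v::ab_group_add \<Rightarrow> 'b::ab_group_add)
    \<Rightarrow> ('u \<times> 'v \<times> 'w::ab_group_add \<Rightarrow> 'c::ab_group_add)
    \<Rightarrow> ('a, 'b, 'c) lie3 \<Rightarrow> (('u \<times> 'v \<times> 'w) list \<Rightarrow> 'u \<times> 'v \<times> 'w) \<Rightarrow> bool" where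
  "structure_maps_match i0 i1 i2 L l \<longleftrightarrow>
     (\<forall>x y. i0 (fst (l [(x, 0, 0), (y, 0, 0)])) = br0 L (i0 x) (i0 y)) \<and>
     (\<forall>x f. i1 (0, fst (snd (l [(x, 0, 0), (0, f, 0)])))
        = br1 L (one0 L (i0 x)) (i1 (0, f))) \<and>
     (\<forall>x a. i2 (0, 0, snd (snd (l [(x, 0, 0), (0, 0, a)])))
        = br2 L (one1 L (one0 L (i0 x))) (i2 (0, 0, a))) \<and>
     (\<forall>x y z. i1 (0, fst (snd (l [(x, 0, 0), (y, 0, 0), (z, 0, 0)])))
        = part1 L (jac L (i0 x) (i0 y) (i0 z))) \<and>
     (\<forall>x y z u. i2 (0, 0, snd (snd (l [(x, 0, 0), (y, 0, 0), (z, 0, 0), (u, 0, 0)])))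
        = - part2 L (idt L (i0 x) (i0 y) (i0 z) (i0 u)))"

end

theory Submission
  imports Defs
begin

text \<open>The theorem holds because a Lie 3-algebra and a Lie infinity algebra of the restricted kind
  are two presentations of the same seven multilinear maps, subject to the same equations.

  On the side of categories, the splitting \<open>L\<^sub>m = V\<^sub>0 \<oplus> \<dots> \<oplus> V\<^sub>m\<close> leaves no freedom in the
  compositions, since linearity and the unit laws determine them, and little freedom in the
  bracket. For \<open>f, g\<close> in \<open>V\<^sub>1\<close> one has \<open>f = f \<circ>\<^sub>0 1\<close> and \<open>g = 1 \<circ>\<^sub>0 g\<close>, hence
  \<open>[f, g] = [1\<^bsub>tf\<^esub>, g]\<close> by functoriality; in the same way a bracket with an element of \<open>V\<^sub>2\<close> is
  nonzero only against an object. So the bracket amounts to an antisymmetric bracket on \<open>V\<^sub>0\<close> and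
  actions of \<open>V\<^sub>0\<close> on \<open>V\<^sub>1\<close> and \<open>V\<^sub>2\<close>. Jacobiator and Identiator have prescribed sources and
  are given by their top components. These maps and the differential form the record
  \<open>components\<close>, and the axioms become the equations of the locale \<open>semistrict_lie3\<close>
  (\<open>lie_imp_semistrict\<close> and \<open>semistrict_imp_lie\<close>). Two points are not formal. Naturality in
  several variables at once has to follow from naturality in a single one (\<open>jacobi_natural\<close>,
  \<open>ident_src_natural\<close>). And the coherence law, an equation between 2-cells, must not say anything
  about their sources: its \<open>V\<^sub>1\<close>-component follows from naturality of the Jacobiator
  (\<open>alpha_boundaries\<close>), so that only an equation in \<open>V\<^sub>2\<close> remains.

  On the side of Lie infinity algebras, degrees leave exactly the same maps, once the bracket of
  \<open>V\<^sub>1\<close> with itself and the ternary bracket in total degree 1 are zero (\<open>linf_of_components\<close>). Of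
  the Lie infinity identities, those with six or more arguments are void, and those with at
  most five arguments are the equations of \<open>semistrict_lie3\<close> (\<open>jacobi_imp_semistrict\<close> and
  \<open>semistrict_imp_jacobi\<close>). The two vanishing conditions match strictness properties of the
  bracket functor and of the Jacobiator: they remove the homotopies that would otherwise correct
  \<open>[tf, g] = [f, tg]\<close> and the Jacobi identity on \<open>V\<^sub>0 \<times> V\<^sub>0 \<times> V\<^sub>1\<close>. The identity for five objects
  is the coherence law in \<open>V\<^sub>2\<close>.\<close>

section \<open>Tuples and multilinear maps\<close>

lemma linear_iff:
  "Vector_Spaces.linear s t f \<longleftrightarrow>
     vector_space s \<and> vector_space t \<and> (\<forall>x y. f (x + y) = f x + f y) \<and> (\<forall>r x. f (s r x) = t r (f x))"
  by (auto simp: Vector_Spaces.linear_def module_hom_iff module_iff_vector_space)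

lemma length_two: "length xs = 2 \<longleftrightarrow> (\<exists>a b. xs = [a, b])"
  by (auto simp: numeral_eq_Suc length_Suc_conv)

lemma length_three: "length xs = 3 \<longleftrightarrow> (\<exists>a b c. xs = [a, b, c])"
  by (auto simp: numeral_eq_Suc length_Suc_conv)

lemma length_four: "length xs = 4 \<longleftrightarrow> (\<exists>a b c d. xs = [a, b, c, d])"
  by (auto simp: numeral_eq_Suc length_Suc_conv)

lemma all_length_two: "(\<forall>xs. length xs = 2 \<longrightarrow> P xs) \<longleftrightarrow> (\<forall>a b. P [a, b])"
  by (auto simp: length_two)

lemma all_length_three: "(\<forall>xs. length xs = 3 \<longrightarrow> P xs) \<longleftrightarrow> (\<forall>a b c. P [a, b, c])"
  by (auto simp: length_three)

lemma all_length_four: "(\<forall>xs. length xs = 4 \<longrightarrow> P xs) \<longleftrightarrow> (\<forall>a b c d. P [a, b, c, d])"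
  by (auto simp: length_four)

lemma less_two: "i < (2::nat) \<longleftrightarrow> i = 0 \<or> i = 1" by auto
lemma less_three: "i < (3::nat) \<longleftrightarrow> i = 0 \<or> i = 1 \<or> i = 2" by auto
lemma less_four: "i < (4::nat) \<longleftrightarrow> i = 0 \<or> i = 1 \<or> i = 2 \<or> i = 3" by auto

lemma less_less_three:
  "i < j \<and> j < (3::nat) \<longleftrightarrow> (i = 0 \<and> j = 1) \<or> (i = 0 \<and> j = 2) \<or> (i = 1 \<and> j = 2)"
  by auto

lemma less_less_four:
  "i < j \<and> j < (4::nat) \<longleftrightarrow>
     (i = 0 \<and> j = 1) \<or> (i = 0 \<and> j = 2) \<or> (i = 1 \<and> j = 2) \<or>
     (i = 0 \<and> j = 3) \<or> (i = 1 \<and> j = 3) \<or> (i = 2 \<and> j = 3)"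
  by auto

lemma multilinear_alt:
  "multilinear n s t F \<longleftrightarrow>
     (\<forall>xs. length xs = n \<longrightarrow> (\<forall>i. i < n \<longrightarrow> Vector_Spaces.linear s t (\<lambda>x. F (xs[i := x]))))"
  unfolding multilinear_def by blast

lemma multilinear_one:
  "multilinear 1 s t F \<longleftrightarrow> Vector_Spaces.linear s t (\<lambda>x. F [x])"
  by (auto simp: multilinear_def length_Suc_conv)

lemma multilinear_two:
  "multilinear 2 s t F \<longleftrightarrow>
     (\<forall>x. Vector_Spaces.linear s t (\<lambda>y. F [x, y])) \<and> (\<forall>y. Vector_Spaces.linear s t (\<lambda>x. F [x, y]))"
  unfolding multilinear_alt all_length_two less_two by (simp add: conj_ac imp_disjL all_conj_distrib)

lemma multilinear_three:
  "multilinear 3 s t F \<longleftrightarrow>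
     (\<forall>x y. Vector_Spaces.linear s t (\<lambda>z. F [x, y, z])) \<and>
     (\<forall>x z. Vector_Spaces.linear s t (\<lambda>y. F [x, y, z])) \<and>
     (\<forall>y z. Vector_Spaces.linear s t (\<lambda>x. F [x, y, z]))"
  unfolding multilinear_alt all_length_three less_three
  by (simp add: numeral_2_eq_2 conj_ac imp_disjL all_conj_distrib)

lemma multilinear_four:
  "multilinear 4 s t F \<longleftrightarrow>
     (\<forall>x y z. Vector_Spaces.linear s t (\<lambda>u. F [x, y, z, u])) \<and>
     (\<forall>x y u. Vector_Spaces.linear s t (\<lambda>z. F [x, y, z, u])) \<and>
     (\<forall>x z u. Vector_Spaces.linear s t (\<lambda>y. F [x, y, z, u])) \<and>
     (\<forall>y z u. Vector_Spaces.linear s t (\<lambda>x. F [x, y, z, u]))"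
  unfolding multilinear_alt all_length_four less_four
  by (simp add: numeral_2_eq_2 numeral_3_eq_3 conj_ac imp_disjL all_conj_distrib)

text \<open>Adjacent transpositions generate the symmetric group, so the swap of the outer arguments
  is a product of three of them.\<close>

lemma antisymmetric_three:
  "antisymmetric 3 F \<longleftrightarrow>
     (\<forall>x y z. F [y, x, z] = - F [x, y, z] \<and> F [x, z, y] = - F [x, y, z])"
  (is "?l \<longleftrightarrow> ?r")
proof
  assume l: ?l
  show ?r
  proof (intro allI conjI)
    fix x y z
    show "F [y, x, z] = - F [x, y, z]"
      using l[unfolded antisymmetric_def, rule_format, of "[x, y, z]" 0 1] by simp
    show "F [x, z, y] = - F [x, y, z]"
      using l[unfolded antisymmetric_def, rule_format, of "[x, y, z]" 1 2]
      by (simp add: numeral_2_eq_2)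
  qed
next
  assume r: ?r
  have r1: "F [y, x, z] = - F [x, y, z]" and r2: "F [x, z, y] = - F [x, y, z]" for x y z
    using r by blast+
  have r3: "F [z, y, x] = - F [x, y, z]" for x y z
    by (metis r1 r2 minus_minus)
  show ?l
    unfolding antisymmetric_def length_three less_less_three
    by (intro allI impI; elim conjE exE disjE; simp add: numeral_2_eq_2; rule r1 r2 r3)
qed

lemma antisymmetric_four:
  "antisymmetric 4 F \<longleftrightarrow>
     (\<forall>x y z u. F [y, x, z, u] = - F [x, y, z, u] \<and> F [x, z, y, u] = - F [x, y, z, u]
        \<and> F [x, y, u, z] = - F [x, y, z, u])"
  (is "?l \<longleftrightarrow> ?r")
proof
  assume l: ?l
  show ?r
  proof (intro allI conjI)
    fix x y z u
    show "F [y, x, z, u] = - F [x, y, z, u]"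
      using l[unfolded antisymmetric_def, rule_format, of "[x, y, z, u]" 0 1] by simp
    show "F [x, z, y, u] = - F [x, y, z, u]"
      using l[unfolded antisymmetric_def, rule_format, of "[x, y, z, u]" 1 2]
      by (simp add: numeral_2_eq_2)
    show "F [x, y, u, z] = - F [x, y, z, u]"
      using l[unfolded antisymmetric_def, rule_format, of "[x, y, z, u]" 2 3]
      by (simp add: numeral_2_eq_2 numeral_3_eq_3)
  qed
next
  assume r: ?r
  have r1: "F [y, x, z, u] = - F [x, y, z, u]" and r2: "F [x, z, y, u] = - F [x, y, z, u]"
    and r3: "F [x, y, u, z] = - F [x, y, z, u]" for x y z u
    using r by blast+
  have r4: "F [z, y, x, u] = - F [x, y, z, u]" for x y z u
    by (metis r1 r2 minus_minus)
  have r5: "F [x, u, z, y] = - F [x, y, z, u]" for x y z u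
    by (metis r2 r3 minus_minus)
  have r6: "F [u, y, z, x] = - F [x, y, z, u]" for x y z u
    by (metis r1 r5 minus_minus)
  show ?l
    unfolding antisymmetric_def length_four less_less_four
    by (intro allI impI; elim conjE exE disjE; simp add: numeral_2_eq_2 numeral_3_eq_3;
        rule r1 r2 r3 r4 r5 r6)
qed

section \<open>Components and the equations between them\<close>

text \<open>The data common to both structures: the differential, the brackets of an object with
  elements of \<open>V\<^sub>0\<close>, \<open>V\<^sub>1\<close>, \<open>V\<^sub>2\<close>, the \<open>V\<^sub>1\<close>-component of the Jacobiator and the
  \<open>V\<^sub>2\<close>-component of the Identiator. The latter is \<open>-\<ell>\<^sub>4\<close>.\<close>

record ('u, 'v, 'w) components =
  diff1 :: "'v \<Rightarrow> 'u"
  diff2 :: "'w \<Rightarrow> 'v"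
  act0 :: "'u \<Rightarrow> 'u \<Rightarrow> 'u"
  act1 :: "'u \<Rightarrow> 'v \<Rightarrow> 'v"
  act2 :: "'u \<Rightarrow> 'w \<Rightarrow> 'w"
  jacobi :: "'u \<Rightarrow> 'u \<Rightarrow> 'u \<Rightarrow> 'v"
  ident :: "'u \<Rightarrow> 'u \<Rightarrow> 'u \<Rightarrow> 'u \<Rightarrow> 'w"

text \<open>Linearity in the last argument suffices for the antisymmetric maps, as antisymmetry carries
  it over to the other arguments.\<close>

locale component_maps =
  V0: vector_space s0 + V1: vector_space s1 + V2: vector_space s2
  for s0 :: "'k::field \<Rightarrow> 'u::ab_group_add \<Rightarrow> 'u"
    and s1 :: "'k \<Rightarrow> 'v::ab_group_add \<Rightarrow> 'v"
    and s2 :: "'k \<Rightarrow> 'w::ab_group_add \<Rightarrow> 'w" +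
  fixes D :: "('u, 'v, 'w) components"
  assumes linear_diff1: "Vector_Spaces.linear s1 s0 (diff1 D)"
    and linear_diff2: "Vector_Spaces.linear s2 s1 (diff2 D)"
    and linear_act0: "Vector_Spaces.linear s0 s0 (act0 D x)"
    and linear_act1: "Vector_Spaces.linear s1 s1 (act1 D x)"
    and linear_act1_left: "Vector_Spaces.linear s0 s1 (\<lambda>x. act1 D x f)"
    and linear_act2: "Vector_Spaces.linear s2 s2 (act2 D x)"
    and linear_act2_left: "Vector_Spaces.linear s0 s2 (\<lambda>x. act2 D x a)"
    and linear_jacobi: "Vector_Spaces.linear s0 s1 (jacobi D x y)"
    and linear_ident: "Vector_Spaces.linear s0 s2 (ident D x y z)"
    and act0_swap: "act0 D y x = - act0 D x y"
    and jacobi_swap12: "jacobi D y x z = - jacobi D x y z"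
    and jacobi_swap23: "jacobi D x z y = - jacobi D x y z"
    and ident_swap12: "ident D y x z u = - ident D x y z u"
    and ident_swap23: "ident D x z y u = - ident D x y z u"
    and ident_swap34: "ident D x y u z = - ident D x y z u"
begin

abbreviation d1 where "d1 \<equiv> diff1 D"
abbreviation d2 where "d2 \<equiv> diff2 D"
abbreviation bracket (\<open>\<lbrakk>_,_\<rbrakk>\<close>) where "\<lbrakk>x,y\<rbrakk> \<equiv> act0 D x y"
abbreviation action1 (infixr \<open>\<rhd>\<close> 75) where "x \<rhd> f \<equiv> act1 D x f"
abbreviation action2 (infixr \<open>\<unrhd>\<close> 75) where "x \<unrhd> a \<equiv> act2 D x a"
abbreviation j where "j \<equiv> jacobi D"
abbreviation m where "m \<equiv> ident D"

lemma linear_act0_left: "Vector_Spaces.linear s0 s0 (\<lambda>x. \<lbrakk>x,y\<rbrakk>)"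
proof -
  have "(\<lambda>x. \<lbrakk>x,y\<rbrakk>) = (\<lambda>x. - \<lbrakk>y,x\<rbrakk>)" by (intro ext act0_swap)
  then show ?thesis using linear_act0[of y] by (simp add: linear_iff V0.scale_minus_right)
qed

lemma linear_jacobi_mid: "Vector_Spaces.linear s0 s1 (\<lambda>y. j x y z)"
proof -
  have "(\<lambda>y. j x y z) = (\<lambda>y. - j x z y)" by (intro ext jacobi_swap23)
  then show ?thesis using linear_jacobi[of x z] by (simp add: linear_iff V1.scale_minus_right)
qed

lemma linear_jacobi_left: "Vector_Spaces.linear s0 s1 (\<lambda>x. j x y z)"
proof -
  have "(\<lambda>x. j x y z) = (\<lambda>x. - j y x z)" by (intro ext jacobi_swap12)
  then show ?thesis using linear_jacobi_mid[of y z] by (simp add: linear_iff V1.scale_minus_right)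
qed

lemma linear_ident_third: "Vector_Spaces.linear s0 s2 (\<lambda>z. m x y z u)"
proof -
  have "(\<lambda>z. m x y z u) = (\<lambda>z. - m x y u z)" by (intro ext ident_swap34)
  then show ?thesis using linear_ident[of x y u] by (simp add: linear_iff V2.scale_minus_right)
qed

lemma linear_ident_second: "Vector_Spaces.linear s0 s2 (\<lambda>y. m x y z u)"
proof -
  have "(\<lambda>y. m x y z u) = (\<lambda>y. - m x z y u)" by (intro ext ident_swap23)
  then show ?thesis using linear_ident_third[of x z u]
    by (simp add: linear_iff V2.scale_minus_right)
qed

lemma linear_ident_first: "Vector_Spaces.linear s0 s2 (\<lambda>x. m x y z u)"
proof -
  have "(\<lambda>x. m x y z u) = (\<lambda>x. - m y x z u)" by (intro ext ident_swap12)
  then show ?thesis using linear_ident_second[of y z u]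
    by (simp add: linear_iff V2.scale_minus_right)
qed

lemmas all_linear = linear_diff1 linear_diff2 linear_act0 linear_act0_left linear_act1
  linear_act1_left linear_act2 linear_act2_left linear_jacobi linear_jacobi_mid
  linear_jacobi_left linear_ident linear_ident_third linear_ident_second linear_ident_first

lemmas additive [simp] =
  all_linear[THEN Vector_Spaces.linear.axioms(3), THEN module_hom.add]
lemmas negative [simp] =
  all_linear[THEN Vector_Spaces.linear.axioms(3), THEN module_hom.neg]
lemmas subtractive [simp] =
  all_linear[THEN Vector_Spaces.linear.axioms(3), THEN module_hom.diff]
lemmas at_zero [simp] =
  all_linear[THEN Vector_Spaces.linear.axioms(3), THEN module_hom.zero]
lemmas homogeneous [simp] =
  all_linear[THEN Vector_Spaces.linear.axioms(3), THEN module_hom.scale]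

text \<open>The \<open>V\<^sub>1\<close>-components of the source and of the target of the Identiator: composition adds
  \<open>V\<^sub>1\<close>-components, and the minus signs come from \<open>[f, 1\<^bsub>u\<^esub>] = -[1\<^bsub>u\<^esub>, f]\<close>.\<close>

definition ident_src where
  "ident_src x y z u = - (u \<rhd> j x y z) + j \<lbrakk>x,z\<rbrakk> y u + j x \<lbrakk>y,z\<rbrakk> u - y \<rhd> j x z u + x \<rhd> j y z u"

definition ident_tgt where
  "ident_tgt x y z u = j \<lbrakk>x,y\<rbrakk> z u - z \<rhd> j x y u + j x \<lbrakk>y,u\<rbrakk> z + j \<lbrakk>x,u\<rbrakk> y z + j x y \<lbrakk>z,u\<rbrakk>"

end

text \<open>Each equation is both an axiom of a Lie 3-algebra read in components and a Lie infinity
  identity. In a general Lie infinity algebra, the right-hand sides of \<open>d1_act1\<close>, \<open>d1_act2\<close>,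
  \<open>act1_bracket\<close>, \<open>act2_bracket\<close> and \<open>ident_d1\<close> contain further terms in \<open>\<ell>\<^sub>2\<close> on \<open>V\<^sub>1 \<times> V\<^sub>1\<close> or in \<open>\<ell>\<^sub>3\<close> in
  total degree 1. The coherence equation is kept apart because the 2-cells of the coherence
  law can only be computed once the other equations are known.\<close>

locale lie3_up_to_coherence = component_maps s0 s1 s2 D
  for s0 :: "'k::field \<Rightarrow> 'u::ab_group_add \<Rightarrow> 'u"
    and s1 :: "'k \<Rightarrow> 'v::ab_group_add \<Rightarrow> 'v"
    and s2 :: "'k \<Rightarrow> 'w::ab_group_add \<Rightarrow> 'w"
    and D +
  assumes d1_d2: "d1 (d2 a) = 0"
    and d1_act: "d1 (x \<rhd> f) = \<lbrakk>x, d1 f\<rbrakk>"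
    and d2_act: "d2 (x \<unrhd> a) = x \<rhd> d2 a"
    and d1_act1: "d1 f \<rhd> g = - (d1 g \<rhd> f)"
    and d1_act2: "d1 f \<unrhd> a = 0"
    and d1_jacobi: "d1 (j x y z) = \<lbrakk>\<lbrakk>x,z\<rbrakk>,y\<rbrakk> + \<lbrakk>x,\<lbrakk>y,z\<rbrakk>\<rbrakk> - \<lbrakk>\<lbrakk>x,y\<rbrakk>,z\<rbrakk>"
    and act1_bracket: "\<lbrakk>x,y\<rbrakk> \<rhd> f = x \<rhd> y \<rhd> f - y \<rhd> x \<rhd> f - j x y (d1 f)"
    and act2_bracket: "\<lbrakk>x,y\<rbrakk> \<unrhd> a = x \<unrhd> y \<unrhd> a - y \<unrhd> x \<unrhd> a"
    and d2_ident: "d2 (m x y z u) = ident_tgt x y z u - ident_src x y z u"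
    and ident_d1: "m x y z (d1 f) = 0"

context lie3_up_to_coherence
begin

lemma jacobi_d1:
  "j x y (d1 f) = x \<rhd> y \<rhd> f - y \<rhd> x \<rhd> f - \<lbrakk>x,y\<rbrakk> \<rhd> f"
  "j x (d1 f) z = z \<rhd> x \<rhd> f - x \<rhd> z \<rhd> f + \<lbrakk>x,z\<rbrakk> \<rhd> f"
  "j (d1 f) y z = y \<rhd> z \<rhd> f - z \<rhd> y \<rhd> f - \<lbrakk>y,z\<rbrakk> \<rhd> f"
proof -
  show *: "j x y (d1 f) = x \<rhd> y \<rhd> f - y \<rhd> x \<rhd> f - \<lbrakk>x,y\<rbrakk> \<rhd> f" for x y
    by (simp add: act1_bracket)
  show "j x (d1 f) z = z \<rhd> x \<rhd> f - x \<rhd> z \<rhd> f + \<lbrakk>x,z\<rbrakk> \<rhd> f"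
    using *[of x z] jacobi_swap23[of x "d1 f" z] by simp
  show "j (d1 f) y z = y \<rhd> z \<rhd> f - z \<rhd> y \<rhd> f - \<lbrakk>y,z\<rbrakk> \<rhd> f"
    using *[of y z] jacobi_swap23[of y z "d1 f"] jacobi_swap12[of "d1 f" y z] by simp
qed

lemma ident_d1_inner: "m x y (d1 f) u = 0" "m x (d1 f) z u = 0" "m (d1 f) y z u = 0"
proof -
  show third: "m x y (d1 f) u = 0" for x y u
    using ident_d1[of x y u f] ident_swap34[of x y u "d1 f"] by simp
  show second: "m x (d1 f) z u = 0" for x z u
    using third[of x z u] ident_swap23[of x z "d1 f" u] by simp
  show "m (d1 f) y z u = 0"
    using second[of y z u] ident_swap12[of y "d1 f" z u] by simp
qed

end

locale semistrict_lie3 = lie3_up_to_coherence s0 s1 s2 D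
  for s0 :: "'k::field \<Rightarrow> 'u::ab_group_add \<Rightarrow> 'u"
    and s1 :: "'k \<Rightarrow> 'v::ab_group_add \<Rightarrow> 'v"
    and s2 :: "'k \<Rightarrow> 'w::ab_group_add \<Rightarrow> 'w"
    and D +
  assumes ident_coherence:
      "v \<unrhd> m x y z u - u \<unrhd> m x y z v + z \<unrhd> m x y u v - y \<unrhd> m x z u v + x \<unrhd> m y z u v
       = m \<lbrakk>x,y\<rbrakk> z u v - m \<lbrakk>x,z\<rbrakk> y u v + m \<lbrakk>x,u\<rbrakk> y z v - m \<lbrakk>x,v\<rbrakk> y z u
         - m x \<lbrakk>y,z\<rbrakk> u v + m x \<lbrakk>y,u\<rbrakk> z v - m x \<lbrakk>y,v\<rbrakk> z u
         + m x y \<lbrakk>z,u\<rbrakk> v - m x y \<lbrakk>z,v\<rbrakk> u - m x y z \<lbrakk>u,v\<rbrakk>"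

section \<open>The bracket of 1-cells and its naturality\<close>

context component_maps
begin

text \<open>The bracket on \<open>L\<^sub>1 = V\<^sub>0 \<oplus> V\<^sub>1\<close>. The last term is the bracket of \<open>f, g\<close> in \<open>V\<^sub>1\<close>, which
  functoriality forces: \<open>[f \<circ>\<^sub>0 1\<^bsub>tf\<^esub>, 1\<^sub>0 \<circ>\<^sub>0 g] = [f, 1\<^sub>0] \<circ>\<^sub>0 [1\<^bsub>tf\<^esub>, g] = [1\<^bsub>tf\<^esub>, g]\<close>.\<close>

definition cell_bracket :: "'u \<times> 'v \<Rightarrow> 'u \<times> 'v \<Rightarrow> 'u \<times> 'v" (infixl \<open>\<odot>\<close> 72) where
  "X \<odot> Y = (\<lbrakk>fst X, fst Y\<rbrakk>, fst X \<rhd> snd Y - fst Y \<rhd> snd X + d1 (snd X) \<rhd> snd Y)"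

definition target :: "'u \<times> 'v \<Rightarrow> 'u" where
  "target X = fst X + d1 (snd X)"

lemma fst_cell_bracket [simp]: "fst (X \<odot> Y) = \<lbrakk>fst X, fst Y\<rbrakk>"
  by (simp add: cell_bracket_def)

lemma cell_bracket_add_left [simp]: "(X + X') \<odot> Y = X \<odot> Y + X' \<odot> Y"
  by (simp add: cell_bracket_def algebra_simps)

lemma cell_bracket_add_right [simp]: "X \<odot> (Y + Y') = X \<odot> Y + X \<odot> Y'"
  by (simp add: cell_bracket_def algebra_simps)

lemma target_add [simp]: "target (X + Y) = target X + target Y"
  by (simp add: target_def algebra_simps)

end

context lie3_up_to_coherence
begin

lemma d1_bracket_act1: "\<lbrakk>x, d1 f\<rbrakk> \<rhd> g = - (d1 g \<rhd> x \<rhd> f)" "\<lbrakk>d1 f, x\<rbrakk> \<rhd> g = d1 g \<rhd> x \<rhd> f"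
  using d1_act1[of "x \<rhd> f" g] act0_swap[of "d1 f" x] by (simp_all add: d1_act)

lemma cell_bracket_swap: "X \<odot> Y = - (Y \<odot> X)"
  using act0_swap[of "fst X" "fst Y"] d1_act1[of "snd X" "snd Y"]
  by (simp add: cell_bracket_def)

lemma target_cell_bracket [simp]: "target (X \<odot> Y) = \<lbrakk>target X, target Y\<rbrakk>"
  using act0_swap[of "d1 (snd X)" "fst Y"]
  by (simp add: cell_bracket_def target_def d1_act algebra_simps)

text \<open>Naturality of the Jacobiator in all three variables. Rewriting every Jacobiator with a
  boundary among its arguments by actions, and every action of a bracket that contains a boundary
  by iterated actions, leaves terms that cancel in pairs by \<open>d1_act1\<close>.\<close>

lemma jacobi_natural:
  "snd (X \<odot> Y \<odot> Z) + j (target X) (target Y) (target Z)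
   = j (fst X) (fst Y) (fst Z) + snd (X \<odot> Z \<odot> Y + X \<odot> (Y \<odot> Z))"
proof -
  obtain x f y g z h where [simp]: "X = (x, f)" "Y = (y, g)" "Z = (z, h)" by (metis surj_pair)
  \<comment> \<open>Actions of the boundary of one element on another are brought into the order \<open>f, g, h\<close>.\<close>
  note flips = d1_act1[of g f] d1_act1[of h f] d1_act1[of h g]
  show ?thesis
    by (simp add: cell_bracket_def target_def jacobi_d1 d1_act d1_bracket_act1 flips algebra_simps)
qed

text \<open>If the square \<open>P \<circ> g = f \<circ> Q\<close> of 1-cells commutes, so does its bracket with a 1-cell \<open>U\<close>. The
  sides \<open>f\<close> and \<open>g\<close> are bracketed with the identities of the source and the target of \<open>U\<close>.\<close>

lemma cell_bracket_naturality_whisker: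
  assumes nat: "snd P + g = f + snd Q" and f: "fst Q = fst P + d1 f"
  shows "snd (P \<odot> U) - target U \<rhd> g = - (fst U \<rhd> f) + snd (Q \<odot> U)"
proof -
  have P: "snd P = f + snd Q - g" using nat by (simp add: algebra_simps)
  have Q: "fst P = fst Q - d1 f" using f by simp
  show ?thesis
    using d1_act1[of g "snd U"]
    by (simp add: cell_bracket_def target_def P Q algebra_simps)
qed

text \<open>The source of the Identiator is pasted from Jacobiators, three of them bracketed with an
  identity 1-cell; its naturality is pasted from their naturality squares in the same way.\<close>

lemma ident_src_natural:
  "snd (X \<odot> Y \<odot> Z \<odot> U) + ident_src (target X) (target Y) (target Z) (target U)
   = ident_src (fst X) (fst Y) (fst Z) (fst U)
     + snd (idt_cod (\<odot>) [X, Y, Z, U])"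
proof -
  have w1: "snd (X \<odot> Y \<odot> Z \<odot> U) - target U \<rhd> j (target X) (target Y) (target Z)
    = - (fst U \<rhd> j (fst X) (fst Y) (fst Z)) + snd ((X \<odot> Z \<odot> Y + X \<odot> (Y \<odot> Z)) \<odot> U)"
    by (rule cell_bracket_naturality_whisker[OF jacobi_natural]) (simp add: d1_jacobi)
  have w2: "snd (X \<odot> Z \<odot> U \<odot> Y) - target Y \<rhd> j (target X) (target Z) (target U)
    = - (fst Y \<rhd> j (fst X) (fst Z) (fst U)) + snd ((X \<odot> U \<odot> Z + X \<odot> (Z \<odot> U)) \<odot> Y)"
    by (rule cell_bracket_naturality_whisker[OF jacobi_natural]) (simp add: d1_jacobi)
  have w3: "snd (Y \<odot> Z \<odot> U \<odot> X) - target X \<rhd> j (target Y) (target Z) (target U)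
    = - (fst X \<rhd> j (fst Y) (fst Z) (fst U)) + snd ((Y \<odot> U \<odot> Z + Y \<odot> (Z \<odot> U)) \<odot> X)"
    by (rule cell_bracket_naturality_whisker[OF jacobi_natural]) (simp add: d1_jacobi)
  show ?thesis
    using cell_bracket_swap[of X "Y \<odot> Z \<odot> U"] cell_bracket_swap[of X "Y \<odot> U \<odot> Z"]
      cell_bracket_swap[of X "Y \<odot> (Z \<odot> U)"]
    by (simp add: w1[unfolded diff_eq_eq] w2[unfolded diff_eq_eq] w3[unfolded diff_eq_eq]
        jacobi_natural[of "X \<odot> Z" Y U, folded eq_diff_eq]
        jacobi_natural[of X "Y \<odot> Z" U, folded eq_diff_eq]
        ident_src_def idt_cod_def Let_def)
qed

end

section \<open>Coordinates on cells\<close>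

locale splitting =
  fixes s0 :: "'k::field \<Rightarrow> 'u::ab_group_add \<Rightarrow> 'u"
    and s1 :: "'k \<Rightarrow> 'v::ab_group_add \<Rightarrow> 'v"
    and s2 :: "'k \<Rightarrow> 'w::ab_group_add \<Rightarrow> 'w"
    and sc0 :: "'k \<Rightarrow> 'a::ab_group_add \<Rightarrow> 'a"
    and sc1 :: "'k \<Rightarrow> 'b::ab_group_add \<Rightarrow> 'b"
    and sc2 :: "'k \<Rightarrow> 'c::ab_group_add \<Rightarrow> 'c"
    and i0 :: "'u \<Rightarrow> 'a"
    and i1 :: "'u \<times> 'v \<Rightarrow> 'b"
    and i2 :: "'u \<times> 'v \<times> 'w \<Rightarrow> 'c"
  assumes vector_spaces: "vector_space s0" "vector_space s1" "vector_space s2"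
    "vector_space sc0" "vector_space sc1" "vector_space sc2"
    and linear_i0: "Vector_Spaces.linear s0 sc0 i0" and bij_i0: "bij i0"
    and linear_i1: "Vector_Spaces.linear (scale_prod s0 s1) sc1 i1" and bij_i1: "bij i1"
    and linear_i2: "Vector_Spaces.linear (scale_prod s0 (scale_prod s1 s2)) sc2 i2"
    and bij_i2: "bij i2"
begin

text \<open>Coordinates on \<open>L\<^sub>2\<close> that keep the source 1-cell together.\<close>

definition e2 :: "'u \<times> 'v \<Rightarrow> 'w \<Rightarrow> 'c" where
  "e2 X a = i2 (fst X, snd X, a)"

lemma cells0: obtains x where "A = i0 x"
  using bij_i0 by (metis bij_pointE)

lemma cells1: obtains X where "f = i1 X"
  using bij_i1 by (metis bij_pointE)

lemma cells2: obtains X a where "\<alpha> = e2 X a"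
proof (rule that)
  show "\<alpha> = e2 (fst (inv i2 \<alpha>), fst (snd (inv i2 \<alpha>))) (snd (snd (inv i2 \<alpha>)))"
    by (simp add: e2_def bij_i2 bij_is_surj surj_f_inv_f)
qed

text \<open>Under meta-quantifiers, cells are replaced by their coordinates, as pairs are by
  \<open>split_paired_all\<close>.\<close>

lemma all_cells0: "(\<And>A. PROP P A) \<equiv> (\<And>x. PROP P (i0 x))"
proof
  fix A assume *: "\<And>x. PROP P (i0 x)"
  show "PROP P A" using *[of "inv i0 A"] by (simp add: bij_i0 bij_is_surj surj_f_inv_f)
qed

lemma all_cells1: "(\<And>f. PROP P f) \<equiv> (\<And>X. PROP P (i1 X))"
proof
  fix A assume *: "\<And>x. PROP P (i1 x)"
  show "PROP P A" using *[of "inv i1 A"] by (simp add: bij_i1 bij_is_surj surj_f_inv_f)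
qed

lemma all_cells2: "(\<And>\<alpha>. PROP P \<alpha>) \<equiv> (\<And>X a. PROP P (e2 X a))"
proof
  fix A assume *: "\<And>X a. PROP P (e2 X a)"
  show "PROP P A"
    using *[of "(fst (inv i2 A), fst (snd (inv i2 A)))" "snd (snd (inv i2 A))"]
    by (simp add: e2_def bij_i2 bij_is_surj surj_f_inv_f)
qed

lemmas all_cells = all_cells0 all_cells1 all_cells2

lemma All_cells0: "(\<forall>A. P A) \<longleftrightarrow> (\<forall>x. P (i0 x))" by (metis cells0)
lemma All_cells1: "(\<forall>f. P f) \<longleftrightarrow> (\<forall>X. P (i1 X))" by (metis cells1)
lemma All_cells2: "(\<forall>\<alpha>. P \<alpha>) \<longleftrightarrow> (\<forall>X a. P (e2 X a))" by (metis cells2)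
lemmas All_cells = All_cells0 All_cells1 All_cells2

lemma i0_simps [simp]:
  "i0 x + i0 y = i0 (x + y)" "i0 x - i0 y = i0 (x - y)" "- i0 x = i0 (- x)" "i0 0 = 0"
  "sc0 r (i0 x) = i0 (s0 r x)" "i0 x = i0 y \<longleftrightarrow> x = y" "i0 x = 0 \<longleftrightarrow> x = 0"
proof -
  interpret Vector_Spaces.linear s0 sc0 i0 by (rule linear_i0)
  show "i0 x + i0 y = i0 (x + y)" "i0 x - i0 y = i0 (x - y)" "- i0 x = i0 (- x)" "i0 0 = 0"
    "sc0 r (i0 x) = i0 (s0 r x)" by (simp_all add: add diff neg scale)
  show "i0 x = i0 y \<longleftrightarrow> x = y" using bij_i0 by (simp add: bij_is_inj inj_eq)
  show "i0 x = 0 \<longleftrightarrow> x = 0" using bij_i0 zero by (metis bij_is_inj inj_eq)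
qed

lemma i1_simps [simp]:
  "i1 X + i1 Y = i1 (X + Y)" "i1 X - i1 Y = i1 (X - Y)" "- i1 X = i1 (- X)" "i1 0 = 0"
  "sc1 r (i1 X) = i1 (scale_prod s0 s1 r X)" "i1 X = i1 Y \<longleftrightarrow> X = Y" "i1 X = 0 \<longleftrightarrow> X = 0"
proof -
  interpret Vector_Spaces.linear "scale_prod s0 s1" sc1 i1 by (rule linear_i1)
  show "i1 X + i1 Y = i1 (X + Y)" "i1 X - i1 Y = i1 (X - Y)" "- i1 X = i1 (- X)" "i1 0 = 0"
    "sc1 r (i1 X) = i1 (scale_prod s0 s1 r X)" by (simp_all add: add diff neg scale)
  show "i1 X = i1 Y \<longleftrightarrow> X = Y" using bij_i1 by (simp add: bij_is_inj inj_eq)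
  show "i1 X = 0 \<longleftrightarrow> X = 0" using bij_i1 zero by (metis bij_is_inj inj_eq)
qed

lemma e2_simps [simp]:
  "e2 X a + e2 Y b = e2 (X + Y) (a + b)" "e2 X a - e2 Y b = e2 (X - Y) (a - b)"
  "- e2 X a = e2 (- X) (- a)" "e2 0 0 = 0"
  "sc2 r (e2 X a) = e2 (scale_prod s0 s1 r X) (s2 r a)"
  "e2 X a = e2 Y b \<longleftrightarrow> X = Y \<and> a = b" "e2 X a = 0 \<longleftrightarrow> X = 0 \<and> a = 0"
proof -
  interpret Vector_Spaces.linear "scale_prod s0 (scale_prod s1 s2)" sc2 i2 by (rule linear_i2)
  show "e2 X a + e2 Y b = e2 (X + Y) (a + b)" "e2 X a - e2 Y b = e2 (X - Y) (a - b)"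
    "- e2 X a = e2 (- X) (- a)"
    by (simp_all add: e2_def flip: add diff neg)
  show z: "e2 0 0 = 0" by (simp add: e2_def zero flip: zero_prod_def)
  show "sc2 r (e2 X a) = e2 (scale_prod s0 s1 r X) (s2 r a)"
    by (cases X) (simp add: e2_def scale_prod_def flip: scale)
  show *: "e2 X a = e2 Y b \<longleftrightarrow> X = Y \<and> a = b" for X a Y b
    using bij_i2 by (auto simp: e2_def bij_is_inj inj_eq prod_eq_iff)
  show "e2 X a = 0 \<longleftrightarrow> X = 0 \<and> a = 0" unfolding z[symmetric] by (rule *)
qed

end

text \<open>The structure of \<open>L\<close> is given in coordinates by the components \<open>D\<close>. The Identiator is left
  open, because its source is itself a composite that has to be computed from the other
  operations.\<close>

locale low_coordinates =
  component_maps s0 s1 s2 D + splitting s0 s1 s2 sc0 sc1 sc2 i0 i1 i2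
  for s0 :: "'k::field \<Rightarrow> 'u::ab_group_add \<Rightarrow> 'u"
    and s1 :: "'k \<Rightarrow> 'v::ab_group_add \<Rightarrow> 'v"
    and s2 :: "'k \<Rightarrow> 'w::ab_group_add \<Rightarrow> 'w"
    and D
    and sc0 :: "'k \<Rightarrow> 'a::ab_group_add \<Rightarrow> 'a"
    and sc1 :: "'k \<Rightarrow> 'b::ab_group_add \<Rightarrow> 'b"
    and sc2 :: "'k \<Rightarrow> 'c::ab_group_add \<Rightarrow> 'c"
    and i0 :: "'u \<Rightarrow> 'a"
    and i1 :: "'u \<times> 'v \<Rightarrow> 'b"
    and i2 :: "'u \<times> 'v \<times> 'w \<Rightarrow> 'c" +
  fixes L :: "('a, 'b, 'c) lie3"
  assumes src1_cell [simp]: "src1 L (i1 X) = i0 (fst X)"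
    and tgt1_cell [simp]: "tgt1 L (i1 X) = i0 (target X)"
    and src2_cell [simp]: "src2 L (e2 X a) = i1 X"
    and tgt2_cell [simp]: "tgt2 L (e2 X a) = i1 (fst X, snd X + d2 a)"
    and one0_cell [simp]: "one0 L (i0 x) = i1 (x, 0)"
    and one1_cell [simp]: "one1 L (i1 X) = e2 X 0"
    and comp10_cell: "comp10 L (i1 X) (i1 Y)
      = (if fst Y = target X then i1 (fst X, snd X + snd Y) else 0)"
    and comp20_cell: "comp20 L (e2 X a) (e2 Y b)
      = (if fst Y = target X then e2 (fst X, snd X + snd Y) (a + b) else 0)"
    and comp21_cell: "comp21 L (e2 X a) (e2 Y b)
      = (if Y = (fst X, snd X + d2 a) then e2 X (a + b) else 0)"
    and br0_cell [simp]: "br0 L (i0 x) (i0 y) = i0 \<lbrakk>x, y\<rbrakk>"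
    and br1_cell [simp]: "br1 L (i1 X) (i1 Y) = i1 (X \<odot> Y)"
    and br2_cell [simp]: "br2 L (e2 X a) (e2 Y b) = e2 (X \<odot> Y) (fst X \<unrhd> b - fst Y \<unrhd> a)"
    and jac_cell [simp]: "jac L (i0 x) (i0 y) (i0 z) = i1 (\<lbrakk>\<lbrakk>x,y\<rbrakk>,z\<rbrakk>, j x y z)"
begin

lemma able_cell:
  "able10 L (i1 X) (i1 Y) \<longleftrightarrow> fst Y = target X"
  "able20 L (e2 X a) (e2 Y b) \<longleftrightarrow> fst Y = target X + d1 (d2 a)"
  "able21 L (e2 X a) (e2 Y b) \<longleftrightarrow> Y = (fst X, snd X + d2 a)"
  by (auto simp: able10_def able20_def able21_def target_def add.assoc)

lemma part_cell [simp]: "part1 L (i1 X) = i1 (0, snd X)" "part2 L (e2 X a) = e2 0 a"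
  by (simp_all add: part1_def part2_def prod_eq_iff)

lemma inverse2_cell [simp]: "inverse2 L (e2 X a) = e2 (fst X, snd X + d2 a) (- a)"
  by (simp add: inverse2_def zero_prod_def)

lemma pad10_cell [simp]: "pad10 L (i1 X) (i1 Y) = i1 (fst X, snd X + snd Y)"
  by (simp add: pad10_def comp10_cell)

end

section \<open>The axioms of a Lie 3-algebra in coordinates\<close>

lemma all_list_all2_two:
  "(\<forall>fs gs. length fs = 2 \<and> list_all2 R fs gs \<longrightarrow> P fs gs) \<longleftrightarrow>
     (\<forall>a b c d. R a c \<and> R b d \<longrightarrow> P [a, b] [c, d])"
  by (auto simp: length_two list_all2_Cons1)

context component_maps
begin

lemma ident_src_multilinear [simp]:
  "ident_src (x + x') y z u = ident_src x y z u + ident_src x' y z u"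
  "ident_src x (y + y') z u = ident_src x y z u + ident_src x y' z u"
  "ident_src x y (z + z') u = ident_src x y z u + ident_src x y z' u"
  "ident_src x y z (u + u') = ident_src x y z u + ident_src x y z u'"
  "ident_src (s0 r x) y z u = s1 r (ident_src x y z u)"
  "ident_src x (s0 r y) z u = s1 r (ident_src x y z u)"
  "ident_src x y (s0 r z) u = s1 r (ident_src x y z u)"
  "ident_src x y z (s0 r u) = s1 r (ident_src x y z u)"
  by (simp_all add: ident_src_def V1.scale_right_distrib V1.scale_right_diff_distrib)

end

context lie3_up_to_coherence
begin

lemma target_ident_src:
  "target (\<lbrakk>\<lbrakk>\<lbrakk>x,y\<rbrakk>,z\<rbrakk>,u\<rbrakk>, ident_src x y z u) = idt_cod (act0 D) [x, y, z, u]"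
  by (simp add: target_def ident_src_def idt_cod_def Let_def d1_act d1_jacobi
      act0_swap[of u "\<lbrakk>_,_\<rbrakk>"] act0_swap[of y "\<lbrakk>_,_\<rbrakk>"] algebra_simps)

lemma ident_target: "m (target x) (target y) (target z) (target u) = m (fst x) (fst y) (fst z) (fst u)"
  by (simp add: target_def ident_d1 ident_d1_inner)

lemma cell_bracket_composite:
  "snd ((x, f + f') \<odot> (y, g + g'))
   = snd ((x, f) \<odot> (y, g)) + snd ((x + d1 f, f') \<odot> (y + d1 g, g'))"
  using d1_act1[of f' g] by (simp add: cell_bracket_def algebra_simps)

lemma cell_bracket_boundary:
  "snd ((x, d2 a) \<odot> (y, d2 b)) = d2 (x \<unrhd> b - y \<unrhd> a)"
  by (simp add: cell_bracket_def d1_d2 d2_act)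

lemma cell_bracket_identities: "snd ((x, 0) \<odot> (y, 0)) = 0"
  by (simp add: cell_bracket_def)

lemma d1_cell_bracket:
  "d1 (snd ((x, f) \<odot> (y, g))) = \<lbrakk>d1 f, y\<rbrakk> + (\<lbrakk>x, d1 g\<rbrakk> + \<lbrakk>d1 f, d1 g\<rbrakk>)"
  using act0_swap[of y "d1 f"] by (simp add: cell_bracket_def d1_act)

end

context low_coordinates
begin

lemma pad20_cell:
  assumes "\<And>a. d1 (d2 a) = 0"
  shows "pad20 L (e2 X a) (e2 Y b) = e2 (fst X, snd X + snd Y) (a + b)"
  by (simp add: pad20_def comp20_cell target_def assms)

text \<open>The two hypotheses make the 1-cells composable; compositions of other pairs have the dummy
  value 0, and the formula would fail.\<close>

lemma ident_src_cell:
  assumes d1_act: "\<And>x f. d1 (x \<rhd> f) = \<lbrakk>x, d1 f\<rbrakk>"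
    and d1_jacobi: "\<And>x y z. d1 (j x y z) = \<lbrakk>\<lbrakk>x,z\<rbrakk>,y\<rbrakk> + \<lbrakk>x,\<lbrakk>y,z\<rbrakk>\<rbrakk> - \<lbrakk>\<lbrakk>x,y\<rbrakk>,z\<rbrakk>"
  shows "idt_src L (i0 x) (i0 y) (i0 z) (i0 u) = i1 (\<lbrakk>\<lbrakk>\<lbrakk>x,y\<rbrakk>,z\<rbrakk>,u\<rbrakk>, ident_src x y z u)"
  by (simp add: idt_src_def cell_bracket_def comp10_cell target_def assms ident_src_def
      act0_swap[of u] algebra_simps)

lemma ident_tgt_cell:
  assumes d1_act: "\<And>x f. d1 (x \<rhd> f) = \<lbrakk>x, d1 f\<rbrakk>"
    and d1_jacobi: "\<And>x y z. d1 (j x y z) = \<lbrakk>\<lbrakk>x,z\<rbrakk>,y\<rbrakk> + \<lbrakk>x,\<lbrakk>y,z\<rbrakk>\<rbrakk> - \<lbrakk>\<lbrakk>x,y\<rbrakk>,z\<rbrakk>"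
  shows "idt_tgt L (i0 x) (i0 y) (i0 z) (i0 u) = i1 (\<lbrakk>\<lbrakk>\<lbrakk>x,y\<rbrakk>,z\<rbrakk>,u\<rbrakk>, ident_tgt x y z u)"
  by (simp add: idt_tgt_def cell_bracket_def comp10_cell target_def assms ident_tgt_def
      act0_swap[of z] algebra_simps)

end

locale coordinates = low_coordinates s0 s1 s2 D sc0 sc1 sc2 i0 i1 i2 L
  for s0 :: "'k::field \<Rightarrow> 'u::ab_group_add \<Rightarrow> 'u"
    and s1 :: "'k \<Rightarrow> 'v::ab_group_add \<Rightarrow> 'v"
    and s2 :: "'k \<Rightarrow> 'w::ab_group_add \<Rightarrow> 'w"
    and D
    and sc0 :: "'k \<Rightarrow> 'a::ab_group_add \<Rightarrow> 'a"
    and sc1 :: "'k \<Rightarrow> 'b::ab_group_add \<Rightarrow> 'b"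
    and sc2 :: "'k \<Rightarrow> 'c::ab_group_add \<Rightarrow> 'c"
    and i0 :: "'u \<Rightarrow> 'a"
    and i1 :: "'u \<times> 'v \<Rightarrow> 'b"
    and i2 :: "'u \<times> 'v \<times> 'w \<Rightarrow> 'c"
    and L :: "('a, 'b, 'c) lie3" +
  assumes idt_cell: "idt L (i0 x) (i0 y) (i0 z) (i0 u)
    = e2 (\<lbrakk>\<lbrakk>\<lbrakk>x,y\<rbrakk>,z\<rbrakk>,u\<rbrakk>, ident_src x y z u) (m x y z u)"

context low_coordinates
begin

lemma scale_prod_simps [simp]:
  "fst (scale_prod s0 s1 r X) = s0 r (fst X)" "snd (scale_prod s0 s1 r X) = s1 r (snd X)"
  by (simp_all add: scale_prod_def)

lemma scale_prod_cell_bracket [simp]: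
  "X \<odot> scale_prod s0 s1 r Y = scale_prod s0 s1 r (X \<odot> Y)"
  "scale_prod s0 s1 r X \<odot> Y = scale_prod s0 s1 r (X \<odot> Y)"
  by (simp_all add: cell_bracket_def scale_prod_def V1.scale_right_distrib
      V1.scale_right_diff_distrib)

lemma two_category:
  assumes "lie3_up_to_coherence s0 s1 s2 D"
  shows "linear_2_category sc0 sc1 sc2 L"
proof -
  interpret lie3_up_to_coherence s0 s1 s2 D by fact
  note facts = able_cell comp10_cell comp20_cell comp21_cell target_def d1_d2 prod_eq_iff
  have lin: "linear_composition sc1 (able10 L) (comp10 L)"
    "linear_composition sc2 (able20 L) (comp20 L)"
    "linear_composition sc2 (able21 L) (comp21 L)"
    unfolding linear_composition_def All_cells by (auto simp: facts algebra_simps)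
  show ?thesis
    apply (intro linear_2_category.intro linear_2_category_axioms.intro vector_spaces lin)
    unfolding linear_iff All_cells all_cells
    by (simp_all add: facts vector_spaces algebra_simps)
qed

lemma bracket_functor:
  assumes "lie3_up_to_coherence s0 s1 s2 D"
  shows "multilinear_2_functor 2 sc0 sc1 sc2 L
       \<lparr>on0 = \<lambda>xs. br0 L (xs ! 0) (xs ! 1),
        on1 = \<lambda>fs. br1 L (fs ! 0) (fs ! 1),
        on2 = \<lambda>\<alpha>s. br2 L (\<alpha>s ! 0) (\<alpha>s ! 1)\<rparr>"
proof -
  interpret lie3_up_to_coherence s0 s1 s2 D by fact
  note facts = able_cell comp10_cell comp20_cell comp21_cell d1_d2 prod_eq_iff
  show ?thesis
    unfolding multilinear_2_functor_def multilinear_two all_list_all2_two all_length_two All_cells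
      linear_iff
    by (simp add: vector_spaces facts target_def cell_bracket_composite cell_bracket_boundary
        cell_bracket_identities d1_cell_bracket
        V2.scale_right_diff_distrib d1_act2)
qed

lemma brackets_antisymmetric:
  assumes "lie3_up_to_coherence s0 s1 s2 D"
  shows "\<forall>x y. br0 L x y = - br0 L y x" "\<forall>f g. br1 L f g = - br1 L g f"
    "\<forall>\<alpha> \<beta>. br2 L \<alpha> \<beta> = - br2 L \<beta> \<alpha>"
proof -
  interpret lie3_up_to_coherence s0 s1 s2 D by fact
  show "\<forall>x y. br0 L x y = - br0 L y x" "\<forall>f g. br1 L f g = - br1 L g f"
    "\<forall>\<alpha> \<beta>. br2 L \<alpha> \<beta> = - br2 L \<beta> \<alpha>"
    by (simp_all add: All_cells act0_swap[symmetric] cell_bracket_swap[symmetric])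
qed

lemma jacobiator:
  assumes "lie3_up_to_coherence s0 s1 s2 D"
  shows "multilinear_2_transformation 3 sc0 sc1 L
       \<lparr>on0 = jac_dom (br0 L), on1 = jac_dom (br1 L), on2 = jac_dom (br2 L)\<rparr>
       \<lparr>on0 = jac_cod (br0 L), on1 = jac_cod (br1 L), on2 = jac_cod (br2 L)\<rparr>
       (\<lambda>xs. jac L (xs ! 0) (xs ! 1) (xs ! 2))"
proof -
  interpret lie3_up_to_coherence s0 s1 s2 D by fact
  have nat: "snd (X \<odot> Y \<odot> Z) + j (target X) (target Y) (target Z)
      = j (fst X) (fst Y) (fst Z) + (snd (X \<odot> Z \<odot> Y) + snd (X \<odot> (Y \<odot> Z)))" for X Y Z
    using jacobi_natural[of X Y Z] by simp
  have tgt: "target (fst X, snd X + d2 a) = target X" for X a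
    by (simp add: target_def d1_d2)
  have tgt_jac: "target (\<lbrakk>\<lbrakk>x,y\<rbrakk>,z\<rbrakk>, j x y z) = \<lbrakk>\<lbrakk>x,z\<rbrakk>,y\<rbrakk> + \<lbrakk>x,\<lbrakk>y,z\<rbrakk>\<rbrakk>" for x y z
    by (simp add: target_def d1_jacobi)
  show ?thesis
    unfolding multilinear_2_transformation_def multilinear_three all_length_three All_cells
      linear_iff
    by (simp add: vector_spaces jac_dom_def jac_cod_def comp20_cell nat tgt numeral_2_eq_2
        tgt_jac scale_prod_def act2_bracket prod_eq_iff del: split_paired_All)
qed

lemma jacobiator_antisymmetric:
  "antisymmetric 3 (\<lambda>xs. part1 L (jac L (xs ! 0) (xs ! 1) (xs ! 2)))"
  unfolding antisymmetric_three All_cells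
  by (simp add: numeral_2_eq_2) (blast intro: jacobi_swap12 jacobi_swap23)

end

context coordinates
begin

text \<open>In the naturality equation, the \<open>V\<^sub>1\<close>-components agree by \<open>ident_src_natural\<close>. The
  \<open>V\<^sub>2\<close>-components agree because the Identiator ignores boundaries and \<open>V\<^sub>0\<close> acts on \<open>V\<^sub>2\<close>
  without homotopies (\<open>act2_bracket\<close>).\<close>

lemma identiator:
  assumes "lie3_up_to_coherence s0 s1 s2 D"
  shows "multilinear_2_modification 4 sc0 sc2 L
       \<lparr>on0 = idt_dom (br0 L), on1 = idt_dom (br1 L), on2 = idt_dom (br2 L)\<rparr>
       \<lparr>on0 = idt_cod (br0 L), on1 = idt_cod (br1 L), on2 = idt_cod (br2 L)\<rparr>
       (\<lambda>xs. idt_src L (xs ! 0) (xs ! 1) (xs ! 2) (xs ! 3))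
       (\<lambda>xs. idt_tgt L (xs ! 0) (xs ! 1) (xs ! 2) (xs ! 3))
       (\<lambda>xs. idt L (xs ! 0) (xs ! 1) (xs ! 2) (xs ! 3))"
proof -
  interpret lie3_up_to_coherence s0 s1 s2 D by fact
  note nat = ident_src_natural[unfolded idt_cod_def Let_def, simplified]
  have tgt: "target (fst X, snd X + d2 a) = target X" for X a
    by (simp add: target_def d1_d2)
  note src_cell = ident_src_cell[OF d1_act d1_jacobi]
  note tgt_cell = ident_tgt_cell[OF d1_act d1_jacobi]
  show ?thesis
    unfolding multilinear_2_modification_def multilinear_four all_length_four All_cells
      linear_iff
    by (simp add: vector_spaces idt_dom_def idt_cod_def Let_def comp20_cell nat tgt
        numeral_2_eq_2 numeral_3_eq_3 d2_ident idt_cell src_cell tgt_cell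
        target_ident_src[unfolded idt_cod_def Let_def, simplified] ident_target
        scale_prod_def act2_bracket prod_eq_iff del: split_paired_All)
qed

lemma identiator_antisymmetric:
  "antisymmetric 4 (\<lambda>xs. part2 L (idt L (xs ! 0) (xs ! 1) (xs ! 2) (xs ! 3)))"
  unfolding antisymmetric_four All_cells
  by (simp add: numeral_2_eq_2 numeral_3_eq_3 idt_cell)
    (blast intro: ident_swap12 ident_swap23 ident_swap34)

end

section \<open>The coherence law in coordinates\<close>

context component_maps
begin

text \<open>For each of the four 2-cells of the coherence law, the \<open>V\<^sub>1\<close>-component (that of its source)
  and the \<open>V\<^sub>2\<close>-component.\<close>

definition alpha1_src where
  "alpha1_src x y z u v =
        j \<lbrakk>\<lbrakk>x,y\<rbrakk>,z\<rbrakk> u v + ident_src x y z \<lbrakk>u,v\<rbrakk> - u \<rhd> ident_src x y z v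
        - u \<rhd> (j x \<lbrakk>z,v\<rbrakk> y + j \<lbrakk>x,v\<rbrakk> z y + j x z \<lbrakk>y,v\<rbrakk>)
        + ident_src \<lbrakk>x,v\<rbrakk> y z u + ident_src x \<lbrakk>y,v\<rbrakk> z u + ident_src x y \<lbrakk>z,v\<rbrakk> u"

definition alpha1_part where
  "alpha1_part x y z u v =
    m x y z \<lbrakk>u,v\<rbrakk> - u \<unrhd> m x y z v + m \<lbrakk>x,v\<rbrakk> y z u + m x \<lbrakk>y,v\<rbrakk> z u + m x y \<lbrakk>z,v\<rbrakk> u"

definition alpha4_src where
  "alpha4_src x y z u v =
        - (v \<rhd> ident_src x y z u)
        - v \<rhd> (j \<lbrakk>x,u\<rbrakk> z y + j x z \<lbrakk>y,u\<rbrakk> + j x \<lbrakk>z,u\<rbrakk> y)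
        + ident_src \<lbrakk>x,u\<rbrakk> y z v + ident_src x \<lbrakk>y,u\<rbrakk> z v + ident_src x y \<lbrakk>z,u\<rbrakk> v
        + (y \<rhd> z \<rhd> j x u v - \<lbrakk>y,z\<rbrakk> \<rhd> j x u v - x \<rhd> z \<rhd> j y u v - y \<rhd> x \<rhd> j z u v
           + x \<rhd> y \<rhd> j z u v + \<lbrakk>x,z\<rbrakk> \<rhd> j y u v)"

definition alpha4_part where
  "alpha4_part x y z u v =
    - (v \<unrhd> m x y z u) + m \<lbrakk>x,u\<rbrakk> y z v + m x \<lbrakk>y,u\<rbrakk> z v + m x y \<lbrakk>z,u\<rbrakk> v"

definition alpha3_src where
  "alpha3_src x y z u v =
        ident_src \<lbrakk>x,y\<rbrakk> z u v - z \<rhd> j \<lbrakk>x,y\<rbrakk> v u - z \<rhd> ident_src x y u v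
        + (- (\<lbrakk>z,u\<rbrakk> \<rhd> j x y v) + j x y \<lbrakk>\<lbrakk>z,v\<rbrakk>,u\<rbrakk> + j x y \<lbrakk>z,\<lbrakk>u,v\<rbrakk>\<rbrakk>
           + j \<lbrakk>\<lbrakk>x,v\<rbrakk>,u\<rbrakk> y z + j \<lbrakk>x,v\<rbrakk> \<lbrakk>y,u\<rbrakk> z + j \<lbrakk>x,u\<rbrakk> \<lbrakk>y,v\<rbrakk> z + j x \<lbrakk>\<lbrakk>y,v\<rbrakk>,u\<rbrakk> z
           + j \<lbrakk>x,\<lbrakk>u,v\<rbrakk>\<rbrakk> y z + j x \<lbrakk>y,\<lbrakk>u,v\<rbrakk>\<rbrakk> z - \<lbrakk>z,v\<rbrakk> \<rhd> j x y u)
        + (j x \<lbrakk>y,v\<rbrakk> \<lbrakk>z,u\<rbrakk> + j \<lbrakk>x,v\<rbrakk> y \<lbrakk>z,u\<rbrakk> + j x \<lbrakk>y,u\<rbrakk> \<lbrakk>z,v\<rbrakk> + j \<lbrakk>x,u\<rbrakk> y \<lbrakk>z,v\<rbrakk>)"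

definition alpha3_part where
  "alpha3_part x y z u v =
    m \<lbrakk>x,y\<rbrakk> z u v - z \<unrhd> m x y u v"

definition alpha2_src where
  "alpha2_src x y z u v =
        v \<rhd> u \<rhd> j x y z + ident_src \<lbrakk>x,z\<rbrakk> y u v + ident_src x \<lbrakk>y,z\<rbrakk> u v
        + (x \<rhd> j \<lbrakk>y,z\<rbrakk> v u - y \<rhd> j \<lbrakk>x,z\<rbrakk> v u)
        + (x \<rhd> ident_src y z u v - y \<rhd> ident_src x z u v)
        + (- (\<lbrakk>y,u\<rbrakk> \<rhd> j x z v) - \<lbrakk>y,v\<rbrakk> \<rhd> j x z u + \<lbrakk>x,v\<rbrakk> \<rhd> j y z u + \<lbrakk>x,u\<rbrakk> \<rhd> j y z v)"

definition alpha2_part where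
  "alpha2_part x y z u v =
    m \<lbrakk>x,z\<rbrakk> y u v + m x \<lbrakk>y,z\<rbrakk> u v + x \<unrhd> m y z u v - y \<unrhd> m x z u v"

end

context lie3_up_to_coherence
begin

lemma d1_ident_src:
  "d1 (ident_src x y z u) = idt_cod (act0 D) [x, y, z, u] - \<lbrakk>\<lbrakk>\<lbrakk>x,y\<rbrakk>,z\<rbrakk>,u\<rbrakk>"
  using target_ident_src[of x y z u] by (simp add: target_def algebra_simps)

end

context coordinates
begin

context
  assumes ss: "lie3_up_to_coherence s0 s1 s2 D"
begin

interpretation lie3_up_to_coherence s0 s1 s2 D by (rule ss)

context
  fixes x y z u v :: 'u
begin

text \<open>Antisymmetry, oriented towards a normal form of the expressions in five elements. In brackets,
  compound entries precede letters and longer entries precede shorter ones; in Jacobiators,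
  letters precede compound entries; ties are broken by the order \<open>x, y, z, u, v\<close>. The elements
  are fixed because rewriting with antisymmetry for arbitrary arguments does not terminate.\<close>

  lemmas bracket_flips =
    act0_swap[of y x] act0_swap[of z x] act0_swap[of u x] act0_swap[of v x] act0_swap[of z y]
    act0_swap[of u y] act0_swap[of v y] act0_swap[of u z] act0_swap[of v z] act0_swap[of v u]
    act0_swap[of x "\<lbrakk>_,_\<rbrakk>"] act0_swap[of y "\<lbrakk>_,_\<rbrakk>"]
    act0_swap[of z "\<lbrakk>_,_\<rbrakk>"] act0_swap[of u "\<lbrakk>_,_\<rbrakk>"]
    act0_swap[of v "\<lbrakk>_,_\<rbrakk>"]
    act0_swap[of "\<lbrakk>z,u\<rbrakk>" "\<lbrakk>x,y\<rbrakk>"]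
    act0_swap[of "\<lbrakk>z,v\<rbrakk>" "\<lbrakk>x,y\<rbrakk>"]
    act0_swap[of "\<lbrakk>u,v\<rbrakk>" "\<lbrakk>x,y\<rbrakk>"]
    act0_swap[of "\<lbrakk>y,u\<rbrakk>" "\<lbrakk>x,z\<rbrakk>"]
    act0_swap[of "\<lbrakk>y,v\<rbrakk>" "\<lbrakk>x,z\<rbrakk>"]
    act0_swap[of "\<lbrakk>u,v\<rbrakk>" "\<lbrakk>x,z\<rbrakk>"]
    act0_swap[of "\<lbrakk>y,z\<rbrakk>" "\<lbrakk>x,u\<rbrakk>"]
    act0_swap[of "\<lbrakk>y,v\<rbrakk>" "\<lbrakk>x,u\<rbrakk>"]
    act0_swap[of "\<lbrakk>z,v\<rbrakk>" "\<lbrakk>x,u\<rbrakk>"]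
    act0_swap[of "\<lbrakk>y,z\<rbrakk>" "\<lbrakk>x,v\<rbrakk>"]
    act0_swap[of "\<lbrakk>y,u\<rbrakk>" "\<lbrakk>x,v\<rbrakk>"]
    act0_swap[of "\<lbrakk>z,u\<rbrakk>" "\<lbrakk>x,v\<rbrakk>"]
    act0_swap[of "\<lbrakk>u,v\<rbrakk>" "\<lbrakk>y,z\<rbrakk>"]
    act0_swap[of "\<lbrakk>z,v\<rbrakk>" "\<lbrakk>y,u\<rbrakk>"]
    act0_swap[of "\<lbrakk>z,u\<rbrakk>" "\<lbrakk>y,v\<rbrakk>"]
    act0_swap[of "\<lbrakk>x,y\<rbrakk>" "\<lbrakk>\<lbrakk>_,_\<rbrakk>,_\<rbrakk>"]
    act0_swap[of "\<lbrakk>x,z\<rbrakk>" "\<lbrakk>\<lbrakk>_,_\<rbrakk>,_\<rbrakk>"]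
    act0_swap[of "\<lbrakk>x,u\<rbrakk>" "\<lbrakk>\<lbrakk>_,_\<rbrakk>,_\<rbrakk>"]
    act0_swap[of "\<lbrakk>x,v\<rbrakk>" "\<lbrakk>\<lbrakk>_,_\<rbrakk>,_\<rbrakk>"]
    act0_swap[of "\<lbrakk>y,z\<rbrakk>" "\<lbrakk>\<lbrakk>_,_\<rbrakk>,_\<rbrakk>"]
    act0_swap[of "\<lbrakk>y,u\<rbrakk>" "\<lbrakk>\<lbrakk>_,_\<rbrakk>,_\<rbrakk>"]
    act0_swap[of "\<lbrakk>y,v\<rbrakk>" "\<lbrakk>\<lbrakk>_,_\<rbrakk>,_\<rbrakk>"]
    act0_swap[of "\<lbrakk>z,u\<rbrakk>" "\<lbrakk>\<lbrakk>_,_\<rbrakk>,_\<rbrakk>"]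
    act0_swap[of "\<lbrakk>z,v\<rbrakk>" "\<lbrakk>\<lbrakk>_,_\<rbrakk>,_\<rbrakk>"]
    act0_swap[of "\<lbrakk>u,v\<rbrakk>" "\<lbrakk>\<lbrakk>_,_\<rbrakk>,_\<rbrakk>"]

  lemmas jacobi_flips =
    jacobi_swap12[of y x] jacobi_swap12[of z x] jacobi_swap12[of u x] jacobi_swap12[of v x]
    jacobi_swap12[of z y] jacobi_swap12[of u y] jacobi_swap12[of v y] jacobi_swap12[of u z]
    jacobi_swap12[of v z] jacobi_swap12[of v u] jacobi_swap23[of _ y x] jacobi_swap23[of _ z x]
    jacobi_swap23[of _ u x] jacobi_swap23[of _ v x] jacobi_swap23[of _ z y]
    jacobi_swap23[of _ u y] jacobi_swap23[of _ v y] jacobi_swap23[of _ u z]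
    jacobi_swap23[of _ v z] jacobi_swap23[of _ v u] jacobi_swap12[of "\<lbrakk>_,_\<rbrakk>" x]
    jacobi_swap12[of "\<lbrakk>_,_\<rbrakk>" y] jacobi_swap12[of "\<lbrakk>_,_\<rbrakk>" z]
    jacobi_swap12[of "\<lbrakk>_,_\<rbrakk>" u] jacobi_swap12[of "\<lbrakk>_,_\<rbrakk>" v]
    jacobi_swap23[of _ "\<lbrakk>_,_\<rbrakk>" x] jacobi_swap23[of _ "\<lbrakk>_,_\<rbrakk>" y]
    jacobi_swap23[of _ "\<lbrakk>_,_\<rbrakk>" z] jacobi_swap23[of _ "\<lbrakk>_,_\<rbrakk>" u]
    jacobi_swap23[of _ "\<lbrakk>_,_\<rbrakk>" v]
    jacobi_swap23[of _ "\<lbrakk>z,u\<rbrakk>" "\<lbrakk>x,y\<rbrakk>"]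
    jacobi_swap23[of _ "\<lbrakk>z,v\<rbrakk>" "\<lbrakk>x,y\<rbrakk>"]
    jacobi_swap23[of _ "\<lbrakk>u,v\<rbrakk>" "\<lbrakk>x,y\<rbrakk>"]
    jacobi_swap23[of _ "\<lbrakk>y,u\<rbrakk>" "\<lbrakk>x,z\<rbrakk>"]
    jacobi_swap23[of _ "\<lbrakk>y,v\<rbrakk>" "\<lbrakk>x,z\<rbrakk>"]
    jacobi_swap23[of _ "\<lbrakk>u,v\<rbrakk>" "\<lbrakk>x,z\<rbrakk>"]
    jacobi_swap23[of _ "\<lbrakk>y,z\<rbrakk>" "\<lbrakk>x,u\<rbrakk>"]
    jacobi_swap23[of _ "\<lbrakk>y,v\<rbrakk>" "\<lbrakk>x,u\<rbrakk>"]
    jacobi_swap23[of _ "\<lbrakk>z,v\<rbrakk>" "\<lbrakk>x,u\<rbrakk>"]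
    jacobi_swap23[of _ "\<lbrakk>y,z\<rbrakk>" "\<lbrakk>x,v\<rbrakk>"]
    jacobi_swap23[of _ "\<lbrakk>y,u\<rbrakk>" "\<lbrakk>x,v\<rbrakk>"]
    jacobi_swap23[of _ "\<lbrakk>z,u\<rbrakk>" "\<lbrakk>x,v\<rbrakk>"]
    jacobi_swap23[of _ "\<lbrakk>u,v\<rbrakk>" "\<lbrakk>y,z\<rbrakk>"]
    jacobi_swap23[of _ "\<lbrakk>z,v\<rbrakk>" "\<lbrakk>y,u\<rbrakk>"]
    jacobi_swap23[of _ "\<lbrakk>z,u\<rbrakk>" "\<lbrakk>y,v\<rbrakk>"]

lemmas pad20_pair = pad20_cell[OF d1_d2]
lemmas d1_simps = d1_act d1_jacobi d1_ident_src idt_cod_def Let_def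

lemmas alpha_simps = pad20_pair comp20_cell idt_cell cell_bracket_def target_def

lemma alpha1_cell:
  "alpha1 L (i0 x) (i0 y) (i0 z) (i0 u) (i0 v) =
    e2 (\<lbrakk>\<lbrakk>\<lbrakk>\<lbrakk>x,y\<rbrakk>,z\<rbrakk>,u\<rbrakk>,v\<rbrakk>,
        alpha1_src x y z u v)
       (alpha1_part x y z u v)"
  by (simp add: alpha1_def alpha1_src_def alpha1_part_def alpha_simps d1_jacobi)

lemma alpha4_cell:
  "alpha4 L (i0 x) (i0 y) (i0 z) (i0 u) (i0 v) =
    e2 (\<lbrakk>\<lbrakk>\<lbrakk>\<lbrakk>x,y\<rbrakk>,z\<rbrakk>,u\<rbrakk>,v\<rbrakk>,
        alpha4_src x y z u v)
       (alpha4_part x y z u v)"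
  by (simp add: alpha4_def alpha4_src_def alpha4_part_def alpha_simps d1_simps bracket_flips algebra_simps)

lemma alpha3_cell:
  "alpha3 L (i0 x) (i0 y) (i0 z) (i0 u) (i0 v) =
    e2 (\<lbrakk>\<lbrakk>\<lbrakk>\<lbrakk>x,y\<rbrakk>,z\<rbrakk>,u\<rbrakk>,v\<rbrakk>,
        alpha3_src x y z u v)
       (alpha3_part x y z u v)"
  by (simp add: alpha3_def alpha3_src_def alpha3_part_def alpha_simps d1_simps bracket_flips algebra_simps)

lemma alpha2_cell:
  "alpha2 L (i0 x) (i0 y) (i0 z) (i0 u) (i0 v) =
    e2 (\<lbrakk>\<lbrakk>\<lbrakk>\<lbrakk>x,y\<rbrakk>,z\<rbrakk>,u\<rbrakk>,v\<rbrakk>,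
        alpha2_src x y z u v)
       (alpha2_part x y z u v)"
  by (simp add: alpha2_def alpha2_src_def alpha2_part_def alpha_simps d1_simps bracket_flips algebra_simps)

text \<open>The \<open>V\<^sub>1\<close>-component of the coherence law holds automatically. With the boundaries of the
  Identiators expanded, no Identiator is left, and the two sides differ by instances of
  \<open>act1_bracket\<close> in which \<open>f\<close> is a Jacobiator.\<close>

lemma alpha_boundaries:
  "alpha1_src x y z u v + alpha4_src x y z u v + d2 (alpha4_part x y z u v)
   = alpha3_src x y z u v + alpha2_src x y z u v + d2 (alpha2_part x y z u v)"
  by (simp add: alpha1_src_def alpha2_src_def alpha3_src_def alpha4_src_def alpha2_part_def
      alpha4_part_def ident_src_def ident_tgt_def d2_act d2_ident d1_jacobi act1_bracket
      bracket_flips jacobi_flips algebra_simps)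

end

lemma coherence:
  "coherence_law L \<longleftrightarrow>
    (\<forall>x y z u v. alpha1_part x y z u v - alpha4_part x y z u v
       = alpha3_part x y z u v - alpha2_part x y z u v)"
  using alpha_boundaries
  by (simp add: coherence_law_def All_cells0 alpha1_cell alpha2_cell alpha3_cell alpha4_cell
      add.assoc)

end

end

section \<open>Equations between components from the axioms\<close>

context component_maps
begin

text \<open>The \<open>V\<^sub>2\<close>-component of the coherence law is the equation \<open>ident_coherence\<close>.\<close>

lemma coherence_parts:
  "alpha1_part x y z u v - alpha4_part x y z u v = alpha3_part x y z u v - alpha2_part x y z u v
   \<longleftrightarrow> v \<unrhd> m x y z u - u \<unrhd> m x y z v + z \<unrhd> m x y u v - y \<unrhd> m x z u v + x \<unrhd> m y z u v
       = m \<lbrakk>x,y\<rbrakk> z u v - m \<lbrakk>x,z\<rbrakk> y u v + m \<lbrakk>x,u\<rbrakk> y z v - m \<lbrakk>x,v\<rbrakk> y z u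
         - m x \<lbrakk>y,z\<rbrakk> u v + m x \<lbrakk>y,u\<rbrakk> z v - m x \<lbrakk>y,v\<rbrakk> z u
         + m x y \<lbrakk>z,u\<rbrakk> v - m x y \<lbrakk>z,v\<rbrakk> u - m x y z \<lbrakk>u,v\<rbrakk>"
  by (simp add: alpha1_part_def alpha2_part_def alpha3_part_def alpha4_part_def algebra_simps)

end

context low_coordinates
begin

text \<open>The equations between the components are instances of the axioms at cells that are
  concentrated in one degree.\<close>

context
  assumes lie: "is_lie_3_algebra sc0 sc1 sc2 L"
begin

lemmas lie_parts = lie[unfolded is_lie_3_algebra_def]
lemmas bracket_is_functor = lie_parts[THEN conjunct2, THEN conjunct1]
lemmas jacobiator_is_transformation =
  lie_parts[THEN conjunct2, THEN conjunct2, THEN conjunct2, THEN conjunct2, THEN conjunct2,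
    THEN conjunct1]
lemmas identiator_is_modification =
  lie_parts[THEN conjunct2, THEN conjunct2, THEN conjunct2, THEN conjunct2, THEN conjunct2,
    THEN conjunct2, THEN conjunct2, THEN conjunct1]

interpretation linear_2_category sc0 sc1 sc2 L
  by (rule lie_parts[THEN conjunct1])

lemma boundary_boundary: "d1 (d2 a) = 0"
  using glob_tgt[of "e2 0 a"] by (simp add: target_def del: i1_simps(4))

lemma bracket_targets:
  "tgt1 L (br1 L f g) = br0 L (tgt1 L f) (tgt1 L g)"
  "tgt2 L (br2 L \<alpha> \<beta>) = br1 L (tgt2 L \<alpha>) (tgt2 L \<beta>)"
  using bracket_is_functor unfolding multilinear_2_functor_def all_length_two by simp_all

lemma d1_equivariant: "d1 (x \<rhd> f) = \<lbrakk>x, d1 f\<rbrakk>"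
  using bracket_targets(1)[of "i1 (x, 0)" "i1 (0, f)"]
  by (simp add: cell_bracket_def target_def)

lemma d2_equivariant: "d2 (x \<unrhd> a) = x \<rhd> d2 a"
  using bracket_targets(2)[of "e2 (x, 0) 0" "e2 0 a"]
  by (simp add: cell_bracket_def)

lemma peiffer: "d1 f \<rhd> g = - (d1 g \<rhd> f)"
proof -
  have "br1 L (i1 (0, f)) (i1 (0, g)) = - br1 L (i1 (0, g)) (i1 (0, f))"
    using lie unfolding is_lie_3_algebra_def by blast
  then show ?thesis by (simp add: cell_bracket_def)
qed

text \<open>The bracket of \<open>f\<close> in \<open>V\<^sub>1\<close> with \<open>a\<close> in \<open>V\<^sub>2\<close> vanishes in coordinates, and by functoriality
  it is also \<open>[f \<circ>\<^sub>0 1\<^bsub>tf\<^esub>, 1\<^sub>0 \<circ>\<^sub>0 a] = [1\<^bsub>tf\<^esub>, a]\<close>.\<close>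

lemma boundary_acts_trivially: "d1 f \<unrhd> a = 0"
proof -
  have "br2 L (comp20 L (e2 (0, f) 0) (e2 (d1 f, 0) 0)) (comp20 L (e2 0 0) (e2 0 a))
    = comp20 L (br2 L (e2 (0, f) 0) (e2 0 0)) (br2 L (e2 (d1 f, 0) 0) (e2 0 a))"
    using bracket_is_functor able_cell(2)[of "(0, f)" 0 "(d1 f, 0)" 0] able_cell(2)[of 0 0 0 a]
    unfolding multilinear_2_functor_def all_list_all2_two
    by (simp add: target_def)
  then show ?thesis
    by (simp add: comp20_cell target_def cell_bracket_def del: e2_simps(4))
qed

lemma jacobi_boundary: "d1 (j x y z) = \<lbrakk>\<lbrakk>x,z\<rbrakk>,y\<rbrakk> + \<lbrakk>x,\<lbrakk>y,z\<rbrakk>\<rbrakk> - \<lbrakk>\<lbrakk>x,y\<rbrakk>,z\<rbrakk>"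
proof -
  have "\<forall>xs. length xs = 3 \<longrightarrow> tgt1 L (jac L (xs ! 0) (xs ! 1) (xs ! 2)) = jac_cod (br0 L) xs"
    using jacobiator_is_transformation unfolding multilinear_2_transformation_def by simp
  from this[rule_format, of "[i0 x, i0 y, i0 z]"]
  have "tgt1 L (jac L (i0 x) (i0 y) (i0 z)) = jac_cod (br0 L) [i0 x, i0 y, i0 z]"
    by (simp add: numeral_2_eq_2)
  then show ?thesis
    by (simp add: jac_cod_def target_def numeral_2_eq_2 algebra_simps eq_diff_eq)
qed

lemma jacobiator_naturality:
  "comp20 L (br2 L (br2 L \<alpha> \<beta>) \<gamma>)
     (one1 L (jac L (tgt1 L (tgt2 L \<alpha>)) (tgt1 L (tgt2 L \<beta>)) (tgt1 L (tgt2 L \<gamma>))))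
   = comp20 L (one1 L (jac L (src1 L (src2 L \<alpha>)) (src1 L (src2 L \<beta>)) (src1 L (src2 L \<gamma>))))
       (br2 L (br2 L \<alpha> \<gamma>) \<beta> + br2 L \<alpha> (br2 L \<beta> \<gamma>))"
  using jacobiator_is_transformation unfolding multilinear_2_transformation_def all_length_three
  by (simp add: jac_dom_def jac_cod_def numeral_2_eq_2)

lemma act1_of_bracket: "\<lbrakk>x,y\<rbrakk> \<rhd> f = x \<rhd> y \<rhd> f - y \<rhd> x \<rhd> f - j x y (d1 f)"
  using jacobiator_naturality[of "e2 (x, 0) 0" "e2 (y, 0) 0" "e2 (0, f) 0"]
  by (simp add: comp20_cell target_def cell_bracket_def d1_equivariant algebra_simps
      del: i0_simps(4) i1_simps(4))

lemma act2_of_bracket: "\<lbrakk>x,y\<rbrakk> \<unrhd> a = x \<unrhd> y \<unrhd> a - y \<unrhd> x \<unrhd> a"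
  using jacobiator_naturality[of "e2 (x, 0) 0" "e2 (y, 0) 0" "e2 0 a"]
  by (simp add: comp20_cell target_def cell_bracket_def boundary_boundary algebra_simps
      del: i0_simps(4) i1_simps(4))

lemma idt_boundary_cells:
  "src2 L (idt L (i0 x) (i0 y) (i0 z) (i0 u)) = i1 (\<lbrakk>\<lbrakk>\<lbrakk>x,y\<rbrakk>,z\<rbrakk>,u\<rbrakk>, ident_src x y z u)"
  "tgt2 L (idt L (i0 x) (i0 y) (i0 z) (i0 u)) = i1 (\<lbrakk>\<lbrakk>\<lbrakk>x,y\<rbrakk>,z\<rbrakk>,u\<rbrakk>, ident_tgt x y z u)"
  using identiator_is_modification ident_src_cell[OF d1_equivariant jacobi_boundary, of x y z u]
    ident_tgt_cell[OF d1_equivariant jacobi_boundary, of x y z u]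
  unfolding multilinear_2_modification_def all_length_four
  by (simp_all add: numeral_2_eq_2 numeral_3_eq_3)

lemma identiator_naturality:
  "comp20 L (idt_dom (br2 L) [\<alpha>, \<beta>, \<gamma>, \<delta>])
     (idt L (tgt1 L (tgt2 L \<alpha>)) (tgt1 L (tgt2 L \<beta>)) (tgt1 L (tgt2 L \<gamma>)) (tgt1 L (tgt2 L \<delta>)))
   = comp20 L
     (idt L (src1 L (src2 L \<alpha>)) (src1 L (src2 L \<beta>)) (src1 L (src2 L \<gamma>)) (src1 L (src2 L \<delta>)))
     (idt_cod (br2 L) [\<alpha>, \<beta>, \<gamma>, \<delta>])"
  using identiator_is_modification unfolding multilinear_2_modification_def all_length_four
  by (simp add: numeral_2_eq_2 numeral_3_eq_3)

lemma coordinates_if_part2: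
  assumes "\<And>x y z u. part2 L (idt L (i0 x) (i0 y) (i0 z) (i0 u)) = e2 0 (m x y z u)"
  shows "coordinates s0 s1 s2 D sc0 sc1 sc2 i0 i1 i2 L"
proof unfold_locales
  fix x y z u
  obtain X a where e: "idt L (i0 x) (i0 y) (i0 z) (i0 u) = e2 X a" by (rule cells2)
  then show "idt L (i0 x) (i0 y) (i0 z) (i0 u)
      = e2 (\<lbrakk>\<lbrakk>\<lbrakk>x,y\<rbrakk>,z\<rbrakk>,u\<rbrakk>, ident_src x y z u) (m x y z u)"
    using idt_boundary_cells(1)[of x y z u] assms[of x y z u] by simp
qed

end

lemma identified: "identified_via i0 i1 i2 L"
proof -
  have e: "i2 (x, f, a) = e2 (x, f) a" for x f a by (simp add: e2_def)
  have "range (\<lambda>f. i1 (0, f)) = {f. src1 L f = 0}"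
  proof (intro set_eqI)
    fix F obtain X where "F = i1 X" by (rule cells1)
    then show "F \<in> range (\<lambda>f. i1 (0, f)) \<longleftrightarrow> F \<in> {f. src1 L f = 0}"
      by (cases X) auto
  qed
  moreover have "range (\<lambda>a. i2 (0, 0, a)) = {\<alpha>. src2 L \<alpha> = 0}"
  proof (intro set_eqI)
    fix \<alpha> obtain X a where "\<alpha> = e2 X a" by (rule cells2)
    then show "\<alpha> \<in> range (\<lambda>a. i2 (0, 0, a)) \<longleftrightarrow> \<alpha> \<in> {\<alpha>. src2 L \<alpha> = 0}"
      by (auto simp: e zero_prod_def)
  qed
  ultimately show ?thesis
    unfolding identified_via_def by (simp add: e zero_prod_def)
qed

end

context coordinates
begin

lemma lie_imp_semistrict:
  assumes lie: "is_lie_3_algebra sc0 sc1 sc2 L"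
  shows "semistrict_lie3 s0 s1 s2 D"
proof -
  have d2_ident: "d2 (m x y z u) = ident_tgt x y z u - ident_src x y z u" for x y z u
    using idt_boundary_cells(2)[OF lie, of x y z u]
    by (simp add: idt_cell algebra_simps)
  have ident_d1: "m x y z (d1 f) = 0" for x y z f
    using identiator_naturality[OF lie, of "e2 (x, 0) 0" "e2 (y, 0) 0" "e2 (z, 0) 0" "e2 (0, f) 0"]
    by (simp add: idt_dom_def idt_cod_def Let_def numeral_2_eq_2 numeral_3_eq_3
        comp20_cell cell_bracket_def target_def idt_cell d1_equivariant[OF lie]
        ident_src_def del: i0_simps(4))
  have pre: "lie3_up_to_coherence s0 s1 s2 D"
    by unfold_locales
      (rule boundary_boundary[OF lie] d1_equivariant[OF lie] d2_equivariant[OF lie]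
        peiffer[OF lie] boundary_acts_trivially[OF lie] jacobi_boundary[OF lie]
        act1_of_bracket[OF lie] act2_of_bracket[OF lie] d2_ident ident_d1)+
  have "coherence_law L"
    using lie unfolding is_lie_3_algebra_def by blast
  then show ?thesis
    using coherence[OF pre, unfolded coherence_parts] pre
    by (simp add: semistrict_lie3_def semistrict_lie3_axioms_def)
qed

lemma semistrict_imp_lie:
  assumes "semistrict_lie3 s0 s1 s2 D"
  shows "is_lie_3_algebra sc0 sc1 sc2 L"
proof -
  interpret semistrict_lie3 s0 s1 s2 D by fact
  have pre: "lie3_up_to_coherence s0 s1 s2 D" by unfold_locales
  have "coherence_law L"
    using coherence[OF pre, unfolded coherence_parts] ident_coherence by blast
  then show ?thesis
    unfolding is_lie_3_algebra_def
    using two_category[OF pre] bracket_functor[OF pre] brackets_antisymmetric[OF pre]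
      jacobiator[OF pre] jacobiator_antisymmetric identiator[OF pre] identiator_antisymmetric
    by blast
qed

end

section \<open>Coordinates of a given Lie 3-algebra\<close>

lemma linear_at_zero: "Vector_Spaces.linear s t f \<Longrightarrow> f 0 = 0"
  by (meson Vector_Spaces.linear.axioms(3) module_hom.zero)

context splitting
begin

definition components_of :: "('a, 'b, 'c) lie3 \<Rightarrow> ('u, 'v, 'w) components" where
  "components_of L = \<lparr>
     diff1 = \<lambda>f. inv i0 (tgt1 L (i1 (0, f))),
     diff2 = \<lambda>a. snd (inv i1 (tgt2 L (e2 0 a))),
     act0 = \<lambda>x y. inv i0 (br0 L (i0 x) (i0 y)),
     act1 = \<lambda>x f. snd (inv i1 (br1 L (i1 (x, 0)) (i1 (0, f)))),
     act2 = \<lambda>x a. snd (snd (inv i2 (br2 L (e2 (x, 0) 0) (e2 0 a)))),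
     jacobi = \<lambda>x y z. snd (inv i1 (jac L (i0 x) (i0 y) (i0 z))),
     ident = \<lambda>x y z u. snd (snd (inv i2 (idt L (i0 x) (i0 y) (i0 z) (i0 u)))) \<rparr>"

lemma inv_i0 [simp]: "i0 (inv i0 A) = A" "inv i0 (i0 x) = x"
  using bij_i0 by (simp_all add: bij_is_surj surj_f_inv_f bij_is_inj)

lemma inv_i1 [simp]: "i1 (inv i1 f) = f" "inv i1 (i1 X) = X"
  using bij_i1 by (simp_all add: bij_is_surj surj_f_inv_f bij_is_inj)

lemma inv_e2 [simp]: "inv i2 (e2 X a) = (fst X, snd X, a)"
  using bij_i2 by (simp add: e2_def bij_is_inj)

context
  fixes L :: "('a, 'b, 'c) lie3"
  assumes lie: "is_lie_3_algebra sc0 sc1 sc2 L"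
    and identified: "identified_via i0 i1 i2 L"
begin

lemmas lie_conjuncts = lie[unfolded is_lie_3_algebra_def]

interpretation linear_2_category sc0 sc1 sc2 L
  by (rule lie_conjuncts[THEN conjunct1])

lemmas maps_add =
  lin_src1[THEN Vector_Spaces.linear.axioms(3), THEN module_hom.add]
  lin_tgt1[THEN Vector_Spaces.linear.axioms(3), THEN module_hom.add]
  lin_src2[THEN Vector_Spaces.linear.axioms(3), THEN module_hom.add]
  lin_tgt2[THEN Vector_Spaces.linear.axioms(3), THEN module_hom.add]
  lin_one0[THEN Vector_Spaces.linear.axioms(3), THEN module_hom.add]
  lin_one1[THEN Vector_Spaces.linear.axioms(3), THEN module_hom.add]

lemmas maps_scale =
  lin_tgt1[THEN Vector_Spaces.linear.axioms(3), THEN module_hom.scale]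
  lin_tgt2[THEN Vector_Spaces.linear.axioms(3), THEN module_hom.scale]

lemmas maps_zero [simp] =
  lin_src1[THEN linear_at_zero] lin_tgt1[THEN linear_at_zero] lin_src2[THEN linear_at_zero]
  lin_tgt2[THEN linear_at_zero] lin_one0[THEN linear_at_zero] lin_one1[THEN linear_at_zero]

private abbreviation (input) "K \<equiv> components_of L"

lemma src1_vertical: "src1 L (i1 (0, f)) = 0"
  using identified unfolding identified_via_def by blast

lemma src2_vertical: "src2 L (e2 0 a) = 0"
proof -
  have "e2 0 a \<in> range (\<lambda>a. i2 (0, 0, a))" by (simp add: e2_def)
  then show ?thesis using identified unfolding identified_via_def by blast
qed

lemma one0_coord: "one0 L (i0 x) = i1 (x, 0)"
proof -
  have "i1 (x, 0) = one0 L (i0 x) + i1 (0, 0)"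
    using identified unfolding identified_via_def by blast
  then show ?thesis by (simp flip: zero_prod_def)
qed

lemma one1_coord: "one1 L (i1 X) = e2 X 0"
proof -
  have e: "i2 (0, 0, 0) = 0" using e2_simps(4) by (simp add: e2_def)
  have "i2 (fst X, snd X, 0)
    = one1 L (one0 L (i0 (fst X))) + one1 L (i1 (0, snd X)) + i2 (0, 0, 0)"
    using identified unfolding identified_via_def by blast
  also have "\<dots> = one1 L (i1 (fst X, 0) + i1 (0, snd X))"
    by (simp add: one0_coord maps_add e del: i1_simps)
  finally show ?thesis by (simp add: e2_def)
qed

lemma split_cell1: "i1 X = one0 L (i0 (fst X)) + i1 (0, snd X)"
  by (simp add: one0_coord)

lemma split_cell2: "e2 X a = one1 L (i1 X) + e2 0 a"
  by (simp add: one1_coord)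

lemma src1_coord: "src1 L (i1 X) = i0 (fst X)"
  by (subst split_cell1) (simp only: maps_add src1_vertical src_one0 add_0_right)

lemma src2_coord: "src2 L (e2 X a) = i1 X"
  by (subst split_cell2) (simp only: maps_add src2_vertical src_one1 add_0_right)

lemma tgt1_vertical: "tgt1 L (i1 (0, f)) = i0 (diff1 K f)"
  by (simp add: components_of_def)

lemma tgt2_vertical: "tgt2 L (e2 0 a) = i1 (0, diff2 K a)"
proof -
  obtain X where X: "tgt2 L (e2 0 a) = i1 X" by (rule cells1)
  have "src1 L (tgt2 L (e2 0 a)) = 0"
    using glob_src[of "e2 0 a"] by (simp add: src2_vertical)
  then have "fst X = 0" by (simp add: X src1_coord)
  then show ?thesis by (cases X) (simp add: components_of_def X)
qed

lemmas bracket_laws = lie_conjuncts[THEN conjunct2, THEN conjunct1, unfolded multilinear_2_functor_def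
    multilinear_two all_list_all2_two all_length_two linear_iff, simplified]

lemma bracket_add:
  "br0 L A (B + B') = br0 L A B + br0 L A B'" "br0 L (A + A') B = br0 L A B + br0 L A' B"
  "br1 L f (g + g') = br1 L f g + br1 L f g'" "br1 L (f + f') g = br1 L f g + br1 L f' g"
  "br2 L \<alpha> (\<beta> + \<beta>') = br2 L \<alpha> \<beta> + br2 L \<alpha> \<beta>'" "br2 L (\<alpha> + \<alpha>') \<beta> = br2 L \<alpha> \<beta> + br2 L \<alpha>' \<beta>"
  using bracket_laws by simp_all

lemma bracket_zero [simp]:
  "br0 L A 0 = 0" "br0 L 0 A = 0" "br1 L f 0 = 0" "br1 L 0 f = 0" "br2 L \<alpha> 0 = 0" "br2 L 0 \<alpha> = 0"
  using bracket_add(1)[of A 0 0] bracket_add(2)[of 0 0 A] bracket_add(3)[of f 0 0] bracket_add(4)[of 0 0 f]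
    bracket_add(5)[of \<alpha> 0 0] bracket_add(6)[of 0 0 \<alpha>] by simp_all

lemma bracket_scale:
  "br0 L A (sc0 r B) = sc0 r (br0 L A B)" "br1 L f (sc1 r g) = sc1 r (br1 L f g)"
  "br1 L (sc1 r f) g = sc1 r (br1 L f g)" "br2 L \<alpha> (sc2 r \<beta>) = sc2 r (br2 L \<alpha> \<beta>)"
  "br2 L (sc2 r \<alpha>) \<beta> = sc2 r (br2 L \<alpha> \<beta>)"
  using bracket_laws by simp_all

lemma bracket_faces:
  "src1 L (br1 L f g) = br0 L (src1 L f) (src1 L g)"
  "src2 L (br2 L \<alpha> \<beta>) = br1 L (src2 L \<alpha>) (src2 L \<beta>)"
  "br1 L (one0 L A) (one0 L B) = one0 L (br0 L A B)"
  "br2 L (one1 L f) (one1 L g) = one1 L (br1 L f g)"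
  using bracket_laws by simp_all

lemma bracket_composite:
  "able10 L f f' \<Longrightarrow> able10 L g g' \<Longrightarrow>
    br1 L (comp10 L f f') (comp10 L g g') = comp10 L (br1 L f g) (br1 L f' g')"
  "able20 L \<alpha> \<alpha>' \<Longrightarrow> able20 L \<beta> \<beta>' \<Longrightarrow>
    br2 L (comp20 L \<alpha> \<alpha>') (comp20 L \<beta> \<beta>') = comp20 L (br2 L \<alpha> \<beta>) (br2 L \<alpha>' \<beta>')"
  "able21 L \<alpha> \<alpha>' \<Longrightarrow> able21 L \<beta> \<beta>' \<Longrightarrow>
    br2 L (comp21 L \<alpha> \<alpha>') (comp21 L \<beta> \<beta>') = comp21 L (br2 L \<alpha> \<beta>) (br2 L \<alpha>' \<beta>')"
  using bracket_laws by simp_all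

lemma bracket_antisym:
  "br0 L A B = - br0 L B A" "br1 L f g = - br1 L g f" "br2 L \<alpha> \<beta> = - br2 L \<beta> \<alpha>"
  using lie_conjuncts by blast+

lemma br0_coord: "br0 L (i0 x) (i0 y) = i0 (act0 K x y)"
  by (simp add: components_of_def)

lemma br1_vertical: "br1 L (i1 (x, 0)) (i1 (0, f)) = i1 (0, act1 K x f)"
proof -
  obtain X where X: "br1 L (i1 (x, 0)) (i1 (0, f)) = i1 X" by (rule cells1)
  have "src1 L (br1 L (i1 (x, 0)) (i1 (0, f))) = 0"
    by (simp add: bracket_faces src1_coord)
  then have "fst X = 0" by (simp add: X src1_coord)
  then show ?thesis by (cases X) (simp add: components_of_def X)
qed

lemma br2_vertical: "br2 L (e2 (x, 0) 0) (e2 0 a) = e2 0 (act2 K x a)"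
proof -
  obtain X b where X: "br2 L (e2 (x, 0) 0) (e2 0 a) = e2 X b" by (rule cells2)
  have "src2 L (br2 L (e2 (x, 0) 0) (e2 0 a)) = 0"
    by (simp add: bracket_faces src2_coord)
  then have "X = 0" by (simp add: X src2_coord)
  then show ?thesis by (simp add: components_of_def X)
qed

lemmas jacobiator_faces =
  lie_conjuncts[THEN conjunct2, THEN conjunct2, THEN conjunct2, THEN conjunct2, THEN conjunct2,
    THEN conjunct1, unfolded multilinear_2_transformation_def multilinear_three linear_iff,
    THEN conjunct2, THEN conjunct1, rule_format]
lemmas jacobiator_linear =
  lie_conjuncts[THEN conjunct2, THEN conjunct2, THEN conjunct2, THEN conjunct2, THEN conjunct2,
    THEN conjunct1, unfolded multilinear_2_transformation_def multilinear_three linear_iff,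
    THEN conjunct1]
lemmas jacobiator_antisym =
  lie_conjuncts[THEN conjunct2, THEN conjunct2, THEN conjunct2, THEN conjunct2, THEN conjunct2,
    THEN conjunct2, THEN conjunct1, unfolded antisymmetric_three]
lemmas identiator_linear =
  lie_conjuncts[THEN conjunct2, THEN conjunct2, THEN conjunct2, THEN conjunct2, THEN conjunct2,
    THEN conjunct2, THEN conjunct2, THEN conjunct1, unfolded multilinear_2_modification_def
    multilinear_four linear_iff, THEN conjunct1]
lemmas identiator_antisym =
  lie_conjuncts[THEN conjunct2, THEN conjunct2, THEN conjunct2, THEN conjunct2, THEN conjunct2,
    THEN conjunct2, THEN conjunct2, THEN conjunct2, THEN conjunct1, unfolded antisymmetric_four]

lemma jac_coord: "jac L (i0 x) (i0 y) (i0 z) = i1 (act0 K (act0 K x y) z, jacobi K x y z)"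
proof -
  obtain X where X: "jac L (i0 x) (i0 y) (i0 z) = i1 X" by (rule cells1)
  have "src1 L (jac L (i0 x) (i0 y) (i0 z)) = br0 L (br0 L (i0 x) (i0 y)) (i0 z)"
    using jacobiator_faces[of "[i0 x, i0 y, i0 z]"] by (simp add: jac_dom_def numeral_2_eq_2)
  then have "fst X = act0 K (act0 K x y) z" by (simp add: X src1_coord br0_coord)
  then show ?thesis by (cases X) (simp add: components_of_def X)
qed

lemma part1_coord: "part1 L (i1 X) = i1 (0, snd X)"
  by (cases X) (simp add: part1_def src1_coord one0_coord)

lemma part2_coord: "part2 L (e2 X a) = e2 0 a"
  by (simp add: part2_def src2_coord one1_coord)

lemma part2_idt_coord: "part2 L (idt L (i0 x) (i0 y) (i0 z) (i0 u)) = e2 0 (ident K x y z u)"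
proof -
  obtain X a where X: "idt L (i0 x) (i0 y) (i0 z) (i0 u) = e2 X a" by (rule cells2)
  then show ?thesis by (simp add: components_of_def part2_coord)
qed

lemma part1_jac_coord: "part1 L (jac L (i0 x) (i0 y) (i0 z)) = i1 (0, jacobi K x y z)"
  by (simp add: jac_coord part1_coord)

lemma component_maps_of: "component_maps s0 s1 s2 K"
proof -
  interpret V0: vector_space s0 by (rule vector_spaces)
  interpret V1: vector_space s1 by (rule vector_spaces)
  interpret V2: vector_space s2 by (rule vector_spaces)
  have sp: "scale_prod s0 s1 r (x, f) = (s0 r x, s1 r f)" "scale_prod s0 s1 r 0 = 0" for r x f
    by (simp_all add: scale_prod_def prod_eq_iff)
  show ?thesis
  proof (intro component_maps.intro component_maps_axioms.intro vector_spaces)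
    show "Vector_Spaces.linear s1 s0 (diff1 K)"
      unfolding linear_iff
    proof (intro conjI allI vector_spaces)
      show "diff1 K (f + g) = diff1 K f + diff1 K g" for f g
        using maps_add(2)[of "i1 (0, f)" "i1 (0, g)"] by (simp add: tgt1_vertical)
      show "diff1 K (s1 r f) = s0 r (diff1 K f)" for r f
        using maps_scale(1)[of r "i1 (0, f)"] by (simp add: tgt1_vertical sp)
    qed
    show "Vector_Spaces.linear s2 s1 (diff2 K)"
      unfolding linear_iff
    proof (intro conjI allI vector_spaces)
      show "diff2 K (a + b) = diff2 K a + diff2 K b" for a b
        using maps_add(4)[of "e2 0 a" "e2 0 b"] by (simp add: tgt2_vertical)
      show "diff2 K (s2 r a) = s1 r (diff2 K a)" for r a
        using maps_scale(2)[of r "e2 0 a"] by (simp add: tgt2_vertical sp)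
    qed
    show "Vector_Spaces.linear s0 s0 (act0 K x)" for x
      unfolding linear_iff
    proof (intro conjI allI vector_spaces)
      show "act0 K x (y + z) = act0 K x y + act0 K x z" for y z
        using bracket_add(1)[of "i0 x" "i0 y" "i0 z"] by (simp add: br0_coord)
      show "act0 K x (s0 r y) = s0 r (act0 K x y)" for r y
        using bracket_scale(1)[of "i0 x" r "i0 y"] by (simp add: br0_coord)
    qed
    show "Vector_Spaces.linear s1 s1 (act1 K x)" for x
      unfolding linear_iff
    proof (intro conjI allI vector_spaces)
      show "act1 K x (f + g) = act1 K x f + act1 K x g" for f g
        using bracket_add(3)[of "i1 (x, 0)" "i1 (0, f)" "i1 (0, g)"] by (simp add: br1_vertical)
      show "act1 K x (s1 r f) = s1 r (act1 K x f)" for r f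
        using bracket_scale(2)[of "i1 (x, 0)" r "i1 (0, f)"]
        by (simp add: br1_vertical sp)
    qed
    show "Vector_Spaces.linear s0 s1 (\<lambda>x. act1 K x f)" for f
      unfolding linear_iff
    proof (intro conjI allI vector_spaces)
      show "act1 K (x + y) f = act1 K x f + act1 K y f" for x y
        using bracket_add(4)[of "i1 (x, 0)" "i1 (y, 0)" "i1 (0, f)"] by (simp add: br1_vertical)
      show "act1 K (s0 r x) f = s1 r (act1 K x f)" for r x
        using bracket_scale(3)[of r "i1 (x, 0)" "i1 (0, f)"]
        by (simp add: br1_vertical sp)
    qed
    show "Vector_Spaces.linear s2 s2 (act2 K x)" for x
      unfolding linear_iff
    proof (intro conjI allI vector_spaces)
      show "act2 K x (a + b) = act2 K x a + act2 K x b" for a b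
        using bracket_add(5)[of "e2 (x, 0) 0" "e2 0 a" "e2 0 b"] by (simp add: br2_vertical)
      show "act2 K x (s2 r a) = s2 r (act2 K x a)" for r a
        using bracket_scale(4)[of "e2 (x, 0) 0" r "e2 0 a"]
        by (simp add: br2_vertical sp)
    qed
    show "Vector_Spaces.linear s0 s2 (\<lambda>x. act2 K x a)" for a
      unfolding linear_iff
    proof (intro conjI allI vector_spaces)
      show "act2 K (x + y) a = act2 K x a + act2 K y a" for x y
        using bracket_add(6)[of "e2 (x, 0) 0" "e2 (y, 0) 0" "e2 0 a"] by (simp add: br2_vertical)
      show "act2 K (s0 r x) a = s2 r (act2 K x a)" for r x
        using bracket_scale(5)[of r "e2 (x, 0) 0" "e2 0 a"]
        by (simp add: br2_vertical sp)
    qed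
    show "Vector_Spaces.linear s0 s1 (jacobi K x y)" for x y
      unfolding linear_iff
    proof (intro conjI allI vector_spaces)
      have j: "jac L A B (C + C') = jac L A B C + jac L A B C'"
        "jac L A B (sc0 r C) = sc1 r (jac L A B C)" for A B C C' r
        using jacobiator_linear by (simp_all add: numeral_2_eq_2)
      show "jacobi K x y (z + z') = jacobi K x y z + jacobi K x y z'" for z z'
        using j(1)[of "i0 x" "i0 y" "i0 z" "i0 z'"] by (simp add: jac_coord)
      show "jacobi K x y (s0 r z) = s1 r (jacobi K x y z)" for r z
        using j(2)[of "i0 x" "i0 y" r "i0 z"] by (simp add: jac_coord sp)
    qed
    show "Vector_Spaces.linear s0 s2 (ident K x y z)" for x y z
      unfolding linear_iff
    proof (intro conjI allI vector_spaces)
      have m: "idt L A B C (E + E') = idt L A B C E + idt L A B C E'"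
        "idt L A B C (sc0 r E) = sc2 r (idt L A B C E)" for A B C E E' r
        using identiator_linear by (simp_all add: numeral_2_eq_2 numeral_3_eq_3)
      have p: "part2 L (\<alpha> + \<beta>) = part2 L \<alpha> + part2 L \<beta>" "part2 L (sc2 r \<alpha>) = sc2 r (part2 L \<alpha>)"
        for \<alpha> \<beta> r
      proof -
        obtain X a Y b where [simp]: "\<alpha> = e2 X a" "\<beta> = e2 Y b" by (metis cells2)
        show "part2 L (\<alpha> + \<beta>) = part2 L \<alpha> + part2 L \<beta>" "part2 L (sc2 r \<alpha>) = sc2 r (part2 L \<alpha>)"
          by (simp_all add: part2_coord sp)
      qed
      show "ident K x y z (u + u') = ident K x y z u + ident K x y z u'" for u u'
        using p(1)[of "idt L (i0 x) (i0 y) (i0 z) (i0 u)" "idt L (i0 x) (i0 y) (i0 z) (i0 u')"]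
          m(1)[of "i0 x" "i0 y" "i0 z" "i0 u" "i0 u'", symmetric]
        by (simp add: part2_idt_coord)
      show "ident K x y z (s0 r u) = s2 r (ident K x y z u)" for r u
        using p(2)[of r "idt L (i0 x) (i0 y) (i0 z) (i0 u)"]
          m(2)[of "i0 x" "i0 y" "i0 z" r "i0 u", symmetric]
        by (simp add: part2_idt_coord)
    qed
    show "act0 K y x = - act0 K x y" for x y
      using bracket_antisym(1)[of "i0 y" "i0 x"] by (simp add: br0_coord)
    show "jacobi K y x z = - jacobi K x y z" "jacobi K x z y = - jacobi K x y z" for x y z
      using jacobiator_antisym[rule_format, of "i0 y" "i0 x" "i0 z"]
        jacobiator_antisym[rule_format, of "i0 x" "i0 y" "i0 z"]
      by (simp_all add: numeral_2_eq_2 part1_jac_coord)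
    show "ident K y x z u = - ident K x y z u" "ident K x z y u = - ident K x y z u"
      "ident K x y u z = - ident K x y z u" for x y z u
      using identiator_antisym[rule_format, of "i0 y" "i0 x" "i0 z" "i0 u"]
        identiator_antisym[rule_format, of "i0 x" "i0 y" "i0 z" "i0 u"]
      by (simp_all add: numeral_2_eq_2 numeral_3_eq_3 part2_idt_coord)
  qed
qed

interpretation K: component_maps s0 s1 s2 K
  by (rule component_maps_of)

lemma tgt1_coord: "tgt1 L (i1 X) = i0 (K.target X)"
  by (subst split_cell1) (simp only: maps_add tgt_one0 tgt1_vertical K.target_def i0_simps)

lemma tgt2_coord: "tgt2 L (e2 X a) = i1 (fst X, snd X + diff2 K a)"
  by (subst split_cell2)
    (simp only: maps_add tgt_one1 tgt2_vertical i1_simps, simp add: prod_eq_iff)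

lemma d1_d2_of: "diff1 K (diff2 K a) = 0"
  using glob_tgt[of "e2 0 a"]
  by (simp add: src2_coord tgt2_coord tgt1_coord K.target_def del: i1_simps(4))

text \<open>A composable pair is the sum of a pair \<open>(a, 1)\<close> and a pair \<open>(0, b)\<close> in which \<open>b\<close> starts at
  zero. Linearity and the two unit laws give its composite.\<close>

lemma compositions_coord:
  "comp10 L (i1 X) (i1 Y) = (if fst Y = K.target X then i1 (fst X, snd X + snd Y) else 0)"
  "comp20 L (e2 X a) (e2 Y b)
    = (if fst Y = K.target X then e2 (fst X, snd X + snd Y) (a + b) else 0)"
  "comp21 L (e2 X a) (e2 Y b)
    = (if Y = (fst X, snd X + diff2 K a) then e2 X (a + b) else 0)"
proof -
  have able: "able10 L (i1 X) (i1 Y) \<longleftrightarrow> fst Y = K.target X"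
    "able20 L (e2 X a) (e2 Y b) \<longleftrightarrow> fst Y = K.target X"
    "able21 L (e2 X a) (e2 Y b) \<longleftrightarrow> Y = (fst X, snd X + diff2 K a)" for X Y a b
    by (auto simp: able10_def able20_def able21_def src1_coord src2_coord tgt1_coord tgt2_coord
        K.target_def d1_d2_of)
  note lin = lin_comp10[unfolded linear_composition_def] lin_comp20[unfolded linear_composition_def]
    lin_comp21[unfolded linear_composition_def]
  note units = unit10_left[of "i1 (0, g)" for g] unit10_right[of "i1 X" for X]
    unit20_left[of "e2 (0, g) b" for g b] unit20_right[of "e2 X a" for X a]
    unit21_left[of "e2 0 b" for b] unit21_right[of "e2 X a" for X a]
  note units = units[unfolded src2_coord tgt2_coord src1_coord tgt1_coord one0_coord one1_coord]
  show "comp10 L (i1 X) (i1 Y) = (if fst Y = K.target X then i1 (fst X, snd X + snd Y) else 0)"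
  proof (cases "fst Y = K.target X")
    case True
    then obtain g where Y: "Y = (K.target X, g)" by (cases Y) simp
    have "comp10 L (i1 X + i1 0) (i1 (K.target X, 0) + i1 (0, g))
      = comp10 L (i1 X) (i1 (K.target X, 0)) + comp10 L (i1 0) (i1 (0, g))"
      using lin(1) by (simp add: able K.target_def del: i1_simps)
    then show ?thesis
      unfolding Y using units(1,2) by (simp add: prod_eq_iff flip: zero_prod_def)
  qed (use lin(1) able in simp)
  show "comp20 L (e2 X a) (e2 Y b)
    = (if fst Y = K.target X then e2 (fst X, snd X + snd Y) (a + b) else 0)"
  proof (cases "fst Y = K.target X")
    case True
    then obtain g where Y: "Y = (K.target X, g)" by (cases Y) simp
    have "comp20 L (e2 X a + e2 0 0) (e2 (K.target X, 0) 0 + e2 (0, g) b)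
      = comp20 L (e2 X a) (e2 (K.target X, 0) 0) + comp20 L (e2 0 0) (e2 (0, g) b)"
      using lin(2) by (simp add: able K.target_def del: e2_simps)
    then show ?thesis
      unfolding Y using units(3,4) by (simp add: prod_eq_iff K.target_def d1_d2_of flip: zero_prod_def)
  qed (use lin(2) able in simp)
  show "comp21 L (e2 X a) (e2 Y b)
    = (if Y = (fst X, snd X + diff2 K a) then e2 X (a + b) else 0)"
  proof (cases "Y = (fst X, snd X + diff2 K a)")
    case True
    have "comp21 L (e2 X a + e2 0 0) (e2 Y 0 + e2 0 b)
      = comp21 L (e2 X a) (e2 Y 0) + comp21 L (e2 0 0) (e2 0 b)"
      using lin(3) by (simp add: able True zero_prod_def del: e2_simps)
    then show ?thesis
      using True units(5,6) by (simp flip: zero_prod_def)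
  qed (use lin(3) able in simp)
qed

lemma br1_coord: "br1 L (i1 X) (i1 Y) = i1 (K.cell_bracket X Y)"
proof -
  obtain x f y g where [simp]: "X = (x, f)" "Y = (y, g)" by (metis surj_pair)
  have able: "able10 L (i1 (0, f)) (i1 (diff1 K f, 0))" "able10 L 0 (i1 (0, g))"
    by (simp_all add: able10_def tgt1_vertical src1_coord)
  have vertical: "br1 L (i1 (0, f)) (i1 (0, g)) = i1 (0, act1 K (diff1 K f) g)"
    using bracket_composite(1)[OF able] unit10_right[of "i1 (0, f)"] unit10_left[of "i1 (0, g)"]
      unit10_left[of "i1 (0, act1 K (diff1 K f) g)"]
    by (simp add: one0_coord tgt1_vertical src1_vertical br1_vertical)
  have "br1 L (i1 (x, 0) + i1 (0, f)) (i1 (y, 0) + i1 (0, g))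
    = br1 L (i1 (x, 0)) (i1 (y, 0)) + br1 L (i1 (x, 0)) (i1 (0, g))
      + br1 L (i1 (0, f)) (i1 (y, 0)) + br1 L (i1 (0, f)) (i1 (0, g))"
    by (simp only: bracket_add ac_simps)
  also have "\<dots> = i1 (K.cell_bracket X Y)"
    using bracket_faces(3)[of "i0 x" "i0 y"] bracket_antisym(2)[of "i1 (0, f)" "i1 (y, 0)"]
    by (simp add: vertical br1_vertical one0_coord br0_coord K.cell_bracket_def)
  finally show ?thesis by simp
qed

text \<open>Functoriality along 0-cells shows that \<open>V\<^sub>1\<close> and \<open>V\<^sub>2\<close> have zero bracket:
  \<open>[1\<^sub>0 \<circ>\<^sub>0 f, b \<circ>\<^sub>0 1\<^sub>0] = [1\<^sub>0, b] \<circ>\<^sub>0 [f, 1\<^sub>0] = 0\<close>. Functoriality along 1-cells shows the same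
  for \<open>V\<^sub>2\<close> and itself: \<open>[1\<^sub>0 \<circ>\<^sub>1 a, b \<circ>\<^sub>1 1\<^bsub>tb\<^esub>] = [1\<^sub>0, b] \<circ>\<^sub>1 [a, 1\<^bsub>tb\<^esub>] = 0\<close>.\<close>

lemma br2_coord: "br2 L (e2 X a) (e2 Y b)
  = e2 (K.cell_bracket X Y) (act2 K (fst X) b - act2 K (fst Y) a)"
proof -
  have vertical: "br2 L (e2 (0, f) 0) (e2 0 b) = 0" for f b
  proof -
    have able: "able20 L 0 (e2 (0, f) 0)" "able20 L (e2 0 b) 0"
      by (simp_all add: able20_def src1_coord src2_coord tgt1_coord tgt2_vertical K.target_def
          d1_d2_of del: i1_simps(4))
    show ?thesis
      using bracket_composite(2)[OF able] unit20_left[of "e2 (0, f) 0"] unit20_right[of "e2 0 b"]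
        unit20_right[of 0]
      by (simp add: src2_coord src1_vertical tgt2_vertical tgt1_vertical d1_d2_of)
  qed
  have one: "br2 L (e2 X 0) (e2 0 b) = e2 0 (act2 K (fst X) b)" for X b
  proof -
    have "br2 L (e2 (fst X, 0) 0 + e2 (0, snd X) 0) (e2 0 b) = e2 0 (act2 K (fst X) b)"
      by (simp only: bracket_add br2_vertical vertical add_0_right)
    then show ?thesis by simp
  qed
  have two: "br2 L (e2 0 a) (e2 0 b) = 0"
  proof -
    have able: "able21 L 0 (e2 0 a)" "able21 L (e2 0 b) (e2 (0, diff2 K b) 0)"
      by (simp_all add: able21_def src2_coord tgt2_vertical)
    show ?thesis
      using bracket_composite(3)[OF able] unit21_left[of "e2 0 a"] unit21_right[of "e2 0 b"]
        unit21_right[of 0] vertical[of "diff2 K b" a] bracket_antisym(3)[of "e2 0 a" "e2 (0, diff2 K b) 0"]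
        bracket_antisym(3)[of "e2 0 b" "e2 0 a"]
      by (simp add: src2_coord tgt2_vertical one1_coord)
  qed
  have "br2 L (e2 X 0 + e2 0 a) (e2 Y 0 + e2 0 b)
    = br2 L (e2 X 0) (e2 Y 0) + br2 L (e2 X 0) (e2 0 b)
      + br2 L (e2 0 a) (e2 Y 0) + br2 L (e2 0 a) (e2 0 b)"
    by (simp only: bracket_add ac_simps)
  also have "\<dots> = e2 (K.cell_bracket X Y) (act2 K (fst X) b - act2 K (fst Y) a)"
    using bracket_faces(4)[of "i1 X" "i1 Y"] bracket_antisym(3)[of "e2 0 a" "e2 Y 0"]
    by (simp add: one two one1_coord br1_coord)
  finally show ?thesis by simp
qed

lemma low_coordinates_of: "low_coordinates s0 s1 s2 K sc0 sc1 sc2 i0 i1 i2 L"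
  by unfold_locales
    (simp_all add: src1_coord tgt1_coord src2_coord tgt2_coord one0_coord one1_coord
      compositions_coord br0_coord br1_coord br2_coord jac_coord)

theorem coordinates_of: "coordinates s0 s1 s2 K sc0 sc1 sc2 i0 i1 i2 L"
  by (rule low_coordinates.coordinates_if_part2[OF low_coordinates_of lie part2_idt_coord])

end

end

section \<open>Lie 3-algebras and their components\<close>

context splitting
begin

definition lie_of :: "('u, 'v, 'w) components \<Rightarrow> ('a, 'b, 'c) lie3" where
  "lie_of D = (let
     tgt = component_maps.target D; brk = component_maps.cell_bracket D;
     p0 = inv i0; p1 = inv i1; p2 = (\<lambda>\<alpha>. (fst (inv i2 \<alpha>), fst (snd (inv i2 \<alpha>))));
     q2 = (\<lambda>\<alpha>. snd (snd (inv i2 \<alpha>)))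
   in \<lparr>
     src1 = \<lambda>f. i0 (fst (p1 f)),
     tgt1 = \<lambda>f. i0 (tgt (p1 f)),
     src2 = \<lambda>\<alpha>. i1 (p2 \<alpha>),
     tgt2 = \<lambda>\<alpha>. i1 (fst (p2 \<alpha>), snd (p2 \<alpha>) + diff2 D (q2 \<alpha>)),
     one0 = \<lambda>A. i1 (p0 A, 0),
     one1 = \<lambda>f. e2 (p1 f) 0,
     comp10 = \<lambda>f g. if fst (p1 g) = tgt (p1 f) then i1 (fst (p1 f), snd (p1 f) + snd (p1 g)) else 0,
     comp20 = \<lambda>\<alpha> \<beta>. if fst (p2 \<beta>) = tgt (p2 \<alpha>)
       then e2 (fst (p2 \<alpha>), snd (p2 \<alpha>) + snd (p2 \<beta>)) (q2 \<alpha> + q2 \<beta>) else 0,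
     comp21 = \<lambda>\<alpha> \<beta>. if p2 \<beta> = (fst (p2 \<alpha>), snd (p2 \<alpha>) + diff2 D (q2 \<alpha>))
       then e2 (p2 \<alpha>) (q2 \<alpha> + q2 \<beta>) else 0,
     br0 = \<lambda>A B. i0 (act0 D (p0 A) (p0 B)),
     br1 = \<lambda>f g. i1 (brk (p1 f) (p1 g)),
     br2 = \<lambda>\<alpha> \<beta>. e2 (brk (p2 \<alpha>) (p2 \<beta>))
       (act2 D (fst (p2 \<alpha>)) (q2 \<beta>) - act2 D (fst (p2 \<beta>)) (q2 \<alpha>)),
     jac = \<lambda>A B C. i1 (act0 D (act0 D (p0 A) (p0 B)) (p0 C), jacobi D (p0 A) (p0 B) (p0 C)),
     idt = \<lambda>A B C E. e2
       (act0 D (act0 D (act0 D (p0 A) (p0 B)) (p0 C)) (p0 E),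
        component_maps.ident_src D (p0 A) (p0 B) (p0 C) (p0 E))
       (ident D (p0 A) (p0 B) (p0 C) (p0 E)) \<rparr>)"

lemma coordinates_lie_of:
  assumes "component_maps s0 s1 s2 D"
  shows "coordinates s0 s1 s2 D sc0 sc1 sc2 i0 i1 i2 (lie_of D)"
proof -
  interpret component_maps s0 s1 s2 D by fact
  show ?thesis
    by (intro coordinates.intro low_coordinates.intro coordinates_axioms.intro
        low_coordinates_axioms.intro assms splitting_axioms)
      (simp_all add: lie_of_def Let_def prod_eq_iff)
qed

lemma coordinates_unique:
  assumes "coordinates s0 s1 s2 D sc0 sc1 sc2 i0 i1 i2 L"
    and "coordinates s0 s1 s2 D sc0 sc1 sc2 i0 i1 i2 L'"
  shows "L = L'"
proof -
  interpret L: coordinates s0 s1 s2 D sc0 sc1 sc2 i0 i1 i2 L by fact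
  interpret L': coordinates s0 s1 s2 D sc0 sc1 sc2 i0 i1 i2 L' by fact
  show ?thesis
    by (rule lie3.equality; (intro ext)?; (simp only: all_cells)?;
        simp add: L.comp10_cell L'.comp10_cell L.comp20_cell L'.comp20_cell
          L.comp21_cell L'.comp21_cell L.idt_cell L'.idt_cell)
qed

lemma components_of_coordinates:
  assumes "coordinates s0 s1 s2 D sc0 sc1 sc2 i0 i1 i2 L"
  shows "components_of L = D"
proof -
  interpret coordinates s0 s1 s2 D sc0 sc1 sc2 i0 i1 i2 L by fact
  show ?thesis
    by (rule components.equality)
      (simp_all add: components_of_def cell_bracket_def target_def idt_cell)
qed

theorem components_of_bij:
  "bij_betw components_of
     {L. is_lie_3_algebra sc0 sc1 sc2 L \<and> identified_via i0 i1 i2 L}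
     {D. semistrict_lie3 s0 s1 s2 D}"
proof (rule bij_betw_byWitness[where f' = lie_of])
  show "\<forall>L\<in>{L. is_lie_3_algebra sc0 sc1 sc2 L \<and> identified_via i0 i1 i2 L}.
      lie_of (components_of L) = L"
  proof clarify
    fix L assume "is_lie_3_algebra sc0 sc1 sc2 L" "identified_via i0 i1 i2 L"
    \<comment> \<open>Both structures have the same coordinates.\<close>
    then show "lie_of (components_of L) = L"
      by (intro coordinates_unique[OF coordinates_lie_of[OF component_maps_of] coordinates_of])
  qed
  show "\<forall>D\<in>{D. semistrict_lie3 s0 s1 s2 D}. components_of (lie_of D) = D"
    using components_of_coordinates coordinates_lie_of
    by (auto simp: semistrict_lie3_def lie3_up_to_coherence_def)
  show "components_of ` {L. is_lie_3_algebra sc0 sc1 sc2 L \<and> identified_via i0 i1 i2 L}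
      \<subseteq> {D. semistrict_lie3 s0 s1 s2 D}"
    using coordinates.lie_imp_semistrict coordinates_of by blast
  show "lie_of ` {D. semistrict_lie3 s0 s1 s2 D}
      \<subseteq> {L. is_lie_3_algebra sc0 sc1 sc2 L \<and> identified_via i0 i1 i2 L}"
  proof clarify
    fix D assume D: "semistrict_lie3 s0 s1 s2 D"
    then interpret coordinates s0 s1 s2 D sc0 sc1 sc2 i0 i1 i2 "lie_of D"
      by (intro coordinates_lie_of) (simp add: semistrict_lie3_def lie3_up_to_coherence_def)
    show "is_lie_3_algebra sc0 sc1 sc2 (lie_of D) \<and> identified_via i0 i1 i2 (lie_of D)"
      using semistrict_imp_lie[OF D] identified by blast
  qed
qed

end

section \<open>Signs of permutations and shuffles\<close>

fun inversions :: "nat list \<Rightarrow> nat" where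
  "inversions [] = 0"
| "inversions (x # xs) = length (filter (\<lambda>y. y < x) xs) + inversions xs"

lemma inversions_swap:
  "b < a \<Longrightarrow> inversions (xs @ a # b # ys) = Suc (inversions (xs @ b # a # ys))"
  by (induction xs) auto

lemma inversions_sorted: "sorted xs \<Longrightarrow> inversions xs = 0"
  by (induction xs) (auto simp: filter_empty_conv)

text \<open>Swapping two adjacent values that are out of order changes the sign and removes one
  inversion.\<close>

lemma sign_eq_inversions:
  assumes "\<sigma> permutes {..<n}"
  shows "sign \<sigma> = (-1) ^ inversions (map \<sigma> [0..<n])"
  using assms
proof (induction "inversions (map \<sigma> [0..<n])" arbitrary: \<sigma> rule: less_induct)
  case less
  show ?case
  proof (cases "sorted (map \<sigma> [0..<n])")
    case True
    have "distinct (map \<sigma> [0..<n])"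
      using permutes_inj_on[OF less.prems] by (simp add: distinct_map)
    moreover have "set (map \<sigma> [0..<n]) = set [0..<n]"
      using permutes_image[OF less.prems] by (simp add: atLeast0LessThan)
    ultimately have "map \<sigma> [0..<n] = [0..<n]"
      using True by (intro sorted_distinct_set_unique) auto
    then have "\<sigma> k = k" if "k < n" for k
      using that by (metis nth_map length_upt diff_zero nth_upt add_0)
    then have "\<sigma> = id"
      using permutes_not_in[OF less.prems] by (metis eq_id_iff lessThan_iff)
    then show ?thesis by (simp add: inversions_sorted)
  next
    case False
    then obtain i where i: "Suc i < n" "\<sigma> (Suc i) < \<sigma> i"
      by (auto simp: sorted_iff_nth_Suc)
    define \<tau> where "\<tau> = \<sigma> \<circ> transpose i (Suc i)"
    have \<tau>: "\<tau> permutes {..<n}"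
      unfolding \<tau>_def using i less.prems by (intro permutes_compose permutes_swap_id) auto
    have upt: "[0..<n] = [0..<i] @ i # Suc i # [Suc (Suc i)..<n]"
    proof -
      have "[0..<n] = [0..<i] @ [i..<n]"
        using i upt_add_eq_append[of 0 i "n - i"] by simp
      also have "[i..<n] = i # Suc i # [Suc (Suc i)..<n]"
        using i by (metis Suc_lessD upt_conv_Cons)
      finally show ?thesis .
    qed
    have "map \<tau> [0..<i] = map \<sigma> [0..<i]"
      and "map \<tau> [Suc (Suc i)..<n] = map \<sigma> [Suc (Suc i)..<n]"
      and "\<tau> i = \<sigma> (Suc i)" "\<tau> (Suc i) = \<sigma> i"
      by (simp_all add: \<tau>_def transpose_def)
    then have "map \<sigma> [0..<n] = map \<sigma> [0..<i] @ \<sigma> i # \<sigma> (Suc i) # map \<sigma> [Suc (Suc i)..<n]"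
      and "map \<tau> [0..<n] = map \<sigma> [0..<i] @ \<sigma> (Suc i) # \<sigma> i # map \<sigma> [Suc (Suc i)..<n]"
      by (simp_all only: upt map_append list.map)
    then have inv: "inversions (map \<sigma> [0..<n]) = Suc (inversions (map \<tau> [0..<n]))"
      using inversions_swap[OF i(2)] by simp
    have "sign \<tau> = - sign \<sigma>"
    proof -
      have "permutation \<sigma>"
        unfolding permutation_permutes using less.prems by blast
      then show ?thesis
        unfolding \<tau>_def by (simp add: sign_compose permutation_swap_id sign_swap_id)
    qed
    then show ?thesis
      using less.hyps[OF _ \<tau>] inv by simp
  qed
qed

text \<open>The ways to split a list into a subsequence of length \<open>i\<close> and the complementary one. For
  \<open>[0..<n]\<close> they correspond to the \<open>(i, n - i)\<close>-shuffles, and the recursion allows sums over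
  shuffles to be expanded by rewriting.\<close>

fun unshuffles :: "nat \<Rightarrow> 'a list \<Rightarrow> ('a list \<times> 'a list) list" where
  "unshuffles i [] = (if i = 0 then [([], [])] else [])"
| "unshuffles i (x # xs) =
     (if i = 0 then [] else map (\<lambda>(as, bs). (x # as, bs)) (unshuffles (i - 1) xs))
     @ map (\<lambda>(as, bs). (as, x # bs)) (unshuffles i xs)"

lemma unshuffles_sound:
  "(as, bs) \<in> set (unshuffles i xs) \<Longrightarrow> sorted_wrt (<) xs \<Longrightarrow>
    length as = i \<and> mset as + mset bs = mset xs \<and> sorted_wrt (<) as \<and> sorted_wrt (<) bs"
proof (induction xs arbitrary: i as bs)
  case (Cons x xs)
  have sub: "set as' \<subseteq> set xs \<and> set bs' \<subseteq> set xs" if "mset as' + mset bs' = mset xs" for as' bs'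
    using that by (metis set_mset_mset set_mset_union sup_ge1 sup_ge2)
  from Cons.prems(1) show ?case
    using Cons.IH Cons.prems(2) sub by (fastforce split: if_splits)
qed (auto split: if_splits)

lemma unshuffles_complete:
  "sorted_wrt (<) xs \<Longrightarrow> sorted_wrt (<) as \<Longrightarrow> sorted_wrt (<) bs \<Longrightarrow> mset as + mset bs = mset xs
    \<Longrightarrow> (as, bs) \<in> set (unshuffles (length as) (xs :: 'a :: linorder list))"
proof (induction xs arbitrary: as bs)
  case (Cons x xs)
  have set: "set as \<union> set bs = insert x (set xs)"
    using Cons.prems(4) by (metis set_mset_mset set_mset_union list.simps(15))
  have min: "\<forall>y\<in>set as \<union> set bs. x \<le> y"
    using Cons.prems(1) set by auto
  have "x \<in> set as \<or> x \<in> set bs" using set by auto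
  then show ?case
  proof
    assume "x \<in> set as"
    then obtain as' where "as = x # as'"
      using min Cons.prems(2) by (cases as) (auto simp: antisym_conv3 not_less)
    then show ?thesis using Cons.IH[of as' bs] Cons.prems by auto
  next
    assume "x \<in> set bs"
    then obtain bs' where "bs = x # bs'"
      using min Cons.prems(3) by (cases bs) (auto simp: antisym_conv3 not_less)
    then show ?thesis using Cons.IH[of as bs'] Cons.prems by auto
  qed
qed auto

lemma shuffle_perms_bij:
  assumes "i \<le> n"
  shows "bij_betw (\<lambda>\<sigma>. (map \<sigma> [0..<i], map \<sigma> [i..<n])) (shuffle_perms i n)
    (set (unshuffles i [0..<n]))"
proof -
  \<comment> \<open>The inverse sends a split list to the permutation that lists its two parts in turn.\<close>
  define perm where "perm = (\<lambda>(as, bs) k. if k < n then (as @ bs) ! k else (k :: nat))"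
  have split: "[0..<n] = [0..<i] @ [i..<n]"
    using assms upt_add_eq_append[of 0 i "n - i"] by simp
  have forward: "(map \<sigma> [0..<i], map \<sigma> [i..<n]) \<in> set (unshuffles i [0..<n])"
    and left_inverse: "perm (map \<sigma> [0..<i], map \<sigma> [i..<n]) = \<sigma>" if "\<sigma> \<in> shuffle_perms i n" for \<sigma>
  proof -
    have \<sigma>: "\<sigma> permutes {..<n}" "strict_mono_on {..<i} \<sigma>" "strict_mono_on {i..<n} \<sigma>"
      using that by (auto simp: shuffle_perms_def)
    have "mset (map \<sigma> [0..<n]) = mset [0..<n]"
      using \<sigma>(1) by (metis mset_map mset_upt atLeast0LessThan permutes_image_mset)
    then have m: "mset (map \<sigma> [0..<i]) + mset (map \<sigma> [i..<n]) = mset [0..<n]"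
      by (simp add: split)
    have "\<sigma> r < \<sigma> s" if "r < s" "s < i" for r s
      using strict_mono_onD[OF \<sigma>(2)] that by simp
    moreover have "\<sigma> r < \<sigma> s" if "i \<le> r" "r < s" "s < n" for r s
      using strict_mono_onD[OF \<sigma>(3)] that by simp
    ultimately have "sorted_wrt (<) (map \<sigma> [0..<i])" "sorted_wrt (<) (map \<sigma> [i..<n])"
      by (simp_all add: sorted_wrt_iff_nth_less)
    then show "(map \<sigma> [0..<i], map \<sigma> [i..<n]) \<in> set (unshuffles i [0..<n])"
      using unshuffles_complete[OF _ _ _ m] by simp
    show "perm (map \<sigma> [0..<i], map \<sigma> [i..<n]) = \<sigma>"
      using permutes_not_in[OF \<sigma>(1)] assms
      by (auto simp: perm_def fun_eq_iff simp flip: map_append split)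
  qed
  have inverse: "perm p \<in> shuffle_perms i n"
    and right_inverse: "(map (perm p) [0..<i], map (perm p) [i..<n]) = p"
    if "p \<in> set (unshuffles i [0..<n])" for p
  proof -
    obtain as bs where p: "p = (as, bs)" by (cases p)
    have *: "length as = i" "mset as + mset bs = mset [0..<n]"
      "sorted_wrt (<) as" "sorted_wrt (<) bs"
      using unshuffles_sound[of as bs i "[0..<n]"] that p by auto
    then have m: "mset (as @ bs) = mset [0..<n]" by simp
    have len: "length (as @ bs) = n" using mset_eq_length[OF m] by simp
    have set: "set (as @ bs) = {..<n}" using mset_eq_setD[OF m] by (simp only: set_upt atLeast0LessThan)
    have dist: "distinct (as @ bs)" using mset_eq_imp_distinct_iff[OF m] by simp
    have perm_as: "perm p k = as ! k" if "k < i" for k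
      using that *(1) len by (simp add: p perm_def nth_append)
    have perm_bs: "perm p (i + k) = bs ! k" if "k < length bs" for k
      using that *(1) len by (simp add: p perm_def nth_append)
    have "map (perm p) [0..<i] = as"
      by (rule nth_equalityI) (simp_all add: *(1) perm_as)
    moreover have "map (perm p) [i..<n] = bs"
      by (rule nth_equalityI) (use *(1) len in \<open>simp_all add: perm_bs\<close>)
    ultimately show "(map (perm p) [0..<i], map (perm p) [i..<n]) = p" by (simp add: p)
    have "bij_betw ((!) (as @ bs)) {..<n} {..<n}"
      using bij_betw_nth[OF dist refl set[symmetric]] unfolding len .
    moreover have "perm p k = (as @ bs) ! k" if "k \<in> {..<n}" for k
      using that by (simp add: perm_def p)
    ultimately have "bij_betw (perm p) {..<n} {..<n}"
      using bij_betw_cong[of "{..<n}" "perm p" "(!) (as @ bs)"] by blast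
    then have "perm p permutes {..<n}"
      by (rule bij_imp_permutes) (simp add: perm_def p)
    moreover have "strict_mono_on {..<i} (perm p)"
      by (rule strict_mono_onI) (simp add: perm_as sorted_wrt_nth_less[OF *(3)] *(1))
    moreover have "strict_mono_on {i..<n} (perm p)"
    proof (rule strict_mono_onI)
      fix r s assume "r \<in> {i..<n}" "s \<in> {i..<n}" "r < s"
      moreover from this obtain r' s' where "r = i + r'" "s = i + s'"
        by (metis atLeastLessThan_iff le_iff_add)
      ultimately show "perm p r < perm p s"
        using sorted_wrt_nth_less[OF *(4), of r' s'] *(1) len by (simp add: perm_bs)
    qed
    ultimately show "perm p \<in> shuffle_perms i n" by (simp add: shuffle_perms_def)
  qed
  show ?thesis
    by (rule bij_betw_byWitness[where f' = perm]) (use forward left_inverse inverse right_inverse in auto)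
qed

lemma koszul_sign_trivial:
  assumes "\<sigma> permutes {..<length ds}"
    and "\<And>p q. p < length ds \<Longrightarrow> q < length ds \<Longrightarrow> p \<noteq> q \<Longrightarrow> ds ! p * ds ! q = 0"
  shows "koszul_sign ds \<sigma> = 1"
  unfolding koszul_sign_def
proof (rule prod.neutral, clarify)
  fix p q assume "p < q" "q < length ds" "\<sigma> q < \<sigma> p"
  then have "ds ! \<sigma> p * ds ! \<sigma> q = 0"
    using permutes_in_image[OF assms(1)] by (intro assms(2)) auto
  then show "(- 1) ^ (ds ! \<sigma> p * ds ! \<sigma> q) = (1 :: int)" by (simp only: power_0)
qed

text \<open>The contribution of \<open>\<ell>\<^sub>j \<ell>\<^sub>i\<close> to the Lie infinity identity, without Koszul signs.\<close>

definition jacobi_term ::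
  "('k::field \<Rightarrow> 'x \<Rightarrow> 'x) \<Rightarrow> ('x list \<Rightarrow> 'x::ab_group_add) \<Rightarrow> nat \<Rightarrow> nat \<Rightarrow> 'x list \<Rightarrow> 'x" where
  "jacobi_term s l i n xs = (\<Sum>(as, bs)\<in>set (unshuffles i [0..<n]).
     s (of_int ((-1) ^ (inversions (as @ bs) + i * (n - i))))
       (l (l (map ((!) xs) as) # map ((!) xs) bs)))"

lemma shuffle_sum_eq_jacobi_term:
  assumes "length xs = n" "length ds = n" "i \<le> n"
    and "\<And>p q. p < n \<Longrightarrow> q < n \<Longrightarrow> p \<noteq> q \<Longrightarrow> ds ! p * ds ! q = 0"
  shows "(\<Sum>\<sigma>\<in>shuffle_perms i n. s (of_int (chi ds \<sigma> * (-1) ^ (i * (n - i))))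
      (l (l (take i (permute_list \<sigma> xs)) # drop i (permute_list \<sigma> xs)))) = jacobi_term s l i n xs"
proof -
  have upt: "[0..<i] @ [i..<n] = [0..<n]"
    using assms(3) upt_add_eq_append[of 0 i "n - i"] by simp
  have "s (of_int (chi ds \<sigma> * (-1) ^ (i * (n - i))))
      (l (l (take i (permute_list \<sigma> xs)) # drop i (permute_list \<sigma> xs)))
    = s (of_int ((-1) ^ (inversions (map \<sigma> [0..<i] @ map \<sigma> [i..<n]) + i * (n - i))))
       (l (l (map ((!) xs) (map \<sigma> [0..<i])) # map ((!) xs) (map \<sigma> [i..<n])))"
    if "\<sigma> \<in> shuffle_perms i n" for \<sigma>
  proof -
    have \<sigma>: "\<sigma> permutes {..<n}" using that by (simp add: shuffle_perms_def)
    have "chi ds \<sigma> = (-1) ^ inversions (map \<sigma> [0..<i] @ map \<sigma> [i..<n])"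
      using koszul_sign_trivial[of \<sigma> ds] \<sigma> assms
      by (simp add: chi_def sign_eq_inversions upt flip: map_append)
    moreover have "permute_list \<sigma> xs = map ((!) xs) (map \<sigma> [0..<i]) @ map ((!) xs) (map \<sigma> [i..<n])"
      by (simp add: permute_list_def assms(1) upt o_def flip: map_append)
    ultimately show ?thesis by (simp add: power_add)
  qed
  then show ?thesis
    unfolding jacobi_term_def
    by (subst sum.reindex_bij_betw[OF shuffle_perms_bij[OF assms(3)], symmetric]) simp
qed

section \<open>The Lie infinity identities as explicit sums\<close>

text \<open>The sign of the last bracket: \<open>ident\<close> leads from \<open>ident_src\<close> to \<open>ident_tgt\<close>, while the Lie
  infinity identity for four objects makes \<open>\<ell>\<^sub>1 \<ell>\<^sub>4\<close> equal to \<open>ident_src - ident_tgt\<close>.\<close>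

fun linf_of :: "('u::ab_group_add, 'v::ab_group_add, 'w::ab_group_add) components
    \<Rightarrow> ('u \<times> 'v \<times> 'w) list \<Rightarrow> 'u \<times> 'v \<times> 'w" where
  "linf_of D [(x, f, a)] = (diff1 D f, diff2 D a, 0)"
| "linf_of D [(x, f, a), (y, g, b)]
     = (act0 D x y, act1 D x g - act1 D y f, act2 D x b - act2 D y a)"
| "linf_of D [(x, f, a), (y, g, b), (z, h, c)] = (0, jacobi D x y z, 0)"
| "linf_of D [(x, f, a), (y, g, b), (z, h, c), (u, k, e)] = (0, 0, - ident D x y z u)"
| "linf_of D _ = 0"

definition jacobi_sum ::
  "('k::field \<Rightarrow> 'x \<Rightarrow> 'x) \<Rightarrow> ('x list \<Rightarrow> 'x::ab_group_add) \<Rightarrow> nat list \<Rightarrow> 'x list \<Rightarrow> 'x" where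
  "jacobi_sum s l ds xs = (let n = length xs in
     \<Sum>i=1..n. \<Sum>\<sigma>\<in>shuffle_perms i n. s (of_int (chi ds \<sigma> * (-1) ^ (i * (n - i))))
       (l (l (take i (permute_list \<sigma> xs)) # drop i (permute_list \<sigma> xs))))"

text \<open>Koszul signs involve products of degrees of two different entries; they are 1 if at most one
  degree is nonzero.\<close>

definition sparse :: "nat list \<Rightarrow> bool" where
  "sparse ds \<longleftrightarrow> length (filter (\<lambda>d. d \<noteq> 0) ds) \<le> 1"

lemma sparse_products:
  assumes "sparse ds" "p < length ds" "q < length ds" "p \<noteq> q"
  shows "ds ! p * ds ! q = 0"
proof (rule ccontr)
  assume "ds ! p * ds ! q \<noteq> 0"
  then have "{p, q} \<subseteq> {i. i < length ds \<and> ds ! i \<noteq> 0}"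
    using assms by auto
  then have "card {p, q} \<le> length (filter (\<lambda>d. d \<noteq> 0) ds)"
    unfolding length_filter_conv_card by (intro card_mono) auto
  then show False using assms by (simp add: sparse_def)
qed

lemma jacobi_sum_sparse:
  assumes "length ds = length xs" "sparse ds"
  shows "jacobi_sum s l ds xs = (\<Sum>i=1..length xs. jacobi_term s l i (length xs) xs)"
  unfolding jacobi_sum_def Let_def
  by (intro sum.cong refl shuffle_sum_eq_jacobi_term) (use assms sparse_products in auto)

lemma permutes_two: "\<sigma> permutes {..<2 :: nat} \<longleftrightarrow> \<sigma> = id \<or> \<sigma> = transpose 0 1"
proof
  assume \<sigma>: "\<sigma> permutes {..<2 :: nat}"
  have "\<sigma> 0 < 2" "\<sigma> 1 < 2" "\<sigma> 0 \<noteq> \<sigma> 1"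
    using permutes_in_image[OF \<sigma>, of 0] permutes_in_image[OF \<sigma>, of 1] permutes_inj[OF \<sigma>]
    by (auto simp: inj_eq)
  then consider "\<sigma> 0 = 0 \<and> \<sigma> 1 = 1" | "\<sigma> 0 = 1 \<and> \<sigma> 1 = 0" by linarith
  then show "\<sigma> = id \<or> \<sigma> = transpose 0 1"
  proof cases
    case 1
    have "\<sigma> k = k" for k
      using 1 permutes_not_in[OF \<sigma>, of k] by (cases "k = 0 \<or> k = 1") auto
    then show ?thesis by auto
  next
    case 2
    have "\<sigma> k = transpose 0 1 k" for k
      using 2 permutes_not_in[OF \<sigma>, of k] by (cases "k = 0 \<or> k = 1") (auto simp: transpose_def)
    then show ?thesis by blast
  qed
next
  assume "\<sigma> = id \<or> \<sigma> = transpose 0 1"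
  then show "\<sigma> permutes {..<2 :: nat}"
    using permutes_id permutes_swap_id[of "0 :: nat" "{..<2}" 1] by auto
qed

lemma chi_two: "chi [d, e] id = 1" "chi [d, e] (transpose 0 1) = - ((- 1) ^ (d * e))"
proof -
  have no_inversions: "{(p, q). p < q \<and> q < length [d, e] \<and> id q < (id p :: nat)} = {}" by auto
  show "chi [d, e] id = 1" unfolding chi_def koszul_sign_def no_inversions by simp
  have "{(p, q). p < q \<and> q < Suc (Suc 0) \<and> transpose 0 (1::nat) q < transpose 0 1 p} = {(0, 1)}"
    by (auto simp: transpose_def less_Suc_eq)
  then show "chi [d, e] (transpose 0 1) = - ((- 1) ^ (d * e))"
    by (simp add: chi_def koszul_sign_def sign_swap_id mult.commute)
qed

lemma shuffle_perms_two:
  "shuffle_perms 1 2 = {id, transpose 0 1}" "shuffle_perms 2 2 = {id}"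
proof -
  have one: "{..<1 :: nat} = {0}" "{1..<2 :: nat} = {1}" by auto
  show "shuffle_perms 1 2 = {id, transpose 0 1}"
    by (auto simp: shuffle_perms_def permutes_two one strict_mono_on_def)
  have "strict_mono_on {..<2} \<sigma> \<Longrightarrow> \<sigma> 0 < \<sigma> (1 :: nat)" for \<sigma> :: "nat \<Rightarrow> nat"
    by (auto simp: strict_mono_on_def)
  from this[of "transpose 0 1"] show "shuffle_perms 2 2 = {id}"
    by (auto simp: shuffle_perms_def permutes_two strict_mono_on_def)
qed

lemma jacobi_sum_two:
  "jacobi_sum s l [d, e] [p, q] =
     s (- 1) (l [l [p], q]) + s ((- 1) ^ (d * e)) (l [l [q], p]) + s 1 (l [l [p, q]])"
proof -
  have "(1 :: nat) \<noteq> 2" and "{1..2 :: nat} = {1, 2}" and "id \<noteq> transpose 0 (1 :: nat)"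
    by (auto simp: fun_eq_iff transpose_def)
  then show ?thesis
    by (simp add: jacobi_sum_def numeral_2_eq_2[symmetric] shuffle_perms_two shuffle_perms_two[unfolded One_nat_def]
        chi_two[unfolded One_nat_def] permute_list_def upt_rec add.assoc)
qed

context component_maps
begin

abbreviation scale where "scale \<equiv> scale_prod s0 (scale_prod s1 s2)"

lemma scale_signs [simp]: "scale 1 p = p" "scale (- 1) p = - p" "scale r 0 = 0"
  by (cases p; simp add: scale_prod_def zero_prod_def)+

lemma linf_of_zero [simp]: "linf_of D [0] = 0"
  by (simp add: zero_prod_def)

lemma jacobi_sum_one: "jacobi_sum scale (linf_of D) [d] [(x, f, a)] = (d1 (d2 a), 0, 0)"
  by (subst jacobi_sum_sparse) (simp_all add: sparse_def jacobi_term_def)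

text \<open>For two arguments both degrees can be odd with a nonzero result. This is the only case in
  which a Koszul sign is visible.\<close>

lemma jacobi_sum_two_even:
  assumes "even (d * e)"
  shows "jacobi_sum scale (linf_of D) [d, e] [(x, f, a), (y, g, b)] =
    (d1 (x \<rhd> g) - d1 (y \<rhd> f) + \<lbrakk>d1 g, x\<rbrakk> - \<lbrakk>d1 f, y\<rbrakk>,
     d2 (x \<unrhd> b) - d2 (y \<unrhd> a) + y \<rhd> d2 a - x \<rhd> d2 b - d1 f \<rhd> g + d1 g \<rhd> f,
     d1 g \<unrhd> a - d1 f \<unrhd> b)"
  using assms unfolding jacobi_sum_two by (simp add: algebra_simps del: even_mult_iff)

lemma jacobi_sum_two_odd:
  assumes "odd (d * e)"
  shows "jacobi_sum scale (linf_of D) [d, e] [(x, f, a), (y, g, b)] =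
    (d1 (x \<rhd> g) - d1 (y \<rhd> f) - \<lbrakk>d1 g, x\<rbrakk> - \<lbrakk>d1 f, y\<rbrakk>,
     d2 (x \<unrhd> b) - d2 (y \<unrhd> a) + y \<rhd> d2 a + x \<rhd> d2 b - d1 f \<rhd> g - d1 g \<rhd> f,
     - (d1 g \<unrhd> a) - d1 f \<unrhd> b)"
  using assms unfolding jacobi_sum_two by (simp add: algebra_simps del: even_mult_iff)

lemma jacobi_sum_three:
  assumes "sparse ds" "length ds = 3"
  shows "jacobi_sum scale (linf_of D) ds [(x, f, a), (y, g, b), (z, h, c)] =
    (d1 (j x y z) + \<lbrakk>\<lbrakk>x,y\<rbrakk>,z\<rbrakk> + \<lbrakk>\<lbrakk>y,z\<rbrakk>,x\<rbrakk> - \<lbrakk>\<lbrakk>x,z\<rbrakk>,y\<rbrakk>,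
     j (d1 f) y z - j (d1 g) x z + j (d1 h) x y
       + (\<lbrakk>x,y\<rbrakk> \<rhd> h - x \<rhd> y \<rhd> h + y \<rhd> x \<rhd> h) - (\<lbrakk>x,z\<rbrakk> \<rhd> g - x \<rhd> z \<rhd> g + z \<rhd> x \<rhd> g)
       + (\<lbrakk>y,z\<rbrakk> \<rhd> f - y \<rhd> z \<rhd> f + z \<rhd> y \<rhd> f),
     (\<lbrakk>x,y\<rbrakk> \<unrhd> c - x \<unrhd> y \<unrhd> c + y \<unrhd> x \<unrhd> c) - (\<lbrakk>x,z\<rbrakk> \<unrhd> b - x \<unrhd> z \<unrhd> b + z \<unrhd> x \<unrhd> b)
       + (\<lbrakk>y,z\<rbrakk> \<unrhd> a - y \<unrhd> z \<unrhd> a + z \<unrhd> y \<unrhd> a))"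
proof -
  have "{1..3 :: nat} = {1, 2, 3}" by auto
  then show ?thesis
    using assms by (subst jacobi_sum_sparse)
      (simp_all add: jacobi_term_def upt_rec_numeral upt_rec algebra_simps)
qed

lemma jacobi_sum_four:
  assumes "sparse ds" "length ds = 4"
  shows "jacobi_sum scale (linf_of D) ds [(x, f, a), (y, g, b), (z, h, c), (u, k, e)] =
    (0, ident_tgt x y z u - ident_src x y z u - d2 (m x y z u),
     m (d1 f) y z u - m (d1 g) x z u + m (d1 h) x y u - m (d1 k) x y z)"
proof -
  have "{1..4 :: nat} = {1, 2, 3, 4}" by auto
  moreover note flips = jacobi_swap12[of _ "\<lbrakk>_,_\<rbrakk>"] jacobi_swap23[of _ _ "\<lbrakk>_,_\<rbrakk>"]
  ultimately show ?thesis
    using assms by (subst jacobi_sum_sparse)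
      (simp_all add: jacobi_term_def upt_rec_numeral upt_rec ident_tgt_def ident_src_def
        flips algebra_simps)
qed

lemma jacobi_sum_five:
  assumes "sparse ds" "length ds = 5"
  shows "jacobi_sum scale (linf_of D) ds
      [(x, f, a), (y, g, b), (z, h, c), (u, k, e), (v, q, r)] =
    (0, 0,
     (v \<unrhd> m x y z u - u \<unrhd> m x y z v + z \<unrhd> m x y u v - y \<unrhd> m x z u v + x \<unrhd> m y z u v)
     - (m \<lbrakk>x,y\<rbrakk> z u v - m \<lbrakk>x,z\<rbrakk> y u v + m \<lbrakk>x,u\<rbrakk> y z v - m \<lbrakk>x,v\<rbrakk> y z u
         - m x \<lbrakk>y,z\<rbrakk> u v + m x \<lbrakk>y,u\<rbrakk> z v - m x \<lbrakk>y,v\<rbrakk> z u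
         + m x y \<lbrakk>z,u\<rbrakk> v - m x y \<lbrakk>z,v\<rbrakk> u - m x y z \<lbrakk>u,v\<rbrakk>))"
proof -
  have "{1..5 :: nat} = {1, 2, 3, 4, 5}" by auto
  moreover note flips = ident_swap12[of _ "\<lbrakk>_,_\<rbrakk>"] ident_swap23[of _ _ "\<lbrakk>_,_\<rbrakk>"]
    ident_swap34[of _ _ _ "\<lbrakk>_,_\<rbrakk>"]
  ultimately show ?thesis
    using assms by (subst jacobi_sum_sparse)
      (simp_all add: jacobi_term_def upt_rec_numeral upt_rec flips algebra_simps)
qed

end

section \<open>The Lie infinity identities and the equations between components\<close>

context component_maps
begin

text \<open>Every equation is the Lie infinity identity for one choice of degrees.\<close>

lemma jacobi_imp_semistrict:
  assumes jacobi: "\<And>xs ds. xs \<noteq> [] \<Longrightarrow> has_degrees xs ds \<Longrightarrow> jacobi_sum scale (linf_of D) ds xs = 0"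
  shows "semistrict_lie3 s0 s1 s2 D"
proof -
  have d1_d2: "d1 (d2 a) = 0" for a
    using jacobi[of "[(0, 0, a)]" "[2]"]
    by (simp add: has_degrees_def homog_def jacobi_sum_one zero_prod_def)
  have d1_act: "d1 (x \<rhd> f) = \<lbrakk>x, d1 f\<rbrakk>" for x f
    using jacobi[of "[(x, 0, 0), (0, f, 0)]" "[0, 1]"] act0_swap[of "d1 f" x]
    by (simp add: has_degrees_def homog_def jacobi_sum_two_even zero_prod_def)
  have d2_act: "d2 (x \<unrhd> a) = x \<rhd> d2 a" for x a
    using jacobi[of "[(x, 0, 0), (0, 0, a)]" "[0, 2]"]
    by (simp add: has_degrees_def homog_def jacobi_sum_two_even zero_prod_def)
  have d1_act1: "d1 f \<rhd> g = - (d1 g \<rhd> f)" for f g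
  proof -
    have "- (d1 f \<rhd> g) - d1 g \<rhd> f = 0"
      using jacobi[of "[(0, f, 0), (0, g, 0)]" "[1, 1]"]
      by (simp add: has_degrees_def homog_def jacobi_sum_two_odd[unfolded One_nat_def] zero_prod_def)
    then show ?thesis by (metis diff_eq_eq add_0 minus_minus)
  qed
  have d1_act2: "d1 f \<unrhd> a = 0" for f a
    using jacobi[of "[(0, f, 0), (0, 0, a)]" "[1, 2]"]
    by (simp add: has_degrees_def homog_def jacobi_sum_two_even[unfolded One_nat_def] zero_prod_def)
  have d1_jacobi: "d1 (j x y z) = \<lbrakk>\<lbrakk>x,z\<rbrakk>,y\<rbrakk> + \<lbrakk>x,\<lbrakk>y,z\<rbrakk>\<rbrakk> - \<lbrakk>\<lbrakk>x,y\<rbrakk>,z\<rbrakk>" for x y z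
  proof -
    have "d1 (j x y z) + \<lbrakk>\<lbrakk>x,y\<rbrakk>,z\<rbrakk> + \<lbrakk>\<lbrakk>y,z\<rbrakk>,x\<rbrakk> - \<lbrakk>\<lbrakk>x,z\<rbrakk>,y\<rbrakk> = 0"
      using jacobi[of "[(x, 0, 0), (y, 0, 0), (z, 0, 0)]" "[0, 0, 0]"]
      by (simp add: has_degrees_def homog_def jacobi_sum_three sparse_def zero_prod_def)
    then show ?thesis
      unfolding act0_swap[of x "\<lbrakk>y,z\<rbrakk>"] by (simp add: algebra_simps)
  qed
  have act1_bracket: "\<lbrakk>x,y\<rbrakk> \<rhd> f = x \<rhd> y \<rhd> f - y \<rhd> x \<rhd> f - j x y (d1 f)" for x y f
    using jacobi[of "[(x, 0, 0), (y, 0, 0), (0, f, 0)]" "[0, 0, 1]"]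
      jacobi_swap12[of "d1 f" x y] jacobi_swap23[of x "d1 f" y]
    by (simp add: has_degrees_def homog_def jacobi_sum_three sparse_def zero_prod_def
        algebra_simps)
  have act2_bracket: "\<lbrakk>x,y\<rbrakk> \<unrhd> a = x \<unrhd> y \<unrhd> a - y \<unrhd> x \<unrhd> a" for x y a
    using jacobi[of "[(x, 0, 0), (y, 0, 0), (0, 0, a)]" "[0, 0, 2]"]
    by (simp add: has_degrees_def homog_def jacobi_sum_three sparse_def zero_prod_def
        algebra_simps)
  have d2_ident: "d2 (m x y z u) = ident_tgt x y z u - ident_src x y z u" for x y z u
    using jacobi[of "[(x, 0, 0), (y, 0, 0), (z, 0, 0), (u, 0, 0)]" "[0, 0, 0, 0]"]
    by (simp add: has_degrees_def homog_def jacobi_sum_four sparse_def zero_prod_def)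
  have ident_d1: "m x y z (d1 f) = 0" for x y z f
    using jacobi[of "[(x, 0, 0), (y, 0, 0), (z, 0, 0), (0, f, 0)]" "[0, 0, 0, 1]"]
      ident_swap12[of "d1 f" x y z] ident_swap23[of x "d1 f" y z] ident_swap34[of x y "d1 f" z]
    by (simp add: has_degrees_def homog_def jacobi_sum_four sparse_def zero_prod_def)
  have coherence:
    "v \<unrhd> m x y z u - u \<unrhd> m x y z v + z \<unrhd> m x y u v - y \<unrhd> m x z u v + x \<unrhd> m y z u v
     = m \<lbrakk>x,y\<rbrakk> z u v - m \<lbrakk>x,z\<rbrakk> y u v + m \<lbrakk>x,u\<rbrakk> y z v - m \<lbrakk>x,v\<rbrakk> y z u
       - m x \<lbrakk>y,z\<rbrakk> u v + m x \<lbrakk>y,u\<rbrakk> z v - m x \<lbrakk>y,v\<rbrakk> z u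
       + m x y \<lbrakk>z,u\<rbrakk> v - m x y \<lbrakk>z,v\<rbrakk> u - m x y z \<lbrakk>u,v\<rbrakk>" for x y z u v
    using jacobi[of "[(x, 0, 0), (y, 0, 0), (z, 0, 0), (u, 0, 0), (v, 0, 0)]" "[0, 0, 0, 0, 0]"]
    by (simp add: has_degrees_def homog_def jacobi_sum_five sparse_def zero_prod_def)
  show ?thesis
    by (intro semistrict_lie3.intro semistrict_lie3_axioms.intro lie3_up_to_coherence.intro
        lie3_up_to_coherence_axioms.intro component_maps_axioms)
      (rule d1_d2 d1_act d2_act d1_act1 d1_act2 d1_jacobi act1_bracket act2_bracket d2_ident
        ident_d1 coherence)+
qed

lemma linf_of_long: "length xs > 4 \<Longrightarrow> linf_of D xs = 0"
  by (cases "(D, xs)" rule: linf_of.cases) auto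

lemma linf_of_zero_Cons: "linf_of D (0 # xs) = 0"
  by (cases "(D, 0 # xs)" rule: linf_of.cases) (auto simp: zero_prod_def)

lemma linf_of_vertical: "length xs \<ge> 3 \<Longrightarrow> p \<in> set xs \<Longrightarrow> fst p = 0 \<Longrightarrow> linf_of D xs = 0"
  by (cases "(D, xs)" rule: linf_of.cases) (auto simp: zero_prod_def)

lemma fst_linf_of: "length xs \<ge> 3 \<Longrightarrow> fst (linf_of D xs) = 0"
  by (cases "(D, xs)" rule: linf_of.cases) auto

text \<open>The number of entries that have a \<open>V\<^sub>0\<close>-component, which brackets of three or more arguments
  need in every entry.\<close>

definition horizontal :: "('u \<times> 'v \<times> 'w) list \<Rightarrow> nat" where
  "horizontal xs = length (filter (\<lambda>p. fst p \<noteq> 0) xs)"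

lemma horizontal_permute:
  assumes "\<sigma> permutes {..<length xs}"
  shows "horizontal (permute_list \<sigma> xs) = horizontal xs"
  using mset_permute_list[OF assms] unfolding horizontal_def
  by (metis mset_filter size_mset)

text \<open>Brackets of three or more arguments read only \<open>V\<^sub>0\<close>-components and have values without
  \<open>V\<^sub>0\<close>-component. This makes a nested bracket vanish if two entries have no \<open>V\<^sub>0\<close>-component; for
  five entries one such entry suffices. With six or more entries, either one of the two brackets
  has more than four arguments, or both have at least three.\<close>

lemma nested_vanishes:
  assumes "3 \<le> length xs" "1 \<le> i" "i \<le> length xs"
    and "horizontal xs + 2 \<le> length xs \<or> horizontal xs + 1 \<le> length xs \<and> length xs = 5
      \<or> 6 \<le> length xs"
  shows "linf_of D (linf_of D (take i xs) # drop i xs) = 0"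
proof -
  have outer: ?thesis if "p \<in> insert (linf_of D (take i xs)) (set (drop i xs))" "fst p = 0"
    "length xs - i \<ge> 2" for p
    using that by (intro linf_of_vertical[of _ p]) auto
  consider "length xs = 3" | "length xs = 4" | "length xs = 5" | "6 \<le> length xs"
    using assms(1) by linarith
  then show ?thesis
  proof cases
    case 1
    then have i: "i = 1 \<or> i = 2 \<or> i = 3" using assms(2,3) by auto
    from 1 obtain p q r where "xs = [p, q, r]" by (auto simp: length_three)
    then show ?thesis using assms(4) i
      by (cases p; cases q; cases r) (auto simp: horizontal_def zero_prod_def split: if_splits)
  next
    case 2
    then have i: "i = 1 \<or> i = 2 \<or> i = 3 \<or> i = 4" using assms(2,3) by auto
    from 2 obtain p q r t where "xs = [p, q, r, t]" by (auto simp: length_four)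
    then show ?thesis using assms(4) i
      by (cases p; cases q; cases r; cases t)
        (auto simp: horizontal_def zero_prod_def numeral_2_eq_2 numeral_3_eq_3 split: if_splits)
  next
    case 3
    then have i: "i = 1 \<or> i = 2 \<or> i = 3 \<or> i = 4 \<or> i = 5" using assms(2,3) by auto
    from 3 obtain p q r t w where "xs = [p, q, r, t, w]" by (auto simp: numeral_eq_Suc length_Suc_conv)
    then show ?thesis using assms(4) i
      by (cases p; cases q; cases r; cases t; cases w)
        (auto simp: horizontal_def zero_prod_def numeral_eq_Suc split: if_splits)
  next
    case 4
    consider "i \<ge> 5" | "length xs - i \<ge> 4" | "i \<ge> 3" "length xs - i \<ge> 2" using 4 by linarith
    then show ?thesis
    proof cases
      case 1
      then have "linf_of D (take i xs) = 0" using 4 by (intro linf_of_long) auto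
      then show ?thesis by (simp add: linf_of_zero_Cons)
    next
      case 2
      then show ?thesis by (intro linf_of_long) auto
    next
      case 3
      then show ?thesis by (intro outer[OF insertI1]) (auto intro!: fst_linf_of)
    qed
  qed
qed

lemma jacobi_sum_vanishes:
  assumes "3 \<le> length xs"
    and "horizontal xs + 2 \<le> length xs \<or> horizontal xs + 1 \<le> length xs \<and> length xs = 5
      \<or> 6 \<le> length xs"
  shows "jacobi_sum scale (linf_of D) ds xs = 0"
  unfolding jacobi_sum_def Let_def
proof (intro sum.neutral ballI)
  fix i \<sigma> assume i: "i \<in> {1..length xs}" and \<sigma>: "\<sigma> \<in> shuffle_perms i (length xs)"
  have "linf_of D (linf_of D (take i (permute_list \<sigma> xs)) # drop i (permute_list \<sigma> xs)) = 0"
    using assms i \<sigma> by (intro nested_vanishes) (auto simp: shuffle_perms_def horizontal_permute)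
  then show "scale (of_int (chi ds \<sigma> * (-1) ^ (i * (length xs - i))))
      (linf_of D (linf_of D (take i (permute_list \<sigma> xs)) # drop i (permute_list \<sigma> xs))) = 0"
    by simp
qed

text \<open>An entry with a \<open>V\<^sub>0\<close>-component has degree 0.\<close>

lemma sparse_if_horizontal:
  assumes "has_degrees xs ds" "length xs < horizontal xs + 2"
  shows "sparse ds"
proof -
  have "length (filter (\<lambda>d. d \<noteq> 0) ds) + horizontal xs \<le> length xs"
    using assms(1) unfolding has_degrees_def horizontal_def
    by (induction rule: list_all2_induct) (auto simp: homog_def)
  then show ?thesis using assms(2) by (simp add: sparse_def)
qed

end

context semistrict_lie3
begin

text \<open>Either the terms of the sum vanish one by one, or at most one degree is nonzero and the sum is
  known explicitly.\<close>

lemma semistrict_imp_jacobi: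
  assumes "xs \<noteq> []" and deg: "has_degrees xs ds"
  shows "jacobi_sum scale (linf_of D) ds xs = 0"
proof -
  have len: "length ds = length xs"
    using deg by (simp add: has_degrees_def list_all2_lengthD)
  note zero = zero_prod_def
  have "length xs \<ge> 1" using assms(1) by (cases xs) auto
  then consider "length xs = 1" | "length xs = 2" | "length xs = 3" | "length xs = 4" | "length xs = 5"
    | "6 \<le> length xs"
    by linarith
  then show ?thesis
  proof cases
    case 1
    then obtain x f a where [simp]: "xs = [(x, f, a)]"
      by (metis One_nat_def length_0_conv length_Suc_conv prod_cases3)
    from len obtain d where [simp]: "ds = [d]"
      by (auto simp: length_Suc_conv)
    show ?thesis by (simp add: jacobi_sum_one d1_d2 zero)
  next
    case 2
    then obtain x f a y g b where [simp]: "xs = [(x, f, a), (y, g, b)]"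
      unfolding length_two by (metis prod_cases3)
    from len obtain d e where [simp]: "ds = [d, e]"
      by (auto simp: length_Suc_conv)
    have xa: "d \<noteq> 0 \<Longrightarrow> x = 0" "d \<noteq> 1 \<Longrightarrow> f = 0" "d \<noteq> 2 \<Longrightarrow> a = 0"
      and yb: "e \<noteq> 0 \<Longrightarrow> y = 0" "e \<noteq> 1 \<Longrightarrow> g = 0" "e \<noteq> 2 \<Longrightarrow> b = 0"
      using deg by (auto simp: has_degrees_def homog_def)
    show ?thesis
    proof (cases "even (d * e)")
      case True
      consider "d = 0" | "e = 0" "d \<noteq> 0" | "d = 2" "e \<noteq> 0" | "e = 2" "d \<noteq> 0"
        | "f = 0" "a = 0" "x = 0" | "g = 0" "b = 0" "y = 0"
        using xa yb True by fastforce
      then show ?thesis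
        using jacobi_sum_two_even[OF True, of x f a y g b] xa yb
          act0_swap[of x "d1 g"] act0_swap[of y "d1 f"]
        by cases (simp_all add: zero d1_act d2_act d1_act2)
    next
      case False
      then have "d \<noteq> 0" "e \<noteq> 0" "d \<noteq> 2" "e \<noteq> 2" by (auto simp: odd_pos)
      then show ?thesis
        using xa yb d1_act1[of f g]
        by (simp add: jacobi_sum_two_odd[OF False] zero)
    qed
  next
    case 3
    show ?thesis
    proof (cases "horizontal xs + 2 \<le> length xs")
      case True
      then show ?thesis using 3 by (intro jacobi_sum_vanishes) auto
    next
      case False
      then have sparse: "sparse ds" using deg by (intro sparse_if_horizontal) auto
      from 3 obtain x f a y g b z h c where xs: "xs = [(x, f, a), (y, g, b), (z, h, c)]"
        unfolding length_three by (metis prod_cases3)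
      from len 3 have "length ds = 3" by simp
      then obtain d d' d'' where ds: "ds = [d, d', d'']"
        unfolding length_three by blast
      have "x \<noteq> 0 \<Longrightarrow> f = 0 \<and> a = 0" "y \<noteq> 0 \<Longrightarrow> g = 0 \<and> b = 0" "z \<noteq> 0 \<Longrightarrow> h = 0 \<and> c = 0"
        using deg by (auto simp: has_degrees_def homog_def xs ds)
      then consider "f = 0 \<and> a = 0 \<and> g = 0 \<and> b = 0" | "f = 0 \<and> a = 0 \<and> h = 0 \<and> c = 0"
        | "g = 0 \<and> b = 0 \<and> h = 0 \<and> c = 0"
        using False by (auto simp: horizontal_def xs split: if_splits)
      then show ?thesis
        using jacobi_sum_three[OF sparse, of x f a y g b z h c] 3 len act0_swap[of x "\<lbrakk>y,z\<rbrakk>"]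
        by cases (simp_all add: xs zero d1_jacobi jacobi_d1 act2_bracket)
    qed
  next
    case 4
    show ?thesis
    proof (cases "horizontal xs + 2 \<le> length xs")
      case True
      then show ?thesis using 4 by (intro jacobi_sum_vanishes) auto
    next
      case False
      then have sparse: "sparse ds" using deg by (intro sparse_if_horizontal) auto
      from 4 obtain x f a y g b z h c u k e
        where xs: "xs = [(x, f, a), (y, g, b), (z, h, c), (u, k, e)]"
        unfolding length_four by (metis prod_cases3)
      show ?thesis
        using jacobi_sum_four[OF sparse, of x f a y g b z h c u k e] 4 len
        by (simp add: xs zero d2_ident ident_d1 ident_d1_inner)
    qed
  next
    case 5
    show ?thesis
    proof (cases "horizontal xs + 1 \<le> length xs")
      case True
      then show ?thesis using 5 by (intro jacobi_sum_vanishes) auto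
    next
      case False
      then have sparse: "sparse ds" using deg by (intro sparse_if_horizontal) auto
      from 5 obtain p q r s t where "xs = [p, q, r, s, t]"
        by (auto simp: numeral_eq_Suc length_Suc_conv)
      then obtain x f a y g b z h c u k e v l i
        where xs: "xs = [(x, f, a), (y, g, b), (z, h, c), (u, k, e), (v, l, i)]"
        by (metis prod_cases3)
      show ?thesis
        using jacobi_sum_five[OF sparse, of x f a y g b z h c u k e v l i] 5 len
        by (simp add: xs zero ident_coherence)
    qed
  next
    case 6
    then show ?thesis by (intro jacobi_sum_vanishes) auto
  qed
qed

end

section \<open>The Lie infinity algebra of a system of components\<close>

lemma permute_list_transpose:
  assumes "i < length xs" "k < length xs"
  shows "permute_list (transpose i k) xs = xs[i := xs ! k, k := xs ! i]"
  by (rule nth_equalityI)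
    (use assms in \<open>auto simp: permute_list_def transpose_def nth_list_update\<close>)

lemma antisymmetric_permute:
  assumes F: "antisymmetric n F" and \<sigma>: "\<sigma> permutes {..<n}" and xs: "length xs = n"
  shows "F (permute_list \<sigma> xs) = (if sign \<sigma> = 1 then F xs else - F xs)"
proof -
  have F_swap: "F (ys[i := ys ! k, k := ys ! i]) = - F ys" if "length ys = n" "i < n" "k < n" "i \<noteq> k"
    for ys i k
  proof (cases "i < k")
    case True
    then show ?thesis using F that unfolding antisymmetric_def by blast
  next
    case False
    then have "F (ys[k := ys ! i, i := ys ! k]) = - F ys"
      using F that unfolding antisymmetric_def by auto
    then show ?thesis using that(4) by (simp add: list_update_swap)
  qed
  from finite_lessThan \<sigma> show ?thesis
  proof (induction rule: permutes_rev_induct)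
    case id
    then show ?case by simp
  next
    case (swap a b p)
    have "permute_list (p \<circ> transpose a b) xs
      = (permute_list p xs)[a := permute_list p xs ! b, b := permute_list p xs ! a]"
      using swap xs by (simp add: permute_list_compose permutes_swap_id permute_list_transpose)
    moreover have "permutation p"
      unfolding permutation_permutes using swap finite_lessThan by blast
    then have "sign (p \<circ> transpose a b) = - sign p"
      using swap by (simp add: sign_compose permutation_swap_id sign_swap_id)
    ultimately show ?case
      using swap xs F_swap[of "permute_list p xs" a b]
      by (cases p rule: sign_cases) (simp_all add: o_def)
  qed
qed

lemma vector_space_scale_prod:
  "vector_space s \<Longrightarrow> vector_space t \<Longrightarrow> vector_space (scale_prod s t)"
  by (auto simp: vector_space_def scale_prod_def)

lemma homog_ge_three: "d \<ge> 3 \<Longrightarrow> homog d = {0}"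
  by (auto simp: homog_def zero_prod_def)

context component_maps
begin

lemma vector_space_scale: "vector_space scale"
  by (intro vector_space_scale_prod V0.vector_space_axioms V1.vector_space_axioms
      V2.vector_space_axioms)

lemma multilinear_linf_of:
  assumes "p \<in> {1..4}"
  shows "multilinear p scale scale (linf_of D)"
proof -
  have "p = 1 \<or> p = 2 \<or> p = 3 \<or> p = 4" using assms by auto
  then show ?thesis
    by (elim disjE; simp only: multilinear_one multilinear_two multilinear_three multilinear_four
        linear_iff vector_space_scale simp_thms;
        auto simp: scale_prod_def V1.scale_right_diff_distrib V2.scale_right_diff_distrib)
qed

lemma linf_of_degree:
  assumes "length xs \<in> {1..4}" and deg: "has_degrees xs ds"
  shows "linf_of D xs \<in> homog (int (sum_list ds) + int (length xs) - 2)"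
proof -
  consider "length xs = 1" | "length xs = 2" | "length xs = 3" | "length xs = 4"
    using assms(1) by force
  then show ?thesis
  proof cases
    case 1
    then obtain x f a d where [simp]: "xs = [(x, f, a)]" "ds = [d]"
      using deg unfolding has_degrees_def
      by (metis One_nat_def length_0_conv length_Suc_conv list_all2_lengthD prod_cases3)
    show ?thesis using deg by (auto simp: has_degrees_def homog_def)
  next
    case 2
    then obtain x f a y g b where [simp]: "xs = [(x, f, a), (y, g, b)]"
      unfolding length_two by (metis prod_cases3)
    from deg obtain d e where [simp]: "ds = [d, e]"
      by (auto simp: has_degrees_def list_all2_Cons1)
    show ?thesis using deg by (auto simp: has_degrees_def homog_def)
  next
    case 3
    then obtain x f a y g b z h c where [simp]: "xs = [(x, f, a), (y, g, b), (z, h, c)]"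
      unfolding length_three by (metis prod_cases3)
    from deg obtain d e k where [simp]: "ds = [d, e, k]"
      by (auto simp: has_degrees_def list_all2_Cons1)
    have "d \<noteq> 0 \<Longrightarrow> x = 0" "e \<noteq> 0 \<Longrightarrow> y = 0" "k \<noteq> 0 \<Longrightarrow> z = 0"
      using deg by (simp_all add: has_degrees_def homog_def)
    then have "int d + (int e + int k) \<noteq> 0 \<Longrightarrow> j x y z = 0"
      by (cases "d = 0"; cases "e = 0"; cases "k = 0") simp_all
    then show ?thesis by (auto simp: homog_def)
  next
    case 4
    then obtain x f a y g b z h c u q r
      where [simp]: "xs = [(x, f, a), (y, g, b), (z, h, c), (u, q, r)]"
      unfolding length_four by (metis prod_cases3)
    from deg obtain d e k l where [simp]: "ds = [d, e, k, l]"
      by (auto simp: has_degrees_def list_all2_Cons1)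
    have "d \<noteq> 0 \<Longrightarrow> x = 0" "e \<noteq> 0 \<Longrightarrow> y = 0" "k \<noteq> 0 \<Longrightarrow> z = 0" "l \<noteq> 0 \<Longrightarrow> u = 0"
      using deg by (simp_all add: has_degrees_def homog_def)
    then have "int d + (int e + (int k + int l)) \<noteq> 0 \<Longrightarrow> m x y z u = 0"
      by (cases "d = 0"; cases "e = 0"; cases "k = 0"; cases "l = 0") simp_all
    then show ?thesis by (auto simp: homog_def)
  qed
qed

lemma antisymmetric_linf_of:
  "antisymmetric 3 (linf_of D)" "antisymmetric 4 (linf_of D)"
  unfolding antisymmetric_three antisymmetric_four split_paired_All
  by (simp_all, blast intro: jacobi_swap12 jacobi_swap23,
      blast intro: ident_swap12[symmetric] ident_swap23[symmetric] ident_swap34[symmetric])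

text \<open>Ternary and quaternary brackets are nonzero only on entries of degree 0, where graded
  antisymmetry is ordinary antisymmetry. For binary brackets of two odd entries, both sides are
  zero.\<close>

lemma linf_of_graded_antisymmetric:
  assumes deg: "has_degrees xs ds" and \<sigma>: "\<sigma> permutes {..<length xs}"
  shows "linf_of D (permute_list \<sigma> xs) = scale (of_int (chi ds \<sigma>)) (linf_of D xs)"
proof -
  have len: "length ds = length xs"
    using deg by (simp add: has_degrees_def list_all2_lengthD)
  consider "length xs = 0 \<or> length xs > 4" | "length xs = 1" | "length xs = 2"
    | "length xs = 3 \<or> length xs = 4"
    by linarith
  then show ?thesis
  proof cases
    case 1
    then have "linf_of D ys = 0" if "length ys = length xs" for ys
      using that linf_of_long by (cases ys) auto
    then show ?thesis by simp
  next
    case 2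
    have "{..<1 :: nat} = {0}" by auto
    then have "\<sigma> = id" using \<sigma> 2 by (simp add: permutes_sing)
    then show ?thesis
      using koszul_sign_trivial[of id ds] len 2 by (simp add: chi_def permutes_id)
  next
    case 3
    then obtain x f a y g b where xs: "xs = [(x, f, a), (y, g, b)]"
      unfolding length_two by (metis prod_cases3)
    from len 3 have "length ds = 2" by simp
    then obtain d e where ds: "ds = [d, e]"
      unfolding length_two by blast
    consider "\<sigma> = id" | "\<sigma> = transpose 0 1" "even (d * e)" | "\<sigma> = transpose 0 1" "odd (d * e)"
      using \<sigma> 3 permutes_two by auto
    then show ?thesis
    proof cases
      case 1
      then show ?thesis by (simp add: xs ds chi_two[simplified])
    next
      case 2
      then show ?thesis
        using act0_swap[of x y]
        by (simp add: xs ds permute_list_def upt_rec chi_two[unfolded One_nat_def]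
            del: even_mult_iff)
    next
      case 3
      then have "x = 0" "y = 0"
        using deg by (auto simp: xs ds has_degrees_def homog_def odd_pos)
      then show ?thesis
        by (simp add: xs permute_list_def upt_rec 3 flip: zero_prod_def)
    qed
  next
    case 4
    show ?thesis
    proof (cases "\<exists>p\<in>set xs. fst p = 0")
      case True
      then obtain p where p: "p \<in> set xs" "fst p = 0" by blast
      then have "linf_of D (permute_list \<sigma> xs) = 0" "linf_of D xs = 0"
        using 4 \<sigma> by (auto intro!: linf_of_vertical[of _ p])
      then show ?thesis by simp
    next
      case False
      then have "horizontal xs = length xs"
        by (simp add: horizontal_def filter_id_conv[THEN iffD2])
      then have "sparse ds" using deg by (intro sparse_if_horizontal) auto
      then have chi: "chi ds \<sigma> = sign \<sigma>"
        using koszul_sign_trivial[of \<sigma> ds] \<sigma> len sparse_products by (simp add: chi_def)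
      have "linf_of D (permute_list \<sigma> xs)
          = (if sign \<sigma> = 1 then linf_of D xs else - linf_of D xs)"
        using 4 \<sigma> antisymmetric_permute[OF antisymmetric_linf_of(1), of \<sigma> xs]
          antisymmetric_permute[OF antisymmetric_linf_of(2), of \<sigma> xs] by auto
      then show ?thesis
        by (cases \<sigma> rule: sign_cases) (simp_all add: chi)
    qed
  qed
qed

lemma jacobi_sum_unfold:
  "jacobi_sum scale l ds xs = (\<Sum>i=1..length xs. \<Sum>\<sigma>\<in>shuffle_perms i (length xs).
     scale (of_int (chi ds \<sigma> * (-1) ^ (i * (length xs - i))))
       (l (l (take i (permute_list \<sigma> xs)) # drop i (permute_list \<sigma> xs))))"
  by (simp only: jacobi_sum_def Let_def)

end

context semistrict_lie3
begin

theorem linf_of_is_lie_infinity: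
  "is_lie_infinity_3 s0 s1 s2 (linf_of D)"
  "l2_vanishes_on_V1_V1 (linf_of D)"
  "l3_vanishes_in_total_degree_1 (linf_of D)"
proof -
  have outside: "linf_of D xs = 0" if "length xs \<notin> {1..4}" for xs
    using that linf_of_long by (cases xs) auto
  show "is_lie_infinity_3 s0 s1 s2 (linf_of D)"
    unfolding is_lie_infinity_3_def Let_def
  proof (intro conjI allI impI ballI)
    fix n :: nat and xs :: "('u \<times> 'v \<times> 'w) list" and ds
    assume "1 \<le> n" "length xs = n \<and> has_degrees xs ds"
    then show "(\<Sum>i=1..n. \<Sum>\<sigma>\<in>shuffle_perms i n.
        scale (of_int (chi ds \<sigma> * (-1) ^ (i * (n - i))))
          (linf_of D (linf_of D (take i (permute_list \<sigma> xs)) # drop i (permute_list \<sigma> xs)))) = 0"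
      using semistrict_imp_jacobi[of xs ds] unfolding jacobi_sum_unfold by force
  qed (use outside multilinear_linf_of linf_of_degree linf_of_graded_antisymmetric
      V0.vector_space_axioms V1.vector_space_axioms V2.vector_space_axioms in auto)
  show "l2_vanishes_on_V1_V1 (linf_of D)"
    by (auto simp: l2_vanishes_on_V1_V1_def homog_def zero_prod_def)
  show "l3_vanishes_in_total_degree_1 (linf_of D)"
    unfolding l3_vanishes_in_total_degree_1_def
  proof (intro allI impI)
    fix xs :: "('u \<times> 'v \<times> 'w) list" and ds
    assume *: "length xs = 3 \<and> has_degrees xs ds \<and> sum_list ds = 1"
    then obtain p q r where [simp]: "xs = [p, q, r]" unfolding length_three by blast
    have "\<exists>p\<in>set xs. fst p = 0"
      using * by (auto simp: has_degrees_def list_all2_Cons1 homog_def)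
    then show "linf_of D xs = 0" by (auto intro: linf_of_vertical)
  qed
qed

end

section \<open>The components of a given Lie infinity algebra\<close>

definition elementary :: "('u::zero \<times> 'v::zero \<times> 'w::zero) \<Rightarrow> bool" where
  "elementary p \<longleftrightarrow> (\<exists>d\<le>2. p \<in> homog (int d))"

lemma elementary_simps: "elementary (x, 0, 0)" "elementary (0, f, 0)" "elementary (0, 0, a)"
proof -
  have "(x, 0, 0) \<in> homog (int 0)" "(0, f, 0) \<in> homog (int 1)" "(0, 0, a) \<in> homog (int 2)"
    by (simp_all add: homog_def)
  then show "elementary (x, 0, 0)" "elementary (0, f, 0)" "elementary (0, 0, a)"
    unfolding elementary_def by (blast intro: le_numeral_extra(4) one_le_numeral le0 order_refl)+
qed

text \<open>The entries are replaced one after the other by their homogeneous parts; \<open>k\<close> counts those that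
  are still arbitrary.\<close>

lemma multilinear_eq_on_homogeneous:
  fixes F G :: "('u::ab_group_add \<times> 'v::ab_group_add \<times> 'w::ab_group_add) list \<Rightarrow> 'y::ab_group_add"
  assumes F: "multilinear n s t F" and G: "multilinear n s t G"
    and eq: "\<And>xs. length xs = n \<Longrightarrow> \<forall>p\<in>set xs. elementary p \<Longrightarrow> F xs = G xs"
    and xs: "length xs = n"
  shows "F xs = G xs"
proof -
  have "F xs = G xs" if "length xs = n" "k \<le> n" "\<forall>i<n. k \<le> i \<longrightarrow> elementary (xs ! i)" for xs k
    using that
  proof (induction k arbitrary: xs)
    case 0
    then have "\<forall>p\<in>set xs. elementary p" by (metis in_set_conv_nth le0)
    then show ?case using 0 by (intro eq)
  next
    case (Suc k)
    then have k: "k < n" by simp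
    obtain x f a where p: "xs ! k = (x, f, a)" by (metis prod_cases3)
    have add: "H (xs[k := p + q]) = H (xs[k := p]) + H (xs[k := q])"
      if "multilinear n s t H" for p q and H :: "('u \<times> 'v \<times> 'w) list \<Rightarrow> 'y"
      using that Suc.prems(1) k unfolding multilinear_alt linear_iff by blast
    have "H xs = H (xs[k := (x, 0, 0)]) + (H (xs[k := (0, f, 0)]) + H (xs[k := (0, 0, a)]))"
      if H: "multilinear n s t H" for H :: "('u \<times> 'v \<times> 'w) list \<Rightarrow> 'y"
    proof -
      have "H xs = H (xs[k := (x, 0, 0) + ((0, f, 0) + (0, 0, a))])"
        using p by (metis add_Pair add_0 add_0_right list_update_id)
      then show ?thesis by (simp only: add[OF H])
    qed
    moreover have "F (xs[k := e]) = G (xs[k := e])" if "elementary e" for e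
      using Suc.prems that by (intro Suc.IH) (auto simp: nth_list_update le_Suc_eq less_Suc_eq_le)
    ultimately show ?case
      using F G elementary_simps by metis
  qed
  from this[of xs n] xs show ?thesis by auto
qed

definition components_of_linf ::
  "(('u::ab_group_add \<times> 'v::ab_group_add \<times> 'w::ab_group_add) list \<Rightarrow> 'u \<times> 'v \<times> 'w)
    \<Rightarrow> ('u, 'v, 'w) components" where
  "components_of_linf l = \<lparr>
     diff1 = \<lambda>f. fst (l [(0, f, 0)]),
     diff2 = \<lambda>a. fst (snd (l [(0, 0, a)])),
     act0 = \<lambda>x y. fst (l [(x, 0, 0), (y, 0, 0)]),
     act1 = \<lambda>x f. fst (snd (l [(x, 0, 0), (0, f, 0)])),
     act2 = \<lambda>x a. snd (snd (l [(x, 0, 0), (0, 0, a)])),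
     jacobi = \<lambda>x y z. fst (snd (l [(x, 0, 0), (y, 0, 0), (z, 0, 0)])),
     ident = \<lambda>x y z u. - snd (snd (l [(x, 0, 0), (y, 0, 0), (z, 0, 0), (u, 0, 0)])) \<rparr>"

lemma (in component_maps) components_of_linf_of: "components_of_linf (linf_of D) = D"
  by (rule components.equality) (simp_all add: components_of_linf_def)

context
  fixes s0 :: "'k::field \<Rightarrow> 'u::ab_group_add \<Rightarrow> 'u"
    and s1 :: "'k \<Rightarrow> 'v::ab_group_add \<Rightarrow> 'v"
    and s2 :: "'k \<Rightarrow> 'w::ab_group_add \<Rightarrow> 'w"
    and l :: "('u \<times> 'v \<times> 'w) list \<Rightarrow> 'u \<times> 'v \<times> 'w"
  assumes linf: "is_lie_infinity_3 s0 s1 s2 l"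
    and l2: "l2_vanishes_on_V1_V1 l"
    and l3: "l3_vanishes_in_total_degree_1 l"
begin

private abbreviation (input) "S \<equiv> scale_prod s0 (scale_prod s1 s2)"
private abbreviation (input) "E \<equiv> components_of_linf l"

lemma spaces: "vector_space s0" "vector_space s1" "vector_space s2"
  using linf unfolding is_lie_infinity_3_def Let_def by blast+

interpretation V0: vector_space s0 by (rule spaces)
interpretation V1: vector_space s1 by (rule spaces)
interpretation V2: vector_space s2 by (rule spaces)

lemma linf_outside: "length xs \<notin> {1..4} \<Longrightarrow> l xs = 0"
  and linf_multilinear: "p \<in> {1..4} \<Longrightarrow> multilinear p S S l"
  and linf_degree: "length xs \<in> {1..4} \<Longrightarrow> has_degrees xs ds \<Longrightarrow>
    l xs \<in> homog (int (sum_list ds) + int (length xs) - 2)"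
  and linf_antisym: "has_degrees xs ds \<Longrightarrow> \<sigma> permutes {..<length xs} \<Longrightarrow>
    l (permute_list \<sigma> xs) = S (of_int (chi ds \<sigma>)) (l xs)"
  and linf_jacobi: "xs \<noteq> [] \<Longrightarrow> has_degrees xs ds \<Longrightarrow> jacobi_sum S l ds xs = 0"
proof -
  note * = linf[unfolded is_lie_infinity_3_def Let_def]
  show "length xs \<notin> {1..4} \<Longrightarrow> l xs = 0" using * by blast
  show "p \<in> {1..4} \<Longrightarrow> multilinear p S S l" using * by blast
  show "length xs \<in> {1..4} \<Longrightarrow> has_degrees xs ds \<Longrightarrow>
    l xs \<in> homog (int (sum_list ds) + int (length xs) - 2)" using * by blast
  show "has_degrees xs ds \<Longrightarrow> \<sigma> permutes {..<length xs} \<Longrightarrow>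
    l (permute_list \<sigma> xs) = S (of_int (chi ds \<sigma>)) (l xs)" using * by blast
  show "jacobi_sum S l ds xs = 0" if "xs \<noteq> []" "has_degrees xs ds"
  proof -
    have "1 \<le> length xs" using that(1) by (cases xs) auto
    with that(2) * show ?thesis unfolding jacobi_sum_def Let_def by blast
  qed
qed

lemma S_signs: "S 1 p = p" "S (- 1) p = - p"
  by (cases p; simp add: scale_prod_def)+

lemma linf_swap:
  assumes "has_degrees [p, q] [d, e]"
  shows "l [q, p] = S (of_int (- ((- 1) ^ (d * e)))) (l [p, q])"
  using linf_antisym[OF assms, of "transpose 0 1"] permutes_swap_id[of "0 :: nat" "{..<2}" 1]
  by (simp add: numeral_2_eq_2 permute_list_def upt_rec chi_two[unfolded One_nat_def])

lemma linf_antisym_adjacent: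
  assumes "Suc i < length xs" and deg: "has_degrees xs (replicate (length xs) 0)"
  shows "l (xs[i := xs ! Suc i, Suc i := xs ! i]) = - l xs"
proof -
  have \<sigma>: "transpose i (Suc i) permutes {..<length xs}"
    using assms by (intro permutes_swap_id) auto
  have "chi (replicate (length xs) 0) (transpose i (Suc i)) = - 1"
    using koszul_sign_trivial[of "transpose i (Suc i)" "replicate (length xs) 0"] \<sigma>
    by (simp add: chi_def sign_swap_id)
  then show ?thesis
    using linf_antisym[OF deg \<sigma>] assms by (simp add: permute_list_transpose S_signs)
qed

lemma linear_parts:
  assumes "Vector_Spaces.linear S S G"
  shows "Vector_Spaces.linear s0 s0 (\<lambda>x. fst (G (x, 0, 0)))"
    "Vector_Spaces.linear s1 s0 (\<lambda>f. fst (G (0, f, 0)))"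
    "Vector_Spaces.linear s0 s1 (\<lambda>x. fst (snd (G (x, 0, 0))))"
    "Vector_Spaces.linear s1 s1 (\<lambda>f. fst (snd (G (0, f, 0))))"
    "Vector_Spaces.linear s2 s1 (\<lambda>a. fst (snd (G (0, 0, a))))"
    "Vector_Spaces.linear s0 s2 (\<lambda>x. snd (snd (G (x, 0, 0))))"
    "Vector_Spaces.linear s2 s2 (\<lambda>a. snd (snd (G (0, 0, a))))"
proof -
  have add: "G (p + q) = G p + G q" and scale: "G (S r p) = S r (G p)" for p q r
    using assms unfolding linear_iff by blast+
  note adds = add[of "(x, 0, 0)" "(y, 0, 0)" for x y] add[of "(0, f, 0)" "(0, g, 0)" for f g]
    add[of "(0, 0, a)" "(0, 0, b)" for a b]
  note scales = scale[of r "(x, 0, 0)" for r x] scale[of r "(0, f, 0)" for r f]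
    scale[of r "(0, 0, a)" for r a]
  show "Vector_Spaces.linear s0 s0 (\<lambda>x. fst (G (x, 0, 0)))"
    "Vector_Spaces.linear s1 s0 (\<lambda>f. fst (G (0, f, 0)))"
    "Vector_Spaces.linear s0 s1 (\<lambda>x. fst (snd (G (x, 0, 0))))"
    "Vector_Spaces.linear s1 s1 (\<lambda>f. fst (snd (G (0, f, 0))))"
    "Vector_Spaces.linear s2 s1 (\<lambda>a. fst (snd (G (0, 0, a))))"
    "Vector_Spaces.linear s0 s2 (\<lambda>x. snd (snd (G (x, 0, 0))))"
    "Vector_Spaces.linear s2 s2 (\<lambda>a. snd (snd (G (0, 0, a))))"
    using adds scales by (simp_all add: linear_iff spaces scale_prod_def)
qed

lemma linear_minus: "Vector_Spaces.linear s0 s2 F \<Longrightarrow> Vector_Spaces.linear s0 s2 (\<lambda>x. - F x)"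
  by (simp add: linear_iff V2.scale_minus_right)

lemma linf_linear:
  "Vector_Spaces.linear S S (\<lambda>p. l [p])"
  "Vector_Spaces.linear S S (\<lambda>q. l [p, q])" "Vector_Spaces.linear S S (\<lambda>q. l [q, p])"
  "Vector_Spaces.linear S S (\<lambda>r. l [p, q, r])"
  "Vector_Spaces.linear S S (\<lambda>t. l [p, q, r, t])"
  using linf_multilinear[of 1] linf_multilinear[of 2] linf_multilinear[of 3] linf_multilinear[of 4]
  unfolding multilinear_one multilinear_two multilinear_three multilinear_four
  by (simp_all del: split_paired_All)

lemma linf_zero_entry: "l [(0, 0, 0)] = 0" "l [p, (0, 0, 0)] = 0" "l [(0, 0, 0), p] = 0"
  using linf_linear(1-3)[THEN Vector_Spaces.linear.axioms(3), THEN module_hom.zero]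
  by (simp_all add: zero_prod_def)

lemma component_maps_of_linf: "component_maps s0 s1 s2 E"
proof -
  note m1 = linf_linear(1) note m2 = linf_linear(2,3) note m3 = linf_linear(4)
  note m4 = linf_linear(5)
  show ?thesis
  proof (intro component_maps.intro component_maps_axioms.intro spaces)
    show "Vector_Spaces.linear s1 s0 (diff1 E)"
      using linear_parts(2)[OF m1] by (simp add: components_of_linf_def)
    show "Vector_Spaces.linear s2 s1 (diff2 E)"
      using linear_parts(5)[OF m1] by (simp add: components_of_linf_def)
    show "Vector_Spaces.linear s0 s0 (act0 E x)" for x
      using linear_parts(1)[OF m2(1)] by (simp add: components_of_linf_def)
    show "Vector_Spaces.linear s1 s1 (act1 E x)" for x
      using linear_parts(4)[OF m2(1)] by (simp add: components_of_linf_def)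
    show "Vector_Spaces.linear s0 s1 (\<lambda>x. act1 E x f)" for f
      using linear_parts(3)[OF m2(2)] by (simp add: components_of_linf_def)
    show "Vector_Spaces.linear s2 s2 (act2 E x)" for x
      using linear_parts(7)[OF m2(1)] by (simp add: components_of_linf_def)
    show "Vector_Spaces.linear s0 s2 (\<lambda>x. act2 E x a)" for a
      using linear_parts(6)[OF m2(2)] by (simp add: components_of_linf_def)
    show "Vector_Spaces.linear s0 s1 (jacobi E x y)" for x y
      using linear_parts(3)[OF m3] by (simp add: components_of_linf_def)
    show "Vector_Spaces.linear s0 s2 (ident E x y z)" for x y z
      using linear_minus[OF linear_parts(6)[OF m4]] by (simp add: components_of_linf_def)
    show "act0 E y x = - act0 E x y" for x y
      using linf_antisym_adjacent[of 0 "[(x, 0, 0), (y, 0, 0)]"]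
      by (simp add: components_of_linf_def has_degrees_def homog_def)
    show "jacobi E y x z = - jacobi E x y z" "jacobi E x z y = - jacobi E x y z" for x y z
      using linf_antisym_adjacent[of 0 "[(x, 0, 0), (y, 0, 0), (z, 0, 0)]"]
        linf_antisym_adjacent[of 1 "[(x, 0, 0), (y, 0, 0), (z, 0, 0)]"]
      by (simp_all add: components_of_linf_def has_degrees_def homog_def)
    show "ident E y x z u = - ident E x y z u" "ident E x z y u = - ident E x y z u"
      "ident E x y u z = - ident E x y z u" for x y z u
      using linf_antisym_adjacent[of 0 "[(x, 0, 0), (y, 0, 0), (z, 0, 0), (u, 0, 0)]"]
        linf_antisym_adjacent[of 1 "[(x, 0, 0), (y, 0, 0), (z, 0, 0), (u, 0, 0)]"]
        linf_antisym_adjacent[of 2 "[(x, 0, 0), (y, 0, 0), (z, 0, 0), (u, 0, 0)]"]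
      by (simp_all add: components_of_linf_def has_degrees_def homog_def numeral_2_eq_2)
  qed
qed

interpretation E: component_maps s0 s1 s2 E by (rule component_maps_of_linf)

text \<open>A bracket of homogeneous elements is concentrated in one degree. It is then given by one of the
  components, or it vanishes because the degree exceeds 2 or by one of the two vanishing
  conditions.\<close>

lemma linf_of_components: "linf_of E = l"
proof
  fix xs
  have homogeneous: "linf_of E xs = l xs"
    if len: "length xs \<in> {1..4}" and el: "\<forall>p\<in>set xs. elementary p" for xs
  proof -
    have "\<forall>p\<in>set xs. \<exists>d\<le>2. p \<in> homog (int d)" using el by (simp add: elementary_def)
    then obtain \<delta> where \<delta>: "\<And>p. p \<in> set xs \<Longrightarrow> \<delta> p \<le> 2 \<and> p \<in> homog (int (\<delta> p))"
      by metis
    define ds where "ds = map \<delta> xs"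
    have deg: "has_degrees xs ds"
      using \<delta> by (auto simp: has_degrees_def ds_def list_all2_conv_all_nth)
    note l_deg = linf_degree[OF len deg]
    note E_deg = E.linf_of_degree[OF len deg]
    show ?thesis
    proof (cases "sum_list ds + length xs \<ge> 5")
      case True
      then have "homog (int (sum_list ds) + int (length xs) - 2)
          = {0 :: 'u \<times> 'v \<times> 'w}" by (intro homog_ge_three) linarith
      then show ?thesis using l_deg E_deg by simp
    next
      case False
      consider "length xs = 1" | "length xs = 2" | "length xs = 3" | "length xs = 4"
        using len by force
      then show ?thesis
      proof cases
        case 1
        then obtain x f a where xs: "xs = [(x, f, a)]"
          by (metis One_nat_def length_0_conv length_Suc_conv prod_cases3)
        obtain d where ds: "ds = [d]" "d \<le> 2"
          using \<delta>[of "(x, f, a)"] by (simp add: ds_def xs)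
        obtain x' f' a' where l: "l xs = (x', f', a')" by (metis prod_cases3)
        consider "d = 0" | "d = 1" | "d = 2" using ds by linarith
        then show ?thesis
          using deg l_deg l
          by cases (auto simp: xs ds has_degrees_def homog_def components_of_linf_def linf_zero_entry)
      next
        case 2
        then obtain x f a y g b where xs: "xs = [(x, f, a), (y, g, b)]"
          unfolding length_two by (metis prod_cases3)
        obtain d e where ds: "ds = [d, e]" by (simp add: ds_def xs)
        obtain x' f' a' where l: "l xs = (x', f', a')" by (metis prod_cases3)
        have swap: "l [(y, g, b), (x, f, a)] = S (of_int (- ((- 1) ^ (d * e)))) (l xs)"
          using linf_swap deg by (simp add: xs ds)
        consider "d = 0" "e = 0" | "d = 0" "e = 1" | "d = 0" "e = 2" | "d = 1" "e = 0"
          | "d = 2" "e = 0" | "d = 1" "e = 1"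
          using False by (simp add: xs ds) linarith
        then show ?thesis
        proof cases
          case 6
          then have "l xs = 0"
            using l2 deg by (auto simp: xs ds l2_vanishes_on_V1_V1_def has_degrees_def)
          then show ?thesis
            using deg 6 by (simp add: xs ds has_degrees_def homog_def zero_prod_def)
        qed (use deg l_deg l swap in
            \<open>auto simp: xs ds has_degrees_def homog_def components_of_linf_def linf_zero_entry S_signs\<close>)
      next
        case 3
        then obtain x f a y g b z h c where xs: "xs = [(x, f, a), (y, g, b), (z, h, c)]"
          unfolding length_three by (metis prod_cases3)
        obtain d e k where ds: "ds = [d, e, k]" by (simp add: ds_def xs)
        obtain x' f' a' where l: "l xs = (x', f', a')" by (metis prod_cases3)
        show ?thesis
        proof (cases "sum_list ds = 1")
          case True
          then have "l xs = 0"
            using l3 deg 3 unfolding l3_vanishes_in_total_degree_1_def by blast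
          moreover have "\<exists>p\<in>set xs. fst p = 0"
            using deg True by (auto simp: xs ds has_degrees_def homog_def)
          ultimately show ?thesis using 3 by (auto simp: E.linf_of_vertical)
        next
          case sum: False
          then have "d = 0" "e = 0" "k = 0" using False 3 by (auto simp: ds)
          then show ?thesis
            using deg l_deg l
            by (auto simp: xs ds has_degrees_def homog_def components_of_linf_def linf_zero_entry)
        qed
      next
        case 4
        then obtain x f a y g b z h c u q r
          where xs: "xs = [(x, f, a), (y, g, b), (z, h, c), (u, q, r)]"
          unfolding length_four by (metis prod_cases3)
        obtain d e k i where ds: "ds = [d, e, k, i]" by (simp add: ds_def xs)
        obtain x' f' a' where l: "l xs = (x', f', a')" by (metis prod_cases3)
        have "d = 0" "e = 0" "k = 0" "i = 0" using False 4 by (auto simp: ds)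
        then show ?thesis
          using deg l_deg l
          by (auto simp: xs ds has_degrees_def homog_def components_of_linf_def linf_zero_entry)
      qed
    qed
  qed
  show "linf_of E xs = l xs"
  proof (cases "length xs \<in> {1..4}")
    case True
    show ?thesis
      by (rule multilinear_eq_on_homogeneous[OF E.multilinear_linf_of[OF True]
            linf_multilinear[OF True] _ refl]) (use True homogeneous in auto)
  next
    case False
    then show ?thesis
      using linf_outside[OF False] E.linf_of_long[of xs] by (cases xs) auto
  qed
qed

theorem semistrict_of_linf: "semistrict_lie3 s0 s1 s2 E"
  by (rule E.jacobi_imp_semistrict) (simp add: linf_of_components linf_jacobi)

end

theorem linf_of_bij:
  "bij_betw linf_of {D. semistrict_lie3 s0 s1 s2 D}
     {l. is_lie_infinity_3 s0 s1 s2 l \<and> l2_vanishes_on_V1_V1 l \<and> l3_vanishes_in_total_degree_1 l}"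
proof (rule bij_betw_byWitness[where f' = components_of_linf])
  show "\<forall>D\<in>{D. semistrict_lie3 s0 s1 s2 D}. components_of_linf (linf_of D) = D"
    using component_maps.components_of_linf_of
    by (auto simp: semistrict_lie3_def lie3_up_to_coherence_def)
  show "\<forall>l\<in>{l. is_lie_infinity_3 s0 s1 s2 l \<and> l2_vanishes_on_V1_V1 l \<and>
      l3_vanishes_in_total_degree_1 l}. linf_of (components_of_linf l) = l"
    by (auto intro: linf_of_components)
  show "linf_of ` {D. semistrict_lie3 s0 s1 s2 D} \<subseteq> {l. is_lie_infinity_3 s0 s1 s2 l \<and>
      l2_vanishes_on_V1_V1 l \<and> l3_vanishes_in_total_degree_1 l}"
    by (auto intro: semistrict_lie3.linf_of_is_lie_infinity)
  show "components_of_linf ` {l. is_lie_infinity_3 s0 s1 s2 l \<and> l2_vanishes_on_V1_V1 l \<and>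
      l3_vanishes_in_total_degree_1 l} \<subseteq> {D. semistrict_lie3 s0 s1 s2 D}"
    by (auto intro: semistrict_of_linf)
qed

section \<open>The correspondence\<close>

context coordinates
begin

lemma linf_of_matches:
  "same_underlying_complex i0 i1 i2 L (linf_of D)"
  "structure_maps_match i0 i1 i2 L (linf_of D)"
proof -
  have i2: "i2 (x, f, a) = e2 (x, f) a" for x f a by (simp add: e2_def)
  show "same_underlying_complex i0 i1 i2 L (linf_of D)"
    by (simp add: same_underlying_complex_def i2 target_def flip: zero_prod_def)
  show "structure_maps_match i0 i1 i2 L (linf_of D)"
    by (simp add: structure_maps_match_def i2 idt_cell cell_bracket_def zero_prod_def)
qed

end

theorem theorem3p4p2:
  fixes s0 :: "'k::field \<Rightarrow> 'u::ab_group_add \<Rightarrow> 'u"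
    and s1 :: "'k \<Rightarrow> 'v::ab_group_add \<Rightarrow> 'v"
    and s2 :: "'k \<Rightarrow> 'w::ab_group_add \<Rightarrow> 'w"
    and sc0 :: "'k \<Rightarrow> 'a::ab_group_add \<Rightarrow> 'a"
    and sc1 :: "'k \<Rightarrow> 'b::ab_group_add \<Rightarrow> 'b"
    and sc2 :: "'k \<Rightarrow> 'c::ab_group_add \<Rightarrow> 'c"
    and i0 :: "'u \<Rightarrow> 'a"
    and i1 :: "'u \<times> 'v \<Rightarrow> 'b"
    and i2 :: "'u \<times> 'v \<times> 'w \<Rightarrow> 'c"
  assumes "vector_space s0" "vector_space s1" "vector_space s2"
    and "vector_space sc0" "vector_space sc1" "vector_space sc2"
    and "Vector_Spaces.linear s0 sc0 i0" "bij i0"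
    and "Vector_Spaces.linear (scale_prod s0 s1) sc1 i1" "bij i1"
    and "Vector_Spaces.linear (scale_prod s0 (scale_prod s1 s2)) sc2 i2" "bij i2"
  shows "\<exists>\<Phi> :: ('a, 'b, 'c) lie3 \<Rightarrow> (('u \<times> 'v \<times> 'w) list \<Rightarrow> 'u \<times> 'v \<times> 'w).
    bij_betw \<Phi>
      {L. is_lie_3_algebra sc0 sc1 sc2 L \<and> identified_via i0 i1 i2 L}
      {l. is_lie_infinity_3 s0 s1 s2 l \<and>
          l2_vanishes_on_V1_V1 l \<and> l3_vanishes_in_total_degree_1 l} \<and>
    (\<forall>L. is_lie_3_algebra sc0 sc1 sc2 L \<and> identified_via i0 i1 i2 L \<longrightarrow>
       same_underlying_complex i0 i1 i2 L (\<Phi> L) \<and> structure_maps_match i0 i1 i2 L (\<Phi> L))"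
proof -
  interpret splitting s0 s1 s2 sc0 sc1 sc2 i0 i1 i2
    by (rule splitting.intro) (rule assms)+
  let ?\<Phi> = "linf_of \<circ> components_of"
  have "bij_betw ?\<Phi>
      {L. is_lie_3_algebra sc0 sc1 sc2 L \<and> identified_via i0 i1 i2 L}
      {l. is_lie_infinity_3 s0 s1 s2 l \<and>
          l2_vanishes_on_V1_V1 l \<and> l3_vanishes_in_total_degree_1 l}"
    by (rule bij_betw_trans[OF components_of_bij linf_of_bij])
  moreover have "same_underlying_complex i0 i1 i2 L (?\<Phi> L) \<and> structure_maps_match i0 i1 i2 L (?\<Phi> L)"
    if "is_lie_3_algebra sc0 sc1 sc2 L" "identified_via i0 i1 i2 L" for L
    using coordinates.linf_of_matches[OF coordinates_of[OF that]] by simp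
  ultimately show ?thesis by blast
qed

end
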